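(* Let $\mathcal{C}$ be a class of analytic conjugacy of plane branches. Then $\mathcal{C}$ is complete if and only if $\mathcal{C}$ is formally complete.
   Context: A plane branch is a reduced irreducible germ of analytic curve $\Gamma$ at $(0,0)\in\mathbb{C}^2$. Two branches $\Gamma_1,\Gamma_2$ are analytically conjugated if there is a germ of biholomorphism $\varphi\in\mathrm{Diff}(\mathbb{C}^2,0)$ (fixing the origin) with $\varphi(\Gamma_1)=\Gamma_2$; a class of analytic conjugacy is an equivalence class for this relation. A singular holomorphic vector field is a germ $X=A\,\partial/\partial x+B\,\partial/\partial y$ with $A,B\in\mathbb{C}\{x,y\}$ and $A(0,0)=B(0,0)=0$. A singular formal vector field is a derivation of $\mathbb{C}[[x,y]]$ preserving the maximal ideal $\mathfrak{m}$, i.e. $X=A\,\partial/\partial x+B\,\partial/\partial y$ with $A,B\in\mathfrak{m}$. Its exponential (time $1$ flow) is $\exp(X)(x,y)=\left(\sum_{j\ge 0}X^j(x)/j!,\ \sum_{j\ge 0}X^j(y)/j!\right)$, a formal diffeomorphism (a germ of biholomorphism when $X$ is holomorphic). A formal diffeomorphism $\psi$ conjugates the branches $\Gamma_1,\Gamma_2$ (written $\psi(\Gamma_1)=\Gamma_2$) if, for irreducible parametrizations $\alpha(t),\beta(t)$ of $\Gamma_1,\Gamma_2$, there is a formal power series $\rho(t)$ with $\rho(0)=0$, $\rho'(0)\neq 0$ such that $\psi\circ\alpha=\beta\circ\rho$. $\mathcal{C}$ is complete if for any $\Gamma_1,\Gamma_2\in\mathcal{C}$ there is a singular holomorphic vector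 field $X$ with $\exp(X)(\Gamma_1)=\Gamma_2$ (one says $\Gamma_1,\Gamma_2$ are connected by a geodesic). $\mathcal{C}$ is formally complete if for any $\Gamma_1,\Gamma_2\in\mathcal{C}$ there is a singular formal vector field $X$ such that $\exp(X)$ conjugates $\Gamma_1$ and $\Gamma_2$. *)

theory Defs
  imports "HOL-Analysis.Analysis"
begin

text \<open>
  The ring of formal power series in \<open>x, y\<close> is represented as \<open>\<complex>[[x]][[y]]\<close>: the outer series
  is in \<open>y\<close>, the inner ones are in \<open>x\<close>.
\<close>

type_synonym fps2 = "complex fps fps"

definition coeff2 :: "fps2 \<Rightarrow> nat \<Rightarrow> nat \<Rightarrow> complex" where
  "coeff2 f i j = fps_nth (fps_nth f j) i"

definition var_x :: fps2 where
  "var_x = fps_const fps_X"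

definition var_y :: fps2 where
  "var_y = fps_X"

definition deriv_x :: "fps2 \<Rightarrow> fps2" where
  "deriv_x f = Abs_fps (\<lambda>j. fps_deriv (fps_nth f j))"

definition deriv_y :: "fps2 \<Rightarrow> fps2" where
  "deriv_y f = fps_deriv f"

definition convergent2 :: "fps2 \<Rightarrow> bool" where
  "convergent2 f \<longleftrightarrow>
     (\<exists>r::real>0. (\<lambda>(i, j). norm (coeff2 f i j) * r ^ (i + j)) summable_on UNIV)"

text \<open>Only meaningful for convergent series and points close to the origin.\<close>

definition eval2 :: "fps2 \<Rightarrow> complex \<times> complex \<Rightarrow> complex" where
  "eval2 f p = (\<Sum>\<^sub>\<infinity>(i, j)\<in>UNIV. coeff2 f i j * fst p ^ i * snd p ^ j)"

text \<open>
  The formal substitution \<open>f(a(t), b(t))\<close>. Since \<open>a\<close> and \<open>b\<close> are assumed to vanish at \<open>0\<close>, the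
  monomial \<open>x\<^sup>i y\<^sup>j\<close> does not contribute to the coefficient of \<open>t\<^sup>n\<close> if \<open>i + j > n\<close>.
\<close>

definition subst2 :: "fps2 \<Rightarrow> complex fps \<times> complex fps \<Rightarrow> complex fps" where
  "subst2 f \<alpha> = Abs_fps (\<lambda>n. \<Sum>(i, j) | i + j \<le> n.
     coeff2 f i j * fps_nth (fst \<alpha> ^ i * snd \<alpha> ^ j) n)"


definition germ_eq :: "(complex \<times> complex) set \<Rightarrow> (complex \<times> complex) set \<Rightarrow> bool" where
  "germ_eq A B \<longleftrightarrow> (\<forall>\<^sub>F p in nhds 0. p \<in> A \<longleftrightarrow> p \<in> B)"

lemma equivp_germ_eq: "equivp germ_eq"
proof (rule equivpI)
  show "reflp germ_eq"
    by (simp add: reflp_def germ_eq_def)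
  show "symp germ_eq"
    unfolding symp_def germ_eq_def by (auto elim: eventually_mono)
  show "transp germ_eq"
    unfolding transp_def germ_eq_def
  proof (intro allI impI)
    fix A B C :: "(complex \<times> complex) set"
    assume "\<forall>\<^sub>F p in nhds 0. (p \<in> A) = (p \<in> B)" "\<forall>\<^sub>F p in nhds 0. (p \<in> B) = (p \<in> C)"
    then show "\<forall>\<^sub>F p in nhds 0. (p \<in> A) = (p \<in> C)"
      by eventually_elim simp
  qed
qed

quotient_type plane_germ = "(complex \<times> complex) set" / germ_eq
  morphisms rep_germ germ_of
  by (rule equivp_germ_eq)

text \<open>
  The image of a germ is the germ of the image of \<open>A \<inter> ball 0 \<delta>\<close> for small \<open>\<delta>\<close>. Cutting \<open>A\<close> down
  first is necessary: a point far from the origin may be sent close to the origin.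
\<close>

lift_definition maps_germ ::
  "(complex \<times> complex \<Rightarrow> complex \<times> complex) \<Rightarrow> plane_germ \<Rightarrow> plane_germ \<Rightarrow> bool" is
  "\<lambda>F A B. \<forall>\<^sub>F \<delta> in at_right (0::real). germ_eq (F ` (A \<inter> ball 0 \<delta>)) B"
proof -
  fix F :: "complex \<times> complex \<Rightarrow> complex \<times> complex" and A A' B B'
  assume A: "germ_eq A A'" and B: "germ_eq B B'"
  from A obtain e where e: "e > 0" "\<And>p. dist p 0 < e \<Longrightarrow> p \<in> A \<longleftrightarrow> p \<in> A'"
    unfolding germ_eq_def eventually_nhds_metric by blast
  have cut: "A \<inter> ball 0 \<delta> = A' \<inter> ball 0 \<delta>" if "\<delta> < e" for \<delta>
    using e(2) that by (force simp: dist_commute)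
  have "\<forall>\<^sub>F \<delta> in at_right (0::real). \<delta> < e"
    using e(1) by (auto simp: eventually_at_right_field)
  then have "\<forall>\<^sub>F \<delta> in at_right (0::real).
      germ_eq (F ` (A \<inter> ball 0 \<delta>)) B \<longleftrightarrow> germ_eq (F ` (A' \<inter> ball 0 \<delta>)) B'"
  proof eventually_elim
    case (elim \<delta>)
    show ?case
      unfolding cut[OF elim]
      using B equivp_symp[OF equivp_germ_eq] equivp_transp[OF equivp_germ_eq] by blast
  qed
  then show "(\<forall>\<^sub>F \<delta> in at_right 0. germ_eq (F ` (A \<inter> ball 0 \<delta>)) B) =
             (\<forall>\<^sub>F \<delta> in at_right 0. germ_eq (F ` (A' \<inter> ball 0 \<delta>)) B')"
    by (rule eventually_subst)
qed

definition unit_conv2 :: "fps2 \<Rightarrow> bool" where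
  "unit_conv2 f \<longleftrightarrow> convergent2 f \<and> (\<exists>g. convergent2 g \<and> f * g = 1)"

text \<open>Irreducibility in the ring of convergent power series (not in the formal ring).\<close>

definition irreducible_conv2 :: "fps2 \<Rightarrow> bool" where
  "irreducible_conv2 f \<longleftrightarrow> convergent2 f \<and> f \<noteq> 0 \<and> \<not> unit_conv2 f \<and>
     (\<forall>g h. convergent2 g \<and> convergent2 h \<and> f = g * h \<longrightarrow> unit_conv2 g \<or> unit_conv2 h)"

definition plane_branch :: "plane_germ \<Rightarrow> bool" where
  "plane_branch \<Gamma> \<longleftrightarrow> (\<exists>f. irreducible_conv2 f \<and> \<Gamma> = germ_of {p. eval2 f p = 0})"


text \<open>A pair of series stands both for a map of the plane and for a vector field.\<close>

definition eval_map :: "fps2 \<times> fps2 \<Rightarrow> complex \<times> complex \<Rightarrow> complex \<times> complex" where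
  "eval_map \<phi> p = (eval2 (fst \<phi>) p, eval2 (snd \<phi>) p)"

definition holomorphic_map_germ :: "fps2 \<times> fps2 \<Rightarrow> bool" where
  "holomorphic_map_germ \<phi> \<longleftrightarrow> convergent2 (fst \<phi>) \<and> convergent2 (snd \<phi>) \<and>
     coeff2 (fst \<phi>) 0 0 = 0 \<and> coeff2 (snd \<phi>) 0 0 = 0"

definition biholomorphism_germ :: "fps2 \<times> fps2 \<Rightarrow> bool" where
  "biholomorphism_germ \<phi> \<longleftrightarrow> holomorphic_map_germ \<phi> \<and>
     (\<exists>\<psi>. holomorphic_map_germ \<psi> \<and>
        (\<forall>\<^sub>F p in nhds 0. eval_map \<psi> (eval_map \<phi> p) = p \<and> eval_map \<phi> (eval_map \<psi> p) = p))"

definition analytic_conjugacy :: "(plane_germ \<times> plane_germ) set" where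
  "analytic_conjugacy = {(\<Gamma>1, \<Gamma>2). plane_branch \<Gamma>1 \<and> plane_branch \<Gamma>2 \<and>
     (\<exists>\<phi>. biholomorphism_germ \<phi> \<and> maps_germ (eval_map \<phi>) \<Gamma>1 \<Gamma>2)}"

definition analytic_conjugacy_class :: "plane_germ set \<Rightarrow> bool" where
  "analytic_conjugacy_class \<C> \<longleftrightarrow> \<C> \<in> {\<Gamma>. plane_branch \<Gamma>} // analytic_conjugacy"


definition singular_formal_vf :: "fps2 \<times> fps2 \<Rightarrow> bool" where
  "singular_formal_vf X \<longleftrightarrow> coeff2 (fst X) 0 0 = 0 \<and> coeff2 (snd X) 0 0 = 0"

definition singular_holomorphic_vf :: "fps2 \<times> fps2 \<Rightarrow> bool" where
  "singular_holomorphic_vf X \<longleftrightarrow>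
     singular_formal_vf X \<and> convergent2 (fst X) \<and> convergent2 (snd X)"

definition vf_apply :: "fps2 \<times> fps2 \<Rightarrow> fps2 \<Rightarrow> fps2" where
  "vf_apply X f = fst X * deriv_x f + snd X * deriv_y f"

text \<open>
  \<open>\<Sum>n. X\<^sup>n(f) / n!\<close>, coefficient by coefficient. If \<open>X\<close> has a nonzero linear part, this sum is
  infinite in each coefficient; it converges in \<open>\<complex>\<close> because \<open>X\<close> acts on the finite-dimensional
  spaces of jets.
\<close>

definition exp_vf_apply :: "fps2 \<times> fps2 \<Rightarrow> fps2 \<Rightarrow> fps2" where
  "exp_vf_apply X f =
     Abs_fps (\<lambda>j. Abs_fps (\<lambda>i. \<Sum>n. coeff2 ((vf_apply X ^^ n) f) i j / fact n))"

definition exp_vf :: "fps2 \<times> fps2 \<Rightarrow> fps2 \<times> fps2" where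
  "exp_vf X = (exp_vf_apply X var_x, exp_vf_apply X var_y)"


definition parametrization :: "complex fps \<times> complex fps \<Rightarrow> plane_germ \<Rightarrow> bool" where
  "parametrization \<alpha> \<Gamma> \<longleftrightarrow>
     fps_conv_radius (fst \<alpha>) > 0 \<and> fps_conv_radius (snd \<alpha>) > 0 \<and>
     fps_nth (fst \<alpha>) 0 = 0 \<and> fps_nth (snd \<alpha>) 0 = 0 \<and>
     (\<forall>\<^sub>F \<delta> in at_right (0::real).
        germ_of ((\<lambda>t. (eval_fps (fst \<alpha>) t, eval_fps (snd \<alpha>) t)) ` ball 0 \<delta>) = \<Gamma>)"

text \<open>
  Irreducible means that \<open>\<alpha>\<close> does not factor through a series \<open>\<sigma>\<close> of order at least two.
\<close>

definition irreducible_parametrization ::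
    "complex fps \<times> complex fps \<Rightarrow> plane_germ \<Rightarrow> bool" where
  "irreducible_parametrization \<alpha> \<Gamma> \<longleftrightarrow> parametrization \<alpha> \<Gamma> \<and>
     (\<forall>\<gamma>1 \<gamma>2 \<sigma>. fps_conv_radius \<gamma>1 > 0 \<and> fps_conv_radius \<gamma>2 > 0 \<and> fps_conv_radius \<sigma> > 0 \<and>
        fps_nth \<sigma> 0 = 0 \<and> \<alpha> = (\<gamma>1 oo \<sigma>, \<gamma>2 oo \<sigma>) \<longrightarrow> fps_nth \<sigma> 1 \<noteq> 0)"

text \<open>
  The condition does not depend on the choice of the irreducible parametrizations, which are
  unique up to an analytic change of parameter.
\<close>

definition formally_conjugates :: "fps2 \<times> fps2 \<Rightarrow> plane_germ \<Rightarrow> plane_germ \<Rightarrow> bool" where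
  "formally_conjugates \<psi> \<Gamma>1 \<Gamma>2 \<longleftrightarrow>
     (\<exists>\<alpha> \<beta>. irreducible_parametrization \<alpha> \<Gamma>1 \<and> irreducible_parametrization \<beta> \<Gamma>2 \<and>
        (\<exists>\<rho>. fps_nth \<rho> 0 = 0 \<and> fps_nth \<rho> 1 \<noteq> 0 \<and>
           (subst2 (fst \<psi>) \<alpha>, subst2 (snd \<psi>) \<alpha>) = (fst \<beta> oo \<rho>, snd \<beta> oo \<rho>)))"

definition complete_class :: "plane_germ set \<Rightarrow> bool" where
  "complete_class \<C> \<longleftrightarrow> (\<forall>\<Gamma>1\<in>\<C>. \<forall>\<Gamma>2\<in>\<C>.
     \<exists>X. singular_holomorphic_vf X \<and> maps_germ (eval_map (exp_vf X)) \<Gamma>1 \<Gamma>2)"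

definition formally_complete_class :: "plane_germ set \<Rightarrow> bool" where
  "formally_complete_class \<C> \<longleftrightarrow> (\<forall>\<Gamma>1\<in>\<C>. \<forall>\<Gamma>2\<in>\<C>.
     \<exists>X. singular_formal_vf X \<and> formally_conjugates (exp_vf X) \<Gamma>1 \<Gamma>2)"

end

theory Submission
  imports Defs "HOL-Complex_Analysis.Complex_Analysis"
    "HOL-Computational_Algebra.Fundamental_Theorem_Algebra"
begin

text \<open>
  If a formal \<open>exp(X)\<close> sends \<open>\<Gamma>\<^sub>1\<close> to \<open>\<Gamma>\<^sub>2 \<noteq> \<Gamma>\<^sub>1\<close>, a truncation \<open>E = exp(X\<^sub>N)\<close> is holomorphic and sends
  \<open>\<Gamma>\<^sub>1\<close> to a branch with high contact with \<open>\<Gamma>\<^sub>2\<close>. Every series of large order in the parameter of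
  \<open>\<Gamma>\<^sub>2\<close> is the restriction of a convergent function (Dedekind's conductor formula), so there is a
  convergent \<open>f\<close>, tangent to the identity, that fixes \<open>\<Gamma>\<^sub>1\<close> pointwise and sends \<open>\<Gamma>\<^sub>2\<close> to \<open>E(\<Gamma>\<^sub>1)\<close>.
  Then \<open>f\<^sup>-\<^sup>1 \<circ> E \<circ> f = exp(f\<^sup>* X\<^sub>N)\<close> sends \<open>\<Gamma>\<^sub>1\<close> to \<open>\<Gamma>\<^sub>2\<close>. Conversely, if a holomorphic \<open>exp(X)\<close> sends
  \<open>\<Gamma>\<^sub>1\<close> to \<open>\<Gamma>\<^sub>2\<close>, it maps an irreducible parametrization of \<open>\<Gamma>\<^sub>1\<close>, which exists by Puiseux's theorem,
  to one of \<open>\<Gamma>\<^sub>2\<close>.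
\<close>


section \<open>Formal substitution in two variables\<close>

text \<open>Composing \<open>E\<close> with a correcting map on one side would leave the image of
  the exponential, which is not closed under composition; conjugation does not leave it. This is why
  \<open>f\<close> has to fix the source pointwise: it may move the target only. It is therefore
  built from a convergent equation \<open>F\<close> of one branch that does not vanish on the other;
  if no such equation exists in either direction, the branches are equal. The correction on the
  target is a product of \<open>F\<close> and a second factor in the maximal ideal, whence the
  tangency to the identity, and the order of truncation has to exceed the conductor plus the order
  of \<open>F\<close> along the target. No inverse of \<open>f\<close> is ever constructed: vector
  fields are pulled back by inverting the Jacobian matrix, and \<open>f\<close> is cancelled on
  parametrizations, where a map tangent to the identity is injective. All this takes place among
  power series along parametrizations; sets of points enter only where a germ is translated into a
  parametrization or back.\<close>

lemma fps2_eqI: "(\<And>i j. coeff2 f i j = coeff2 g i j) \<Longrightarrow> f = g"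
  by (auto simp: coeff2_def intro!: fps_ext)

lemma coeff2_0 [simp]: "coeff2 0 i j = 0"
  by (simp add: coeff2_def)

lemma coeff2_add [simp]: "coeff2 (f + g) i j = coeff2 f i j + coeff2 g i j"
  by (simp add: coeff2_def)

lemma coeff2_diff [simp]: "coeff2 (f - g) i j = coeff2 f i j - coeff2 g i j"
  by (simp add: coeff2_def)

lemma coeff2_uminus [simp]: "coeff2 (- f) i j = - coeff2 f i j"
  by (simp add: coeff2_def)

lemma coeff2_sum: "coeff2 (sum f A) i j = (\<Sum>a\<in>A. coeff2 (f a) i j)"
  by (simp add: coeff2_def fps_sum_nth)

lemma coeff2_mult:
  "coeff2 (f * g) i j = (\<Sum>b\<le>j. \<Sum>a\<le>i. coeff2 f a b * coeff2 g (i - a) (j - b))"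
  by (simp add: coeff2_def fps_mult_nth fps_sum_nth atLeast0AtMost)

abbreviation const2 :: "complex \<Rightarrow> fps2" where
  "const2 c \<equiv> fps_const (fps_const c)"

lemma coeff2_Abs [simp]: "coeff2 (Abs_fps (\<lambda>j. Abs_fps (\<lambda>i. h i j))) i j = h i j"
  by (simp add: coeff2_def)

lemma coeff2_const2_mult [simp]: "coeff2 (const2 c * f) i j = c * coeff2 f i j"
  by (simp add: coeff2_def)

lemma coeff2_fps_const: "coeff2 (fps_const a) i j = (if j = 0 then fps_nth a i else 0)"
  by (simp add: coeff2_def)

lemma coeff2_1: "coeff2 1 i j = (if i = 0 \<and> j = 0 then 1 else 0)"
  by (auto simp: coeff2_def)

lemma coeff2_var_x: "coeff2 var_x i j = (if i = 1 \<and> j = 0 then 1 else 0)"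
  by (auto simp: coeff2_def var_x_def)

lemma coeff2_var_y: "coeff2 var_y i j = (if i = 0 \<and> j = 1 then 1 else 0)"
  by (auto simp: coeff2_def var_y_def fps_X_def)

lemma coeff2_var_x_power_mult:
  "coeff2 (var_x ^ a * f) i j = (if i < a then 0 else coeff2 f (i - a) j)"
  by (auto simp: coeff2_def var_x_def fps_const_power fps_X_power_mult_nth)

lemma coeff2_var_y_power_mult:
  "coeff2 (var_y ^ b * f) i j = (if j < b then 0 else coeff2 f i (j - b))"
  by (auto simp: coeff2_def var_y_def fps_X_power_mult_nth)

definition mon :: "nat \<Rightarrow> nat \<Rightarrow> fps2" where
  "mon a b = var_x ^ a * var_y ^ b"

lemma coeff2_mon: "coeff2 (mon a b) i j = (if i = a \<and> j = b then 1 else 0)"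
proof -
  have "coeff2 (mon a b) i j = coeff2 (var_x ^ a * (var_y ^ b * 1)) i j"
    by (simp add: mon_def)
  then show ?thesis
    unfolding coeff2_var_x_power_mult coeff2_var_y_power_mult coeff2_1 by auto
qed

lemma coeff2_deriv_x: "coeff2 (deriv_x f) i j = of_nat (Suc i) * coeff2 f (Suc i) j"
  by (simp add: coeff2_def deriv_x_def)

lemma coeff2_deriv_y: "coeff2 (deriv_y f) i j = of_nat (Suc j) * coeff2 f i (Suc j)"
proof -
  have *: "fps_nth (of_nat k * g) i = of_nat k * fps_nth g i" for k and g :: "complex fps"
    by (induction k) (simp_all add: algebra_simps)
  show ?thesis
    unfolding coeff2_def deriv_y_def fps_deriv_nth Suc_eq_plus1[symmetric] by (rule *)
qed

section \<open>The filtration by order of vanishing, and the maximal ideal\<close>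

definition vanish :: "nat \<Rightarrow> fps2 \<Rightarrow> bool" where
  "vanish N f \<longleftrightarrow> (\<forall>i j. i + j < N \<longrightarrow> coeff2 f i j = 0)"

lemma vanish_0 [simp]: "vanish 0 f" "vanish N 0"
  by (simp_all add: vanish_def)

lemma vanish_Suc_0: "vanish (Suc 0) f \<longleftrightarrow> coeff2 f 0 0 = 0"
  by (auto simp: vanish_def)

lemma vanish_add: "vanish N f \<Longrightarrow> vanish N g \<Longrightarrow> vanish N (f + g)"
  by (simp add: vanish_def)

lemma vanish_diff: "vanish N f \<Longrightarrow> vanish N g \<Longrightarrow> vanish N (f - g)"
  by (simp add: vanish_def)

lemma vanish_uminus: "vanish N f \<Longrightarrow> vanish N (- f)"
  by (simp add: vanish_def)

lemma vanish_mono: "vanish N f \<Longrightarrow> M \<le> N \<Longrightarrow> vanish M f"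
  by (simp add: vanish_def)

lemma vanish_mult:
  assumes "vanish m f" "vanish n g"
  shows "vanish (m + n) (f * g)"
  unfolding vanish_def
proof (intro allI impI)
  fix i j assume ij: "i + j < m + n"
  have "coeff2 f a b * coeff2 g (i - a) (j - b) = 0" if "a \<le> i" "b \<le> j" for a b
  proof (cases "a + b < m")
    case False
    then have "i - a + (j - b) < n" using ij that by linarith
    then show ?thesis using assms(2) by (simp add: vanish_def)
  qed (use assms(1) in \<open>simp add: vanish_def\<close>)
  then show "coeff2 (f * g) i j = 0"
    unfolding coeff2_mult by (intro sum.neutral ballI) auto
qed

lemma vanish_mult_right: "vanish n f \<Longrightarrow> vanish n (f * g)"
  using vanish_mult[of n f 0 g] by simp

lemma vanish_power: "vanish 1 f \<Longrightarrow> vanish n (f ^ n)"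
proof (induction n)
  case (Suc n)
  then show ?case using vanish_mult[of 1 f n "f ^ n"] by simp
qed simp

lemma vanish_all_0: "(\<And>N. vanish N f) \<Longrightarrow> f = 0"
  by (rule fps2_eqI) (metis coeff2_0 lessI vanish_def)

definition max_ideal :: "fps2 \<Rightarrow> bool" where
  "max_ideal f \<longleftrightarrow> coeff2 f 0 0 = 0"

lemma max_ideal_vanish: "max_ideal f \<longleftrightarrow> vanish 1 f"
  by (simp add: max_ideal_def vanish_Suc_0)

lemma max_ideal_intros [simp, intro]:
  "max_ideal var_x" "max_ideal var_y" "max_ideal 0"
  "max_ideal f \<Longrightarrow> max_ideal g \<Longrightarrow> max_ideal (f + g)"
  "max_ideal f \<Longrightarrow> max_ideal g \<Longrightarrow> max_ideal (f - g)"
  "max_ideal f \<Longrightarrow> max_ideal (- f)"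
  "max_ideal f \<Longrightarrow> max_ideal (f * h)"
  "max_ideal f \<Longrightarrow> max_ideal (h * f)"
  "fps_nth a 0 = 0 \<Longrightarrow> max_ideal (fps_const a)"
  by (auto simp: max_ideal_def coeff2_var_x coeff2_var_y coeff2_mult coeff2_fps_const)

lemma max_ideal_power [simp, intro]: "max_ideal f \<Longrightarrow> n > 0 \<Longrightarrow> max_ideal (f ^ n)"
  by (cases n) auto

lemma vanish_mon:
  assumes "max_ideal g" "max_ideal h"
  shows "vanish (a + b) (g ^ a * h ^ b)"
  using assms by (intro vanish_mult vanish_power) (auto simp: max_ideal_vanish)

text \<open>
  A formal substitution is determined by its values on monomials because it respects the filtration
  by powers of the maximal ideal. Most identities below are proved in this way.
\<close>

definition filtered_linear :: "(fps2 \<Rightarrow> fps2) \<Rightarrow> bool" where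
  "filtered_linear L \<longleftrightarrow> (\<forall>f g. L (f + g) = L f + L g) \<and>
     (\<forall>c f. L (const2 c * f) = const2 c * L f) \<and> (\<forall>N f. vanish N f \<longrightarrow> vanish N (L f))"

text \<open>The cut is made in each variable separately and not in the total degree; the discarded
  monomials still have total degree above \<open>N\<close>, and what remains is a polynomial, hence
  convergent.\<close>

definition trunc2 :: "nat \<Rightarrow> fps2 \<Rightarrow> fps2" where
  "trunc2 N f = (\<Sum>a\<le>N. \<Sum>b\<le>N. const2 (coeff2 f a b) * mon a b)"

lemma coeff2_trunc2: "coeff2 (trunc2 N f) i j = (if i \<le> N \<and> j \<le> N then coeff2 f i j else 0)"
proof -
  have "coeff2 (trunc2 N f) i j = (\<Sum>a\<le>N. \<Sum>b\<le>N. if a = i then if b = j then coeff2 f a b else 0 else 0)"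
    unfolding trunc2_def coeff2_sum
    by (intro sum.cong refl) (auto simp: coeff2_mon)
  also have "\<dots> = (\<Sum>a\<le>N. if a = i then (if j \<le> N then coeff2 f i j else 0) else 0)"
    by (intro sum.cong refl) (auto simp: sum.delta)
  finally show ?thesis by (auto simp: sum.delta)
qed

lemma vanish_trunc2: "vanish (Suc N) (f - trunc2 N f)"
  by (auto simp: vanish_def coeff2_trunc2)

lemma filtered_linear_sum:
  assumes "filtered_linear L"
  shows "L (sum f A) = (\<Sum>a\<in>A. L (f a))"
proof -
  have "L (const2 0 * 0) = const2 0 * L 0"
    using assms unfolding filtered_linear_def by blast
  then have "L 0 = 0" by simp
  then show ?thesis
    using assms by (induction A rule: infinite_finite_induct) (auto simp: filtered_linear_def)
qed

text \<open>Truncations are finite sums of monomials, where the two maps agree; both send the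
  remainder, of order at least \<open>N\<close>, to order at least \<open>N\<close>. As
  \<open>N\<close> is arbitrary, the difference lies in every power of the maximal ideal.\<close>

lemma filtered_linear_eqI:
  assumes L: "filtered_linear L" and L': "filtered_linear L'"
    and mon: "\<And>a b. L (mon a b) = L' (mon a b)"
  shows "L f = L' f"
proof -
  have t: "L (trunc2 N f) = L' (trunc2 N f)" for N
    unfolding trunc2_def using L L' mon
    by (simp add: filtered_linear_sum) (simp add: filtered_linear_def)
  have d: "K f = K (trunc2 N f) + K (f - trunc2 N f)" if "filtered_linear K" for K N
    using that unfolding filtered_linear_def by (metis add.commute diff_add_cancel)
  have "vanish N (L f - L' f)" for N
  proof -
    have "L f - L' f = L (f - trunc2 N f) - L' (f - trunc2 N f)"
      using d[OF L, of N] d[OF L', of N] t[of N] by simp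
    moreover have "vanish N (f - trunc2 N f)"
      using vanish_trunc2 by (rule vanish_mono) simp
    ultimately show ?thesis
      using L L' by (auto simp: filtered_linear_def intro: vanish_diff)
  qed
  then have "L f - L' f = 0" by (rule vanish_all_0)
  then show ?thesis by simp
qed

lemma filtered_linear_mult_right:
  "filtered_linear L \<Longrightarrow> filtered_linear (\<lambda>f. L f * g)"
  by (auto simp: filtered_linear_def distrib_right mult.assoc vanish_mult_right)

lemma filtered_linear_mult_left:
  "filtered_linear L \<Longrightarrow> filtered_linear (\<lambda>f. g * L f)"
  using filtered_linear_mult_right[of L g] by (simp only: mult.commute[of g])

lemma filtered_linear_compose:
  "filtered_linear L \<Longrightarrow> filtered_linear K \<Longrightarrow> filtered_linear (\<lambda>f. L (K f))"
  by (auto simp: filtered_linear_def)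

lemma filtered_linear_id: "filtered_linear (\<lambda>f. f)"
  by (auto simp: filtered_linear_def)

lemma filtered_linear_arg_mult_left:
  "filtered_linear L \<Longrightarrow> filtered_linear (\<lambda>f. L (g * f))"
  by (rule filtered_linear_compose[OF _ filtered_linear_mult_left[OF filtered_linear_id]])

lemma filtered_linear_arg_mult_right:
  "filtered_linear L \<Longrightarrow> filtered_linear (\<lambda>f. L (f * g))"
  by (rule filtered_linear_compose[OF _ filtered_linear_mult_right[OF filtered_linear_id]])

lemma filtered_linear_minus: "filtered_linear L \<Longrightarrow> L (f - g) = L f - L g"
  unfolding filtered_linear_def by (metis add_diff_cancel_right' diff_add_cancel)

text \<open>If both components of \<open>\<phi>\<close> lie in the maximal ideal,
  \<open>x^a y^b\<close> contributes nothing to a coefficient of total degree below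
  \<open>a + b\<close>; the cut-off then only makes the sum finite.\<close>

definition subst22 :: "fps2 \<Rightarrow> fps2 \<times> fps2 \<Rightarrow> fps2" where
  "subst22 f \<phi> = Abs_fps (\<lambda>j. Abs_fps (\<lambda>i. \<Sum>(a, b) | a + b \<le> i + j.
     coeff2 f a b * coeff2 (fst \<phi> ^ a * snd \<phi> ^ b) i j))"

lemma finite_pairs_le [simp]: "finite {(a::nat, b::nat). a + b \<le> n}"
  by (rule finite_subset[of _ "{..n} \<times> {..n}"]) auto

lemma coeff2_subst22:
  "coeff2 (subst22 f \<phi>) i j =
     (\<Sum>(a, b) | a + b \<le> i + j. coeff2 f a b * coeff2 (fst \<phi> ^ a * snd \<phi> ^ b) i j)"
  by (simp add: subst22_def)

text \<open>Terms beyond the cut-off vanish because \<open>g^a h^b\<close> has order at least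
  \<open>a + b\<close>. The freedom in \<open>S\<close> serves \<open>subst22_mon\<close>, where the
  index of the monomial may lie beyond the cut-off.\<close>

lemma coeff2_subst22_le:
  assumes "max_ideal g" "max_ideal h" "finite S" "{(a, b). a + b \<le> i + j} \<subseteq> S"
  shows "coeff2 (subst22 f (g, h)) i j = (\<Sum>(a, b)\<in>S. coeff2 f a b * coeff2 (g ^ a * h ^ b) i j)"
  unfolding coeff2_subst22
proof (rule sum.mono_neutral_cong_left, goal_cases)
  case 3
  then show ?case using vanish_mon[OF assms(1,2)] by (force simp: vanish_def)
qed (use assms in auto)

lemma filtered_linear_subst22:
  assumes "max_ideal g" "max_ideal h"
  shows "filtered_linear (\<lambda>f. subst22 f (g, h))"
  unfolding filtered_linear_def
proof (intro conjI allI impI)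
  show "subst22 (f + f') (g, h) = subst22 f (g, h) + subst22 f' (g, h)" for f f'
    by (rule fps2_eqI) (simp add: coeff2_subst22 algebra_simps case_prod_unfold sum.distrib)
  show "subst22 (const2 c * f) (g, h) = const2 c * subst22 f (g, h)" for c f
    by (rule fps2_eqI) (simp add: coeff2_subst22 mult.assoc case_prod_unfold sum_distrib_left)
  show "vanish N (subst22 f (g, h))" if "vanish N f" for N f
    using that by (auto simp: vanish_def coeff2_subst22 intro!: sum.neutral)
qed

lemma subst22_mon:
  assumes "max_ideal g" "max_ideal h"
  shows "subst22 (mon a b) (g, h) = g ^ a * h ^ b"
proof (rule fps2_eqI)
  fix i j
  define S where "S = {(a, b). a + b \<le> i + j} \<union> {(a, b)}"
  have "coeff2 (subst22 (mon a b) (g, h)) i j =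
      (\<Sum>(a', b')\<in>S. coeff2 (mon a b) a' b' * coeff2 (g ^ a' * h ^ b') i j)"
    using assms by (intro coeff2_subst22_le) (auto simp: S_def)
  also have "\<dots> = (\<Sum>x\<in>S. if x = (a, b) then coeff2 (g ^ a * h ^ b) i j else 0)"
    by (intro sum.cong refl) (auto simp: coeff2_mon split: if_splits)
  also have "\<dots> = coeff2 (g ^ a * h ^ b) i j"
    by (subst sum.delta) (auto simp: S_def)
  finally show "coeff2 (subst22 (mon a b) (g, h)) i j = coeff2 (g ^ a * h ^ b) i j" .
qed

lemma mon_mult: "mon a b * mon c d = mon (a + c) (b + d)"
  by (simp add: mon_def power_add)

text \<open>Both sides are bilinear and filtered, so the reduction to monomials is made twice: in
  the second factor while the first is a monomial, then in the first factor.\<close>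

lemma subst22_mult:
  assumes "max_ideal g" "max_ideal h"
  shows "subst22 (f * f') (g, h) = subst22 f (g, h) * subst22 f' (g, h)"
proof -
  note fl = filtered_linear_subst22[OF assms]
  have "subst22 (mon a b * f') (g, h) = subst22 (mon a b) (g, h) * subst22 f' (g, h)" for a b f'
    by (rule filtered_linear_eqI[OF filtered_linear_arg_mult_left[OF fl] filtered_linear_mult_left[OF fl]])
       (simp add: mon_mult subst22_mon assms power_add mult_ac)
  then show ?thesis
    by (rule filtered_linear_eqI[OF filtered_linear_arg_mult_right[OF fl] filtered_linear_mult_right[OF fl]])
qed

context
  fixes g h :: fps2
  assumes gh: "max_ideal g" "max_ideal h"
begin

lemma subst22_add: "subst22 (f + f') (g, h) = subst22 f (g, h) + subst22 f' (g, h)"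
  using filtered_linear_subst22[OF gh] by (auto simp: filtered_linear_def)

lemma subst22_diff: "subst22 (f - f') (g, h) = subst22 f (g, h) - subst22 f' (g, h)"
  using filtered_linear_minus[OF filtered_linear_subst22[OF gh]] .

lemma subst22_var [simp]: "subst22 var_x (g, h) = g" "subst22 var_y (g, h) = h"
  using subst22_mon[OF gh, of 1 0] subst22_mon[OF gh, of 0 1] by (simp_all add: mon_def)

lemma subst22_1 [simp]: "subst22 1 (g, h) = 1"
  using subst22_mon[OF gh, of 0 0] by (simp add: mon_def)

lemma subst22_0 [simp]: "subst22 0 (g, h) = 0"
  using subst22_diff[of 0 0] by simp

lemma subst22_const2_mult: "subst22 (const2 c * f) (g, h) = const2 c * subst22 f (g, h)"
  using filtered_linear_subst22[OF gh] by (auto simp: filtered_linear_def)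

lemma subst22_const2 [simp]: "subst22 (const2 c) (g, h) = const2 c"
  using subst22_const2_mult[of c 1] by simp

lemma subst22_power: "subst22 (f ^ n) (g, h) = subst22 f (g, h) ^ n"
  by (induction n) (simp_all add: subst22_mult[OF gh])

lemma coeff2_subst22_0_0: "coeff2 (subst22 f (g, h)) 0 0 = coeff2 f 0 0"
proof -
  have "{(a::nat, b::nat). a + b \<le> 0} = {(0, 0)}" by auto
  then show ?thesis by (simp add: coeff2_subst22 coeff2_1)
qed

lemma max_ideal_subst22 [simp]: "max_ideal (subst22 f (g, h)) \<longleftrightarrow> max_ideal f"
  by (simp add: max_ideal_def coeff2_subst22_0_0)

end

lemma subst22_id [simp]: "subst22 f (var_x, var_y) = f"
  by (rule filtered_linear_eqI[OF filtered_linear_subst22 filtered_linear_id])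
     (simp_all add: subst22_mon, simp add: mon_def)

lemma subst22_assoc:
  assumes "max_ideal g" "max_ideal h" "max_ideal u" "max_ideal v"
  shows "subst22 (subst22 f (g, h)) (u, v) = subst22 f (subst22 g (u, v), subst22 h (u, v))"
proof (rule filtered_linear_eqI[where f = f])
  show "filtered_linear (\<lambda>f. subst22 (subst22 f (g, h)) (u, v))"
    by (rule filtered_linear_compose[OF filtered_linear_subst22[OF assms(3,4)] filtered_linear_subst22[OF assms(1,2)]])
  show "filtered_linear (\<lambda>f. subst22 f (subst22 g (u, v), subst22 h (u, v)))"
    using assms by (intro filtered_linear_subst22) simp_all
qed (use assms in \<open>simp add: subst22_mon subst22_mult subst22_power\<close>)

text \<open>One-variable substitutions are reduced to \<open>subst22\<close> by reading a series \<open>a(t)\<close> as \<open>a(x)\<close>.\<close>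

lemma fps_const_subst2:
  assumes "fps_nth a 0 = 0" "fps_nth b 0 = 0"
  shows "fps_const (subst2 f (a, b)) = subst22 f (fps_const a, fps_const b)"
proof (rule fps2_eqI)
  fix i j
  have *: "coeff2 (fps_const a ^ k * fps_const b ^ l) i j =
      (if j = 0 then fps_nth (a ^ k * b ^ l) i else 0)" for k l
    unfolding fps_const_power fps_const_mult coeff2_fps_const ..
  show "coeff2 (fps_const (subst2 f (a, b))) i j = coeff2 (subst22 f (fps_const a, fps_const b)) i j"
    unfolding coeff2_subst22 coeff2_fps_const subst2_def fps_nth_Abs_fps fst_conv snd_conv *
    by (cases "j = 0") (simp_all only: if_True if_False add_0_right mult_zero_right simp_thms
      case_prod_unfold sum.neutral_const)
qed

lemma fps_const_eq_iff2: "fps_const a = fps_const b \<longleftrightarrow> a = (b :: complex fps)"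
  by (auto dest: arg_cong[where f = "\<lambda>f. fps_nth f 0"])

context
  fixes a b :: "complex fps"
  assumes ab: "fps_nth a 0 = 0" "fps_nth b 0 = 0"
begin

private lemma mi: "max_ideal (fps_const a)" "max_ideal (fps_const b)"
  using ab by auto

private lemma eq: "subst2 f (a, b) = fps_nth (subst22 f (fps_const a, fps_const b)) 0"
  by (simp flip: fps_const_subst2[OF ab])

lemma subst2_add: "subst2 (f + g) (a, b) = subst2 f (a, b) + subst2 g (a, b)"
  by (simp add: eq subst22_add[OF mi])

lemma subst2_diff: "subst2 (f - g) (a, b) = subst2 f (a, b) - subst2 g (a, b)"
  by (simp add: eq subst22_diff[OF mi])

lemma subst2_mult: "subst2 (f * g) (a, b) = subst2 f (a, b) * subst2 g (a, b)"
  by (simp add: eq subst22_mult[OF mi])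

lemma subst2_var [simp]: "subst2 var_x (a, b) = a" "subst2 var_y (a, b) = b"
  by (simp_all add: eq subst22_var[OF mi])

lemma subst2_const2 [simp]: "subst2 (const2 c) (a, b) = fps_const c"
  by (simp add: eq subst22_const2[OF mi])

lemma subst2_1 [simp]: "subst2 1 (a, b) = 1"
  using subst2_const2[of 1] by simp

lemma subst2_0 [simp]: "subst2 0 (a, b) = 0"
  using subst2_const2[of 0] by simp

lemma subst2_power: "subst2 (f ^ n) (a, b) = subst2 f (a, b) ^ n"
  by (induction n) (simp_all add: subst2_mult)

lemma subst2_prod: "subst2 (prod F A) (a, b) = (\<Prod>x\<in>A. subst2 (F x) (a, b))"
  by (induction A rule: infinite_finite_induct) (simp_all add: subst2_mult)

lemma subst2_sum: "subst2 (sum F A) (a, b) = (\<Sum>x\<in>A. subst2 (F x) (a, b))"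
  by (induction A rule: infinite_finite_induct) (simp_all add: subst2_add)

lemma subst2_nth_0: "fps_nth (subst2 f (a, b)) 0 = coeff2 f 0 0"
proof -
  have "{(a::nat, b::nat). a + b \<le> 0} = {(0, 0)}" by auto
  then show ?thesis by (simp add: subst2_def)
qed

lemma subst2_subst22:
  assumes "max_ideal g" "max_ideal h"
  shows "subst2 (subst22 f (g, h)) (a, b) = subst2 f (subst2 g (a, b), subst2 h (a, b))"
proof -
  have "fps_const (subst2 (subst22 f (g, h)) (a, b)) =
      subst22 f (subst22 g (fps_const a, fps_const b), subst22 h (fps_const a, fps_const b))"
    unfolding fps_const_subst2[OF ab] by (rule subst22_assoc[OF assms mi])
  also have "\<dots> = subst22 f (fps_const (subst2 g (a, b)), fps_const (subst2 h (a, b)))"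
    by (simp only: fps_const_subst2[OF ab])
  also have "\<dots> = fps_const (subst2 f (subst2 g (a, b), subst2 h (a, b)))"
    using assms by (intro fps_const_subst2[symmetric]) (simp_all add: subst2_nth_0 max_ideal_def)
  finally show ?thesis by (simp only: fps_const_eq_iff2)
qed

end

lemma subst2_fps_const: "subst2 (fps_const a) (c, d) = a oo c"
proof (rule fps_ext)
  fix n
  have "fps_nth (subst2 (fps_const a) (c, d)) n =
      (\<Sum>x | fst x + snd x \<le> n. if snd x = 0 then fps_nth a (fst x) * fps_nth (c ^ fst x) n else 0)"
    unfolding subst2_def case_prod_unfold fps_nth_Abs_fps
    by (intro sum.cong refl) (simp add: coeff2_fps_const)
  also have "\<dots> = (\<Sum>x\<in>(\<lambda>i. (i, 0::nat)) ` {0..n}. fps_nth a (fst x) * fps_nth (c ^ fst x) n)"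
  proof (rule sum.mono_neutral_cong_right)
    show "finite {x. fst x + snd x \<le> n}"
      using finite_pairs_le[of n] by (simp add: case_prod_unfold)
    show "(\<lambda>i. (i, 0)) ` {0..n} \<subseteq> {x. fst x + snd x \<le> n}"
      by auto
    show "\<forall>x\<in>{x. fst x + snd x \<le> n} - (\<lambda>i. (i, 0)) ` {0..n}.
        (if snd x = 0 then fps_nth a (fst x) * fps_nth (c ^ fst x) n else 0) = 0"
      by (force simp: image_iff)
  qed auto
  also have "\<dots> = fps_nth (a oo c) n"
    by (subst sum.reindex) (simp_all add: inj_on_def fps_compose_nth)
  finally show "fps_nth (subst2 (fps_const a) (c, d)) n = fps_nth (a oo c) n" .
qed

text \<open>By \<open>eq\<close> the coefficients do not depend on the second component, which may
  thus be replaced by 0, where the one-variable result applies.\<close>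

lemma subst22_fps_const:
  assumes "fps_nth c 0 = 0" "max_ideal h"
  shows "subst22 (fps_const a) (fps_const c, h) = fps_const (a oo c)"
proof (rule fps2_eqI)
  fix i j
  have eq: "coeff2 (subst22 (fps_const a) (fps_const c, h')) i j =
      (\<Sum>x | fst x + snd x \<le> i + j. if snd x = 0
         then fps_nth a (fst x) * coeff2 (fps_const c ^ fst x) i j else 0)" for h'
    unfolding coeff2_subst22 case_prod_unfold
    by (intro sum.cong refl) (simp add: coeff2_fps_const)
  have "fps_const (a oo c) = subst22 (fps_const a) (fps_const c, fps_const 0)"
    using assms fps_const_subst2[of c 0 "fps_const a"] by (simp add: subst2_fps_const)
  then show "coeff2 (subst22 (fps_const a) (fps_const c, h)) i j = coeff2 (fps_const (a oo c)) i j"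
    using eq[of h] eq[of "fps_const 0"] by simp
qed

lemma subst22_fps_const_var_x: 
  assumes "max_ideal h"
  shows "subst22 (fps_const a) (var_x, h) = fps_const a"
  using subst22_fps_const[of fps_X h a] assms by (simp add: var_x_def)

text \<open>The reparametrization is read as the substitution of \<open>(c, 0)\<close> into series
  in \<open>x\<close> alone, which turns the claim into an instance of associativity.\<close>

lemma subst2_compose:
  assumes "fps_nth a 0 = 0" "fps_nth b 0 = 0" "fps_nth c 0 = 0"
  shows "subst2 f (a oo c, b oo c) = subst2 f (a, b) oo c"
proof -
  have "subst2 f (a oo c, b oo c) = subst2 (subst22 f (fps_const a, fps_const b)) (c, 0)"
    using assms by (subst subst2_subst22) (simp_all add: subst2_fps_const)
  also have "\<dots> = subst2 f (a, b) oo c"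
    using assms by (simp add: subst2_fps_const flip: fps_const_subst2)
  finally show ?thesis .
qed

lemma subst2_fps_X_0: "subst2 f (fps_X, 0) = fps_nth f 0"
proof (rule fps_ext)
  fix n
  have *: "fps_nth (fps_X ^ i * 0 ^ j) n = (if (i, j) = (n, 0) then 1 else (0 :: complex))" for i j
    by (cases j) (auto simp: fps_X_power_nth)
  have "fps_nth (subst2 f (fps_X, 0)) n =
      (\<Sum>x | fst x + snd x \<le> n. if x = (n, 0) then coeff2 f n 0 else 0)"
    unfolding subst2_def case_prod_unfold fps_nth_Abs_fps fst_conv snd_conv * prod.collapse
    by (intro sum.cong refl) auto
  also have "\<dots> = fps_nth (fps_nth f 0) n"
    using finite_pairs_le[of n] by (subst sum.delta) (auto simp: coeff2_def case_prod_unfold)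
  finally show "fps_nth (subst2 f (fps_X, 0)) n = fps_nth (fps_nth f 0) n" .
qed

lemma fps_nth_subst2_0_X: "fps_nth (subst2 f (0, fps_X)) n = coeff2 f 0 n"
proof -
  have *: "fps_nth (0 ^ i * fps_X ^ j) n = (if (i, j) = (0, n) then 1 else (0 :: complex))" for i j
    by (cases i) (auto simp: fps_X_power_nth)
  have "fps_nth (subst2 f (0, fps_X)) n =
      (\<Sum>x | fst x + snd x \<le> n. if x = (0, n) then coeff2 f 0 n else 0)"
    unfolding subst2_def case_prod_unfold fps_nth_Abs_fps fst_conv snd_conv * prod.collapse
    by (intro sum.cong refl) auto
  also have "\<dots> = coeff2 f 0 n"
    using finite_pairs_le[of n] by (subst sum.delta) (auto simp: case_prod_unfold)
  finally show ?thesis .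
qed

text \<open>Exchange of the axes. It serves the conductor of a branch whose first component is
  zero.\<close>

definition swap2 :: "fps2 \<Rightarrow> fps2" where
  "swap2 f = Abs_fps (\<lambda>j. Abs_fps (\<lambda>i. coeff2 f j i))"

lemma coeff2_swap2 [simp]: "coeff2 (swap2 f) i j = coeff2 f j i"
  by (simp add: swap2_def)

lemma subst2_swap2: "subst2 (swap2 f) (a, b) = subst2 f (b, a)"
proof (rule fps_ext)
  fix n
  have "bij_betw prod.swap {(i :: nat, j). i + j \<le> n} {(i, j). i + j \<le> n}"
    by (rule bij_betwI[of _ _ _ prod.swap]) (auto simp: add.commute)
  from sum.reindex_bij_betw[OF this, of "\<lambda>(i, j). coeff2 f i j * fps_nth (b ^ i * a ^ j) n"]
  show "fps_nth (subst2 (swap2 f) (a, b)) n = fps_nth (subst2 f (b, a)) n"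
    by (simp add: subst2_def case_prod_unfold mult.commute)
qed

section \<open>Convergence\<close>

text \<open>The sum norm of the homogeneous part of degree \<open>m\<close>. Grouping by total
  degree turns most estimates into estimates for series in one variable.\<close>

definition diag_norm :: "fps2 \<Rightarrow> nat \<Rightarrow> real" where
  "diag_norm f m = (\<Sum>i\<le>m. norm (coeff2 f i (m - i)))"

lemma diag_norm_nonneg [simp]: "diag_norm f m \<ge> 0"
  by (simp add: diag_norm_def sum_nonneg)

lemma norm_coeff2_le_diag_norm: "norm (coeff2 f i j) \<le> diag_norm f (i + j)"
  using member_le_sum[of i "{..i + j}" "\<lambda>k. norm (coeff2 f k (i + j - k))"]
  by (simp add: diag_norm_def)

lemma diag_norm_add: "diag_norm (f + g) m \<le> diag_norm f m + diag_norm g m"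
  unfolding diag_norm_def coeff2_add sum.distrib[symmetric] by (intro sum_mono norm_triangle_ineq)

lemma diag_norm_fps_const: "diag_norm (fps_const a) m = norm (fps_nth a m)"
proof -
  have "diag_norm (fps_const a) m = (\<Sum>i\<le>m. if i = m then norm (fps_nth a m) else 0)"
    unfolding diag_norm_def by (intro sum.cong) (auto simp: coeff2_fps_const)
  then show ?thesis by (simp add: sum.delta)
qed

lemma sum_pairs_eq_diag_norm:
  "(\<Sum>(i, j) | i + j \<le> N. norm (coeff2 f i j) * r ^ (i + j)) = (\<Sum>m\<le>N. diag_norm f m * r ^ m)"
proof -
  have "(\<Sum>(i, j) | i + j \<le> N. norm (coeff2 f i j) * r ^ (i + j)) =
      (\<Sum>m\<le>N. \<Sum>i\<le>m. norm (coeff2 f i (m - i)) * r ^ (i + (m - i)))"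
    by (rule sum.triangle_reindex_eq)
  also have "\<dots> = (\<Sum>m\<le>N. diag_norm f m * r ^ m)"
    unfolding diag_norm_def sum_distrib_right by (intro sum.cong refl) auto
  finally show ?thesis .
qed

lemma diag_norm_mult: "diag_norm (f * g) m \<le> (\<Sum>l\<le>m. diag_norm f l * diag_norm g (m - l))"
proof -
  let ?u = "\<lambda>i j. norm (coeff2 f i j)" and ?v = "\<lambda>i j. norm (coeff2 g i j)"
  have "diag_norm (f * g) m \<le> (\<Sum>i\<le>m. \<Sum>b\<le>m - i. \<Sum>a\<le>i. ?u a b * ?v (i - a) (m - i - b))"
    unfolding diag_norm_def coeff2_mult
    by (intro sum_mono order_trans[OF norm_sum]) (simp add: norm_mult)
  also have "\<dots> = (\<Sum>(i, b, a)\<in>(SIGMA i:{..m}. {..m - i} \<times> {..i}). ?u a b * ?v (i - a) (m - i - b))"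
    by (simp add: sum.Sigma sum.cartesian_product)
  \<comment> \<open>The new indices are the degree \<open>l = a + b\<close> of the monomial of
    \<open>f\<close>, its exponent of \<open>x\<close>, and the exponent \<open>c = i - a\<close> of
    \<open>x\<close> in the monomial of \<open>g\<close>.\<close>
  also have "\<dots> = (\<Sum>(l, a, c)\<in>(SIGMA l:{..m}. {..l} \<times> {..m - l}). ?u a (l - a) * ?v c (m - l - c))"
    by (rule sum.reindex_bij_witness[where
          i = "\<lambda>(l, a, c). (a + c, l - a, a)" and j = "\<lambda>(i, b, a). (a + b, a, i - a)"])
       (auto simp: add.commute)
  also have "\<dots> = (\<Sum>l\<le>m. diag_norm f l * diag_norm g (m - l))"
    unfolding diag_norm_def sum_product by (simp add: sum.Sigma sum.cartesian_product)
  finally show ?thesis .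
qed

text \<open>\<open>C\<close> bounds the norm of \<open>f\<close> in the Banach algebra of series
  with finite weighted sum norm at radius \<open>r\<close>. Only partial sums occur, so that no
  limit has to exist beforehand.\<close>

definition bdd2 :: "real \<Rightarrow> fps2 \<Rightarrow> real \<Rightarrow> bool" where
  "bdd2 r f C \<longleftrightarrow> (\<forall>N. (\<Sum>m\<le>N. diag_norm f m * r ^ m) \<le> C)"

lemma bdd2_nonneg: "bdd2 r f C \<Longrightarrow> C \<ge> 0"
  using diag_norm_nonneg[of f 0] unfolding bdd2_def by (metis atMost_0 sum.insert finite.emptyI
    empty_iff order_trans sum.empty add_0_right power_0 mult_1_right)

lemma bdd2_weaken: "bdd2 r f C \<Longrightarrow> C \<le> D \<Longrightarrow> bdd2 r f D"
  unfolding bdd2_def by (meson order_trans)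

lemma bdd2_mono: "bdd2 r f C \<Longrightarrow> 0 \<le> r' \<Longrightarrow> r' \<le> r \<Longrightarrow> bdd2 r' f C"
  unfolding bdd2_def
  by (meson diag_norm_nonneg mult_left_mono order_trans power_mono sum_mono)

text \<open>A form of the Schwarz lemma: without a constant term every degree present is at least 1,
  and shrinking the radius gains a factor \<open>r' / r\<close> in each of them.\<close>

lemma bdd2_scale:
  assumes "bdd2 r f C" "max_ideal f" "0 \<le> r'" "r' \<le> r" "r > 0"
  shows "bdd2 r' f (C * r' / r)"
  unfolding bdd2_def
proof
  fix N
  have "diag_norm f m * r' ^ m \<le> diag_norm f m * r ^ m * (r' / r)" for m
  proof (cases m)
    case 0
    then show ?thesis using assms(2) by (simp add: diag_norm_def max_ideal_def)
  next
    case (Suc k)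
    have "r' ^ k \<le> r ^ k" using assms by (intro power_mono) auto
    then have "r' ^ m \<le> r ^ m * (r' / r)"
      using assms Suc by (simp add: field_simps mult_left_mono)
    then have "diag_norm f m * r' ^ m \<le> diag_norm f m * (r ^ m * (r' / r))"
      by (rule mult_left_mono) simp
    then show ?thesis by (simp only: mult.assoc)
  qed
  then have "(\<Sum>m\<le>N. diag_norm f m * r' ^ m) \<le> (\<Sum>m\<le>N. diag_norm f m * r ^ m) * (r' / r)"
    unfolding sum_distrib_right by (intro sum_mono)
  also have "\<dots> \<le> C * (r' / r)"
    using assms by (intro mult_right_mono) (auto simp: bdd2_def)
  finally show "(\<Sum>m\<le>N. diag_norm f m * r' ^ m) \<le> C * r' / r" by simp
qed

lemma bdd2_add:
  assumes "bdd2 r f C" "bdd2 r g D" "r \<ge> 0"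
  shows "bdd2 r (f + g) (C + D)"
  unfolding bdd2_def
proof
  fix N
  have "(\<Sum>m\<le>N. diag_norm (f + g) m * r ^ m) \<le> (\<Sum>m\<le>N. diag_norm f m * r ^ m) + (\<Sum>m\<le>N. diag_norm g m * r ^ m)"
    unfolding sum.distrib[symmetric] distrib_right[symmetric]
    using assms by (intro sum_mono mult_right_mono diag_norm_add) auto
  also have "\<dots> \<le> C + D" using assms by (intro add_mono) (auto simp: bdd2_def)
  finally show "(\<Sum>m\<le>N. diag_norm (f + g) m * r ^ m) \<le> C + D" .
qed

lemma bdd2_mult:
  assumes "bdd2 r f C" "bdd2 r g D" "r \<ge> 0"
  shows "bdd2 r (f * g) (C * D)"
  unfolding bdd2_def
proof
  fix N
  let ?u = "\<lambda>l. diag_norm f l * r ^ l" and ?v = "\<lambda>l. diag_norm g l * r ^ l"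
  have "(\<Sum>m\<le>N. diag_norm (f * g) m * r ^ m) \<le> (\<Sum>m\<le>N. (\<Sum>l\<le>m. diag_norm f l * diag_norm g (m - l)) * r ^ m)"
    using assms by (intro sum_mono mult_right_mono diag_norm_mult) auto
  also have "\<dots> = (\<Sum>m\<le>N. \<Sum>l\<le>m. ?u l * ?v (m - l))"
    unfolding sum_distrib_right
    by (intro sum.cong refl) (auto simp: mult_ac simp flip: power_add)
  also have "\<dots> = (\<Sum>(l, k) | l + k \<le> N. ?u l * ?v k)"
    by (rule sum.triangle_reindex_eq[symmetric])
  also have "\<dots> \<le> (\<Sum>(l, k)\<in>{..N} \<times> {..N}. ?u l * ?v k)"
    using assms by (intro sum_mono2) auto
  also have "\<dots> = (\<Sum>l\<le>N. ?u l) * (\<Sum>k\<le>N. ?v k)"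
    by (simp add: sum_product sum.cartesian_product)
  also have "\<dots> \<le> C * D"
    using assms bdd2_nonneg[OF assms(1)] by (intro mult_mono sum_nonneg) (auto simp: bdd2_def)
  finally show "(\<Sum>m\<le>N. diag_norm (f * g) m * r ^ m) \<le> C * D" .
qed

lemma bdd2_1: "bdd2 r 1 1"
proof -
  have "(\<Sum>m\<le>N. diag_norm 1 m * r ^ m) = (\<Sum>m\<le>N. if m = 0 then 1 else 0)" for N
    using diag_norm_fps_const[of 1] by (intro sum.cong) auto
  then show ?thesis by (simp add: bdd2_def)
qed

lemma bdd2_power: "bdd2 r f C \<Longrightarrow> r \<ge> 0 \<Longrightarrow> bdd2 r (f ^ n) (C ^ n)"
  by (induction n) (auto simp: bdd2_1 intro: bdd2_mult)

lemma diag_norm_subst22: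
  "diag_norm (subst22 f \<phi>) m \<le> (\<Sum>(a, b) | a + b \<le> m. norm (coeff2 f a b) * diag_norm (fst \<phi> ^ a * snd \<phi> ^ b) m)"
proof -
  have "diag_norm (subst22 f \<phi>) m \<le>
      (\<Sum>i\<le>m. \<Sum>(a, b) | a + b \<le> m. norm (coeff2 f a b) * norm (coeff2 (fst \<phi> ^ a * snd \<phi> ^ b) i (m - i)))"
    unfolding diag_norm_def
  proof (rule sum_mono)
    fix i assume "i \<in> {..m}"
    then have "i + (m - i) = m" by simp
    then show "norm (coeff2 (subst22 f \<phi>) i (m - i)) \<le>
      (\<Sum>(a, b) | a + b \<le> m. norm (coeff2 f a b) * norm (coeff2 (fst \<phi> ^ a * snd \<phi> ^ b) i (m - i)))"
      unfolding coeff2_subst22 by (auto intro!: order_trans[OF norm_sum] sum_mono simp: norm_mult)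
  qed
  also have "\<dots> = (\<Sum>(a, b) | a + b \<le> m. norm (coeff2 f a b) * diag_norm (fst \<phi> ^ a * snd \<phi> ^ b) m)"
    unfolding diag_norm_def sum_distrib_left by (subst sum.swap) (simp add: case_prod_unfold)
  finally show ?thesis .
qed

text \<open>The algebra norm bounds \<open>g^a h^b\<close> by \<open>A^a B^b\<close>, and the sums
  over the degree and over \<open>(a, b)\<close> are exchanged. The weights \<open>A\<close> and
  \<open>B\<close> are kept apart for the implicit function theorem, where the two variables are
  scaled differently.\<close>

lemma bdd2_subst22_weighted:
  assumes f: "\<And>N. (\<Sum>(a, b) | a + b \<le> N. norm (coeff2 f a b) * (A ^ a * B ^ b)) \<le> C"
    and g: "bdd2 r g A" and h: "bdd2 r h B" and r: "r \<ge> 0"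
  shows "bdd2 r (subst22 f (g, h)) C"
  unfolding bdd2_def
proof
  fix N
  let ?d = "\<lambda>a b m. diag_norm (g ^ a * h ^ b) m * r ^ m"
  have gh: "bdd2 r (g ^ a * h ^ b) (A ^ a * B ^ b)" for a b
    by (intro bdd2_mult bdd2_power g h r)
  have "(\<Sum>m\<le>N. diag_norm (subst22 f (g, h)) m * r ^ m) \<le>
      (\<Sum>m\<le>N. (\<Sum>(a, b) | a + b \<le> m. norm (coeff2 f a b) * diag_norm (g ^ a * h ^ b) m) * r ^ m)"
    using r diag_norm_subst22[of f "(g, h)"] by (intro sum_mono mult_right_mono) auto
  also have "\<dots> = (\<Sum>m\<le>N. \<Sum>(a, b) | a + b \<le> m. norm (coeff2 f a b) * ?d a b m)"
    by (simp add: sum_distrib_right case_prod_unfold mult.assoc)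
  also have "\<dots> \<le> (\<Sum>m\<le>N. \<Sum>(a, b) | a + b \<le> N. norm (coeff2 f a b) * ?d a b m)"
    using r by (intro sum_mono sum_mono2) auto
  also have "\<dots> = (\<Sum>(a, b) | a + b \<le> N. norm (coeff2 f a b) * (\<Sum>m\<le>N. ?d a b m))"
    unfolding sum_distrib_left by (subst sum.swap) (simp add: case_prod_unfold)
  also have "\<dots> \<le> (\<Sum>(a, b) | a + b \<le> N. norm (coeff2 f a b) * (A ^ a * B ^ b))"
    using gh by (auto intro!: sum_mono mult_left_mono simp: bdd2_def)
  also have "\<dots> \<le> C" by (rule f)
  finally show "(\<Sum>m\<le>N. diag_norm (subst22 f (g, h)) m * r ^ m) \<le> C" .
qed

lemma bdd2_subst22:
  assumes "bdd2 s f C" "bdd2 r g s" "bdd2 r h s" "r \<ge> 0"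
  shows "bdd2 r (subst22 f (g, h)) C"
proof (rule bdd2_subst22_weighted[OF _ assms(2-4)])
  show "(\<Sum>(a, b) | a + b \<le> N. norm (coeff2 f a b) * (s ^ a * s ^ b)) \<le> C" for N
    using assms(1) by (simp add: bdd2_def flip: sum_pairs_eq_diag_norm power_add)
qed

lemma bdd2_summable:
  assumes "bdd2 r f C" "r > 0"
  shows "(\<lambda>(i, j). norm (coeff2 f i j) * r ^ (i + j)) summable_on UNIV"
proof (rule nonneg_bdd_above_summable_on)
  show "bdd_above (sum (\<lambda>(i, j). norm (coeff2 f i j) * r ^ (i + j)) ` {F. F \<subseteq> UNIV \<and> finite F})"
  proof (rule bdd_aboveI2)
    fix F :: "(nat \<times> nat) set" assume "F \<in> {F. F \<subseteq> UNIV \<and> finite F}"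
    then have F: "finite F" by simp
    define N where "N = Max ((\<lambda>(i, j). i + j) ` F)"
    have "F \<subseteq> {(i, j). i + j \<le> N}"
      using F unfolding N_def by (auto intro!: Max_ge rev_image_eqI)
    then have "(\<Sum>(i, j)\<in>F. norm (coeff2 f i j) * r ^ (i + j)) \<le>
        (\<Sum>(i, j) | i + j \<le> N. norm (coeff2 f i j) * r ^ (i + j))"
      using assms by (intro sum_mono2) auto
    also have "\<dots> \<le> C" using assms by (simp add: sum_pairs_eq_diag_norm bdd2_def)
    finally show "(\<Sum>(i, j)\<in>F. norm (coeff2 f i j) * r ^ (i + j)) \<le> C" .
  qed
qed (use assms in auto)

lemma convergent2_iff_bdd2: "convergent2 f \<longleftrightarrow> (\<exists>r>0. \<exists>C. bdd2 r f C)"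
proof
  assume "convergent2 f"
  then obtain r where r: "r > 0" and
    s: "(\<lambda>(i, j). norm (coeff2 f i j) * r ^ (i + j)) summable_on UNIV"
    by (auto simp: convergent2_def)
  have "bdd2 r f (\<Sum>\<^sub>\<infinity>(i, j)\<in>UNIV. norm (coeff2 f i j) * r ^ (i + j))"
    unfolding bdd2_def sum_pairs_eq_diag_norm[symmetric]
    using r s by (intro allI finite_sum_le_infsum) auto
  then show "\<exists>r>0. \<exists>C. bdd2 r f C" using r by blast
next
  assume "\<exists>r>0. \<exists>C. bdd2 r f C"
  then show "convergent2 f" using bdd2_summable by (auto simp: convergent2_def)
qed

lemma bdd2_coeff2:
  assumes "bdd2 r f C" "r > 0"
  shows "norm (coeff2 f i j) \<le> C * (1 / r) ^ (i + j)"
proof -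
  have "diag_norm f (i + j) * r ^ (i + j) \<le> (\<Sum>m\<le>i + j. diag_norm f m * r ^ m)"
    using assms by (intro member_le_sum) auto
  also have "\<dots> \<le> C" using assms by (simp add: bdd2_def)
  finally have "diag_norm f (i + j) \<le> C * (1 / r) ^ (i + j)"
    using assms by (simp add: field_simps)
  then show ?thesis using norm_coeff2_le_diag_norm order_trans by blast
qed

lemma convergent2_iff_geometric:
  "convergent2 f \<longleftrightarrow> (\<exists>C R. R \<ge> 1 \<and> C \<ge> 0 \<and> (\<forall>i j. norm (coeff2 f i j) \<le> C * R ^ (i + j)))"
proof
  assume "convergent2 f"
  then obtain r C where r: "r > 0" and C: "bdd2 r f C" by (auto simp: convergent2_iff_bdd2)
  have "norm (coeff2 f i j) \<le> C * (max 1 (1 / r)) ^ (i + j)" for i j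
    using bdd2_nonneg[OF C] r
    by (intro order_trans[OF bdd2_coeff2[OF C r]] mult_left_mono power_mono) auto
  then show "\<exists>C R. R \<ge> 1 \<and> C \<ge> 0 \<and> (\<forall>i j. norm (coeff2 f i j) \<le> C * R ^ (i + j))"
    using bdd2_nonneg[OF C] by (intro exI[of _ C] exI[of _ "max 1 (1 / r)"]) auto
next
  assume "\<exists>C R. R \<ge> 1 \<and> C \<ge> 0 \<and> (\<forall>i j. norm (coeff2 f i j) \<le> C * R ^ (i + j))"
  then obtain C R where R: "R \<ge> 1" and C: "C \<ge> 0" "\<And>i j. norm (coeff2 f i j) \<le> C * R ^ (i + j)"
    by blast
  have d: "diag_norm f m \<le> 2 ^ m * (C * R ^ m)" for m
  proof -
    have "diag_norm f m \<le> (\<Sum>i\<le>m. C * R ^ m)"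
      unfolding diag_norm_def using C(2)[of _ "m - _"] by (intro sum_mono) (metis atMost_iff le_add_diff_inverse)
    also have "\<dots> = real (Suc m) * (C * R ^ m)" by simp
    also have "\<dots> \<le> 2 ^ m * (C * R ^ m)"
      using R C(1) by (intro mult_right_mono) (metis (mono_tags, lifting) Suc_leI less_exp of_nat_le_iff of_nat_numeral of_nat_power, auto)
    finally show ?thesis .
  qed
  \<comment> \<open>Of the factor 4, one 2 absorbs the number \<open>m + 1\<close> of monomials of
    degree \<open>m\<close>, at most \<open>2^m\<close>; the other leaves a geometric series of
    ratio 1/2, with sum 2.\<close>
  have "bdd2 (1 / (4 * R)) f (2 * C)"
    unfolding bdd2_def
  proof
    fix N
    have "(\<Sum>m\<le>N. diag_norm f m * (1 / (4 * R)) ^ m) \<le> (\<Sum>m\<le>N. 2 ^ m * (C * R ^ m) * (1 / (4 * R)) ^ m)"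
      using R by (intro sum_mono mult_right_mono d) auto
    also have "\<dots> = C * (\<Sum>m\<le>N. (1 / 2) ^ m)"
    proof -
      have "(2::real) ^ m * 2 ^ m = 4 ^ m" for m by (simp flip: power_mult_distrib)
      then show ?thesis
        using R unfolding sum_distrib_left by (intro sum.cong) (auto simp: field_simps power_mult_distrib)
    qed
    also have "\<dots> \<le> C * 2"
    proof (rule mult_left_mono)
      have "(\<Sum>m\<le>N. (1 / 2 :: real) ^ m) \<le> (\<Sum>m. (1 / 2) ^ m)"
        by (intro sum_le_suminf summable_geometric) auto
      then show "(\<Sum>m\<le>N. (1 / 2 :: real) ^ m) \<le> 2"
        using suminf_geometric[of "1 / 2 :: real"] by simp
    qed (use C(1) in auto)
    finally show "(\<Sum>m\<le>N. diag_norm f m * (1 / (4 * R)) ^ m) \<le> 2 * C" by simp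
  qed
  moreover have "1 / (4 * R) > 0" using R by simp
  ultimately show "convergent2 f" unfolding convergent2_iff_bdd2 by blast
qed

lemma convergent2_common:
  assumes "convergent2 f" "convergent2 g"
  obtains r C D where "r > 0" "bdd2 r f C" "bdd2 r g D"
proof -
  obtain r C where r: "r > 0" and C: "bdd2 r f C" using assms(1) by (auto simp: convergent2_iff_bdd2)
  obtain s D where s: "s > 0" and D: "bdd2 s g D" using assms(2) by (auto simp: convergent2_iff_bdd2)
  show thesis
    by (rule that[of "min r s" C D]) (use r s C D in \<open>auto intro: bdd2_mono\<close>)
qed

lemma convergent2_add [intro]: "convergent2 f \<Longrightarrow> convergent2 g \<Longrightarrow> convergent2 (f + g)"
  by (erule (1) convergent2_common) (auto simp: convergent2_iff_bdd2 dest: bdd2_add intro: less_imp_le)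

lemma convergent2_mult [intro]: "convergent2 f \<Longrightarrow> convergent2 g \<Longrightarrow> convergent2 (f * g)"
  by (erule (1) convergent2_common) (auto simp: convergent2_iff_bdd2 dest: bdd2_mult intro: less_imp_le)

lemma convergent2_uminus [intro]: "convergent2 f \<Longrightarrow> convergent2 (- f)"
  by (simp add: convergent2_def)

lemma convergent2_diff [intro]: "convergent2 f \<Longrightarrow> convergent2 g \<Longrightarrow> convergent2 (f - g)"
  using convergent2_add[of f "- g"] convergent2_uminus[of g] by simp

lemma convergent2_1 [simp, intro]: "convergent2 1"
  unfolding convergent2_iff_bdd2 using bdd2_1[of 1] by (intro exI[of _ 1]) auto

lemma convergent2_power [intro]: "convergent2 f \<Longrightarrow> convergent2 (f ^ n)"
  by (induction n) auto

lemma convergent2_prod [intro]: "(\<And>a. a \<in> A \<Longrightarrow> convergent2 (f a)) \<Longrightarrow> convergent2 (prod f A)"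
  by (induction A rule: infinite_finite_induct) auto

lemma convergent2_fps_const: "convergent2 (fps_const a) \<longleftrightarrow> fps_conv_radius a > 0"
proof
  assume "convergent2 (fps_const a)"
  then obtain r C where r: "r > 0" and C: "bdd2 r (fps_const a) C" by (auto simp: convergent2_iff_bdd2)
  have "summable (\<lambda>m. norm (fps_nth a m * of_real r ^ m))"
    using C r bdd2_nonneg[OF C]
    by (intro bounded_imp_summable[of _ C]) (auto simp: bdd2_def diag_norm_fps_const norm_mult norm_power)
  then have "fps_conv_radius a \<ge> norm (complex_of_real r)"
    unfolding fps_conv_radius_def by (intro conv_radius_geI) (rule summable_norm_cancel)
  then show "fps_conv_radius a > 0"
    using r by (metis abs_of_pos ereal_less(2) less_le_trans norm_of_real)
next
  assume "fps_conv_radius a > 0"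
  then obtain r where r: "0 < r" "ereal r < fps_conv_radius a"
    using ereal_dense2 by (metis ereal_less(2))
  then have "summable (\<lambda>m. norm (fps_nth a m * of_real r ^ m))"
    by (intro norm_summable_fps) auto
  then have s: "summable (\<lambda>m. norm (fps_nth a m) * r ^ m)"
    using r by (simp add: norm_mult norm_power)
  have "bdd2 r (fps_const a) (\<Sum>m. norm (fps_nth a m) * r ^ m)"
    unfolding bdd2_def diag_norm_fps_const using r s by (intro allI sum_le_suminf) auto
  then show "convergent2 (fps_const a)" using r by (auto simp: convergent2_iff_bdd2)
qed

lemma convergent2_const2 [simp, intro]: "convergent2 (const2 c)"
  by (simp add: convergent2_fps_const)

lemma convergent2_0 [simp, intro]: "convergent2 0"
  using convergent2_const2[of 0] by simp

lemma convergent2_sum [intro]: "(\<And>a. a \<in> A \<Longrightarrow> convergent2 (f a)) \<Longrightarrow> convergent2 (sum f A)"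
  by (induction A rule: infinite_finite_induct) auto

lemma convergent2_var [simp, intro]: "convergent2 var_x" "convergent2 var_y"
proof -
  show "convergent2 var_x" by (simp add: var_x_def convergent2_fps_const)
  have "norm (coeff2 var_y i j) \<le> 1 * 1 ^ (i + j)" for i j
    by (simp add: coeff2_var_y)
  then show "convergent2 var_y" unfolding convergent2_iff_geometric by (metis order_refl zero_le_one)
qed

lemma bdd2_small:
  assumes "convergent2 g" "max_ideal g" "s > 0"
  obtains r where "r > 0" "\<And>r'. 0 \<le> r' \<Longrightarrow> r' \<le> r \<Longrightarrow> bdd2 r' g s"
proof -
  obtain r C where r: "r > 0" and C: "bdd2 r g C" using assms by (auto simp: convergent2_iff_bdd2)
  have C0: "C \<ge> 0" using C by (rule bdd2_nonneg)
  \<comment> \<open>Below this radius the bound \<open>C * r' / r\<close> of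
    \<open>bdd2_scale\<close> is at most \<open>s\<close>; \<open>C + 1\<close> avoids a division by
    zero.\<close>
  define r0 where "r0 = min r (s * r / (C + 1))"
  have "r0 > 0" using assms r C0 by (simp add: r0_def)
  moreover have "bdd2 r' g s" if "0 \<le> r'" "r' \<le> r0" for r'
  proof -
    have "bdd2 r' g (C * r' / r)"
      using that r C assms by (intro bdd2_scale) (auto simp: r0_def)
    moreover have "C * r' / r \<le> s"
    proof -
      have "r' \<le> s * r / (C + 1)" using that by (simp add: r0_def)
      then have "r' * (C + 1) \<le> s * r" using C0 by (simp add: field_simps)
      moreover have "C * r' \<le> r' * (C + 1)" using that by (simp add: algebra_simps)
      ultimately show ?thesis using r by (simp add: field_simps)
    qed
    ultimately show ?thesis by (rule bdd2_weaken)
  qed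
  ultimately show thesis by (rule that)
qed

lemma bdd2_small2:
  assumes "convergent2 g" "max_ideal g" "convergent2 h" "max_ideal h" "s > 0"
  obtains r where "r > 0" "\<And>r'. 0 \<le> r' \<Longrightarrow> r' \<le> r \<Longrightarrow> bdd2 r' g s \<and> bdd2 r' h s"
proof -
  obtain r1 where "r1 > 0" "\<And>r'. 0 \<le> r' \<Longrightarrow> r' \<le> r1 \<Longrightarrow> bdd2 r' g s"
    by (rule bdd2_small[OF assms(1,2,5)]) blast
  moreover obtain r2 where "r2 > 0" "\<And>r'. 0 \<le> r' \<Longrightarrow> r' \<le> r2 \<Longrightarrow> bdd2 r' h s"
    by (rule bdd2_small[OF assms(3,4,5)]) blast
  ultimately show thesis by (intro that[of "min r1 r2"]) auto
qed

lemma convergent2_subst22 [intro]: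
  assumes "convergent2 f" "convergent2 g" "max_ideal g" "convergent2 h" "max_ideal h"
  shows "convergent2 (subst22 f (g, h))"
proof -
  obtain s C where s: "s > 0" and C: "bdd2 s f C" using assms by (auto simp: convergent2_iff_bdd2)
  obtain r where r: "r > 0" "bdd2 r g s" "bdd2 r h s"
    using bdd2_small2[OF assms(2-5) s] by (metis less_imp_le order_refl)
  then have "bdd2 r (subst22 f (g, h)) C"
    using C by (intro bdd2_subst22) auto
  then show ?thesis using r by (auto simp: convergent2_iff_bdd2)
qed

lemma le_power_2: "real (Suc i) \<le> 2 ^ i"
  by (metis Suc_leI less_exp of_nat_le_iff of_nat_numeral of_nat_power)

lemma convergent2_deriv [intro]:
  assumes "convergent2 f"
  shows "convergent2 (deriv_x f)" "convergent2 (deriv_y f)"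
proof -
  obtain C R where R: "R \<ge> 1" and C: "C \<ge> 0" "\<And>i j. norm (coeff2 f i j) \<le> C * R ^ (i + j)"
    using assms by (auto simp: convergent2_iff_geometric)
  have *: "real (Suc k) * norm (coeff2 f a b) \<le> (C * R) * (2 * R) ^ (i + j)"
    if "a + b = Suc (i + j)" "k \<le> i + j" for a b i j k
  proof -
    have "real (Suc k) \<le> 2 ^ (i + j)"
      using le_power_2[of k] power_increasing[OF that(2), of "2::real"] by linarith
    then have "real (Suc k) * norm (coeff2 f a b) \<le> 2 ^ (i + j) * (C * R ^ Suc (i + j))"
      using C(2)[of a b] that by (intro mult_mono) auto
    then show ?thesis by (simp add: power_mult_distrib mult_ac)
  qed
  have "norm (coeff2 (deriv_x f) i j) \<le> (C * R) * (2 * R) ^ (i + j)" for i j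
    unfolding coeff2_deriv_x norm_mult norm_of_nat by (rule *) auto
  then show "convergent2 (deriv_x f)"
    unfolding convergent2_iff_geometric using R C(1)
    by (intro exI[of _ "C * R"] exI[of _ "2 * R"]) auto
  have "norm (coeff2 (deriv_y f) i j) \<le> (C * R) * (2 * R) ^ (i + j)" for i j
    unfolding coeff2_deriv_y norm_mult norm_of_nat by (rule *) auto
  then show "convergent2 (deriv_y f)"
    unfolding convergent2_iff_geometric using R C(1)
    by (intro exI[of _ "C * R"] exI[of _ "2 * R"]) auto
qed

lemma convergent2_swap2 [intro]: "convergent2 f \<Longrightarrow> convergent2 (swap2 f)"
  unfolding convergent2_iff_geometric by (metis add.commute coeff2_swap2)

lemma fps_conv_radius_subst2:
  assumes "convergent2 f" "fps_conv_radius a > 0" "fps_conv_radius b > 0"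
    and "fps_nth a 0 = 0" "fps_nth b 0 = 0"
  shows "fps_conv_radius (subst2 f (a, b)) > 0"
  using assms unfolding convergent2_fps_const[symmetric] fps_const_subst2[OF assms(4,5)]
  by (intro convergent2_subst22) auto

lemma fps_conv_radius_compose:
  fixes a b :: "complex fps"
  assumes "fps_conv_radius a > 0" "fps_conv_radius b > 0" "fps_nth b 0 = 0"
  shows "fps_conv_radius (a oo b) > 0"
  using fps_conv_radius_subst2[of "fps_const a" b 0] assms
  by (simp add: subst2_fps_const convergent2_fps_const)

section \<open>Evaluation\<close>

lemma bdd2_fps_const_conv_radius:
  assumes "bdd2 r (fps_const a) C" "r \<ge> 0"
  shows "fps_conv_radius a \<ge> r"
proof -
  have "summable (\<lambda>m. norm (fps_nth a m * of_real r ^ m))"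
    using assms bdd2_nonneg[OF assms(1)]
    by (intro bounded_imp_summable[of _ C]) (auto simp: bdd2_def diag_norm_fps_const norm_mult norm_power)
  then have "fps_conv_radius a \<ge> norm (complex_of_real r)"
    unfolding fps_conv_radius_def by (intro conv_radius_geI) (rule summable_norm_cancel)
  then show ?thesis using assms by simp
qed

lemma bdd2_fps_const_summable:
  assumes "bdd2 (norm t) (fps_const a) C"
  shows "summable (\<lambda>m. norm (fps_nth a m * t ^ m))" "(\<Sum>m. norm (fps_nth a m * t ^ m)) \<le> C"
proof -
  have b: "(\<Sum>m\<le>N. norm (fps_nth a m * t ^ m)) \<le> C" for N
    using assms by (simp add: bdd2_def diag_norm_fps_const norm_mult norm_power)
  show s: "summable (\<lambda>m. norm (fps_nth a m * t ^ m))"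
    using b by (intro bounded_imp_summable[of _ C]) auto
  have "(\<Sum>m<N. norm (fps_nth a m * t ^ m)) \<le> C" for N
    using b[of N] by (intro order_trans[OF sum_mono2 b[of N]]) auto
  with s show "(\<Sum>m. norm (fps_nth a m * t ^ m)) \<le> C"
    by (rule suminf_le_const)
qed

text \<open>The family indexed by the monomials of \<open>f\<close> and the powers of
  \<open>t\<close> is absolutely summable: its sum over the powers is dominated by
  \<open>norm (coeff2 f i j) * s^(i + j)\<close>. Summing first over the powers gives the value of
  \<open>f\<close> at the point of the curve; summing first over the monomials gives the substituted
  series at \<open>t\<close>.\<close>

lemma eval2_subst2_aux:
  assumes f: "bdd2 s f C" "s > 0"
    and a: "bdd2 (norm t) (fps_const a) s" "norm t < fps_conv_radius a" "fps_nth a 0 = 0"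
    and b: "bdd2 (norm t) (fps_const b) s" "norm t < fps_conv_radius b" "fps_nth b 0 = 0"
  shows "eval_fps (subst2 f (a, b)) t = eval2 f (eval_fps a t, eval_fps b t)"
proof -
  define \<phi> where "\<phi> = (\<lambda>(i, j) m. coeff2 f i j * (fps_nth (a ^ i * b ^ j) m * t ^ m))"
  have ab: "bdd2 (norm t) (fps_const (a ^ i * b ^ j)) (s ^ (i + j))" for i j
    using a b unfolding fps_const_mult[symmetric] fps_const_power[symmetric] power_add
    by (intro bdd2_mult bdd2_power) auto
  have sum_ab: "summable (\<lambda>m. norm (\<phi> x m))" "(\<Sum>m. norm (\<phi> x m)) \<le> norm (coeff2 f (fst x) (snd x)) * s ^ (fst x + snd x)" for x
  proof -
    note * = bdd2_fps_const_summable[OF ab[of "fst x" "snd x"]]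
    show "summable (\<lambda>m. norm (\<phi> x m))"
      using summable_mult[OF *(1), of "norm (coeff2 f (fst x) (snd x))"]
      by (simp add: \<phi>_def case_prod_unfold norm_mult)
    have "(\<Sum>m. norm (\<phi> x m)) = norm (coeff2 f (fst x) (snd x)) * (\<Sum>m. norm (fps_nth (a ^ fst x * b ^ snd x) m * t ^ m))"
      by (subst suminf_mult[OF *(1), symmetric]) (simp add: \<phi>_def case_prod_unfold norm_mult)
    also have "\<dots> \<le> norm (coeff2 f (fst x) (snd x)) * s ^ (fst x + snd x)"
      using *(2) by (rule mult_left_mono) simp
    finally show "(\<Sum>m. norm (\<phi> x m)) \<le> norm (coeff2 f (fst x) (snd x)) * s ^ (fst x + snd x)" .
  qed
  have inner: "((\<lambda>m. norm (\<phi> x m)) has_sum (\<Sum>m. norm (\<phi> x m))) UNIV" for x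
    using sum_ab(1)[of x] by (intro norm_summable_imp_has_sum) (auto intro: summable_sums)
  have "(\<lambda>x. \<Sum>m. norm (\<phi> x m)) summable_on UNIV"
  proof (rule summable_on_comparison_test[OF bdd2_summable[OF f]])
    show "(\<Sum>m. norm (\<phi> x m)) \<le> (case x of (i, j) \<Rightarrow> norm (coeff2 f i j) * s ^ (i + j))" for x
      using sum_ab(2)[of x] by (simp add: case_prod_unfold)
    show "0 \<le> (\<Sum>m. norm (\<phi> x m))" for x
      by (intro suminf_nonneg sum_ab) auto
  qed
  then have "(\<lambda>(x, m). norm (\<phi> x m)) summable_on (UNIV \<times> UNIV)"
    using inner by (intro summable_on_SigmaI[where g = "\<lambda>x. \<Sum>m. norm (\<phi> x m)"]) auto
  then have abs: "(\<lambda>z. norm (case z of (x, m) \<Rightarrow> \<phi> x m)) summable_on (UNIV \<times> UNIV)"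
    by (simp add: case_prod_unfold)
  have swap: "(\<Sum>\<^sub>\<infinity>x\<in>UNIV. \<Sum>\<^sub>\<infinity>m\<in>UNIV. \<phi> x m) = (\<Sum>\<^sub>\<infinity>m\<in>UNIV. \<Sum>\<^sub>\<infinity>x\<in>UNIV. \<phi> x m)"
    by (rule infsum_swap_banach) (rule abs_summable_summable[OF abs])
  have "(\<Sum>\<^sub>\<infinity>m\<in>UNIV. \<phi> (i, j) m) = coeff2 f i j * (eval_fps a t ^ i * eval_fps b t ^ j)" for i j
  proof -
    have "infsum (\<phi> (i, j)) UNIV = (\<Sum>m. \<phi> (i, j) m)"
      using norm_summable_imp_has_sum[OF sum_ab(1) summable_sums[OF summable_norm_cancel[OF sum_ab(1)]]]
      by (rule infsumI)
    also have "\<dots> = coeff2 f i j * eval_fps (a ^ i * b ^ j) t"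
      using summable_norm_cancel[OF bdd2_fps_const_summable(1)[OF ab[of i j]]]
      unfolding eval_fps_def \<phi>_def by (simp add: suminf_mult)
    also have "eval_fps (a ^ i * b ^ j) t = eval_fps a t ^ i * eval_fps b t ^ j"
      using a(2) b(2) fps_conv_radius_power[of a i] fps_conv_radius_power[of b j]
      by (subst eval_fps_mult) (auto simp: eval_fps_power intro: less_le_trans)
    finally show ?thesis .
  qed
  then have L: "(\<Sum>\<^sub>\<infinity>x\<in>UNIV. \<Sum>\<^sub>\<infinity>m\<in>UNIV. \<phi> x m) = eval2 f (eval_fps a t, eval_fps b t)"
    unfolding eval2_def by (intro infsum_cong) (auto simp: mult.assoc)
  have R: "(\<Sum>\<^sub>\<infinity>x\<in>UNIV. \<phi> x m) = fps_nth (subst2 f (a, b)) m * t ^ m" for m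
  proof -
    \<comment> \<open>Only finitely many monomials reach a given power of \<open>t\<close>, which
      reduces the infinite sum to the finite one in \<open>subst2\<close>.\<close>
    have van: "fps_nth (a ^ i * b ^ j) m = 0" if "m < i + j" for i j
    proof -
      have "vanish (i + j) (fps_const a ^ i * fps_const b ^ j)"
        using a b by (intro vanish_mon) auto
      then have "coeff2 (fps_const (a ^ i * b ^ j)) m 0 = 0"
        using that unfolding vanish_def fps_const_power fps_const_mult by auto
      then show ?thesis by (simp add: coeff2_fps_const)
    qed
    have "(\<Sum>\<^sub>\<infinity>x\<in>UNIV. \<phi> x m) = (\<Sum>\<^sub>\<infinity>x\<in>{(i, j). i + j \<le> m}. \<phi> x m)"
      by (rule infsum_cong_neutral) (auto simp: \<phi>_def van)
    also have "\<dots> = (\<Sum>x\<in>{(i, j). i + j \<le> m}. \<phi> x m)"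
      by (rule infsum_finite) simp
    also have "\<dots> = (\<Sum>(i, j) | i + j \<le> m. coeff2 f i j * fps_nth (a ^ i * b ^ j) m) * t ^ m"
      by (simp add: \<phi>_def case_prod_unfold sum_distrib_right mult.assoc)
    finally show ?thesis by (simp add: subst2_def case_prod_unfold)
  qed
  have "(\<lambda>m. \<Sum>\<^sub>\<infinity>x\<in>UNIV. \<phi> x m) summable_on UNIV"
  proof -
    have "(\<lambda>(m, x). \<phi> x m) summable_on (UNIV \<times> UNIV)"
      using abs_summable_summable[OF abs] by (subst summable_on_swap) (simp add: case_prod_unfold)
    then show ?thesis
      using summable_on_Sigma_banach[of "\<lambda>m x. \<phi> x m" UNIV "\<lambda>_. UNIV"] by simp
  qed
  then have "((\<lambda>m. fps_nth (subst2 f (a, b)) m * t ^ m) has_sum (\<Sum>\<^sub>\<infinity>m\<in>UNIV. fps_nth (subst2 f (a, b)) m * t ^ m)) UNIV"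
    unfolding R by (rule has_sum_infsum)
  then have "eval_fps (subst2 f (a, b)) t = (\<Sum>\<^sub>\<infinity>m\<in>UNIV. \<Sum>\<^sub>\<infinity>x\<in>UNIV. \<phi> x m)"
    unfolding R eval_fps_def using has_sum_imp_sums sums_unique by metis
  then show ?thesis using swap L by simp
qed

text \<open>Values of a two-variable series are read off its restriction to the line through the point.\<close>

definition line :: "complex \<times> complex \<Rightarrow> complex fps \<times> complex fps" where
  "line p = (fps_const (fst p) * fps_X, fps_const (snd p) * fps_X)"

lemma line_simps:
  "fps_nth (fps_const c * fps_X) 0 = (0 :: complex)"
  "fps_conv_radius (fps_const c * fps_X) = (\<infinity> :: ereal)"
  "eval_fps (fps_const c * fps_X) 1 = (c :: complex)"
proof -
  show "fps_nth (fps_const c * fps_X) 0 = (0 :: complex)" by simp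
  show r: "fps_conv_radius (fps_const c * fps_X) = (\<infinity> :: ereal)"
    using fps_conv_radius_mult[of "fps_const c" fps_X] by simp
  show "eval_fps (fps_const c * fps_X) 1 = (c :: complex)"
    by (subst eval_fps_mult) auto
qed

lemma bdd2_linear: "bdd2 r (fps_const (fps_const c * fps_X)) (norm c * r)" if "r \<ge> 0"
  unfolding bdd2_def
proof
  fix N
  have "(\<Sum>m\<le>N. diag_norm (fps_const (fps_const c * fps_X)) m * r ^ m) = (\<Sum>m\<le>N. if m = 1 then norm c * r else 0)"
    unfolding diag_norm_fps_const by (intro sum.cong) auto
  also have "\<dots> \<le> norm c * r" using that by (simp add: sum.delta)
  finally show "(\<Sum>m\<le>N. diag_norm (fps_const (fps_const c * fps_X)) m * r ^ m) \<le> norm c * r" .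
qed

lemma eval2_line:
  assumes "bdd2 s f C" "s > 0" "norm (fst p) \<le> s" "norm (snd p) \<le> s"
  shows "eval2 f p = eval_fps (subst2 f (line p)) 1"
proof -
  have "bdd2 (norm (1::complex)) (fps_const (fps_const c * fps_X)) s" if "norm c \<le> s" for c
    using bdd2_linear[of 1 c] that by (auto intro: bdd2_weaken)
  then show ?thesis
    unfolding line_def using assms
    by (subst eval2_subst2_aux[of s f C]) (simp_all add: line_simps)
qed

text \<open>Radius 2 rather than 1 puts the evaluation point 1 of the line strictly inside the disc
  of convergence, where values of sums and products may be computed; hence the factors 2 in the
  hypotheses.\<close>

lemma bdd2_line:
  assumes "bdd2 r g D" "2 * norm (fst p) \<le> r" "2 * norm (snd p) \<le> r" "r > 0"
  shows "bdd2 2 (fps_const (subst2 g (line p))) D"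
  unfolding line_def using assms
  by (subst fps_const_subst2)
     (auto intro!: bdd2_subst22[of r] bdd2_weaken[OF bdd2_linear])

lemma bdd2_2_conv_radius:
  assumes "bdd2 2 (fps_const a) C"
  shows "norm (1 :: complex) < fps_conv_radius a"
proof -
  have "ereal (norm (1 :: complex)) < ereal 2" by simp
  also have "\<dots> \<le> fps_conv_radius a" using assms by (rule bdd2_fps_const_conv_radius) simp
  finally show ?thesis .
qed

lemma norm_eval2_le:
  assumes "bdd2 r g D" "2 * norm (fst p) \<le> r" "2 * norm (snd p) \<le> r" "r > 0"
  shows "norm (eval2 g p) \<le> D"
proof -
  have "bdd2 (norm (1::complex)) (fps_const (subst2 g (line p))) D"
    by (rule bdd2_mono[OF bdd2_line[OF assms]]) auto
  note s = bdd2_fps_const_summable[OF this]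
  have "norm (eval_fps (subst2 g (line p)) 1) \<le> D"
    unfolding eval_fps_def by (rule order_trans[OF summable_norm[OF s(1)] s(2)])
  moreover have "eval2 g p = eval_fps (subst2 g (line p)) 1"
    by (rule eval2_line) (use assms in auto)
  ultimately show ?thesis by simp
qed

lemma eventually_small:
  assumes "(r::real) > 0"
  shows "\<forall>\<^sub>F p :: complex \<times> complex in nhds 0. 2 * norm (fst p) \<le> r \<and> 2 * norm (snd p) \<le> r"
proof -
  have "\<forall>\<^sub>F p :: complex \<times> complex in nhds 0. p \<in> ball 0 (r / 2)"
    using assms by (intro eventually_nhds_in_open) auto
  then show ?thesis
  proof eventually_elim
    case (elim p)
    then have "norm p < r / 2" by simp
    then show ?case
      using norm_fst_le[of "fst p" "snd p"] norm_snd_le[of "snd p" "fst p"] by simp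
  qed
qed

lemma eval2_tendsto_0:
  assumes "convergent2 g" "max_ideal g"
  shows "(eval2 g \<longlongrightarrow> 0) (nhds 0)"
proof (rule tendstoI)
  fix e :: real assume e: "e > 0"
  obtain r where r: "r > 0" "bdd2 r g (e / 2)"
    using bdd2_small[OF assms, of "e / 2"] e by (metis half_gt_zero less_imp_le order_refl)
  show "\<forall>\<^sub>F p in nhds 0. dist (eval2 g p) 0 < e"
    using eventually_small[OF r(1)]
  proof eventually_elim
    case (elim p)
    then have "norm (eval2 g p) \<le> e / 2" by (intro norm_eval2_le[OF r(2) _ _ r(1)]) auto
    then show ?case using e by (simp add: dist_norm)
  qed
qed

lemma eval2_add:
  assumes "convergent2 f" "convergent2 g"
  shows "\<forall>\<^sub>F p in nhds 0. eval2 (f + g) p = eval2 f p + eval2 g p"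
proof -
  obtain r C D where r: "r > 0" "bdd2 r f C" "bdd2 r g D" using convergent2_common[OF assms] .
  show ?thesis
    using eventually_small[OF r(1)]
  proof eventually_elim
    case (elim p)
    then have p: "2 * norm (fst p) \<le> r" "2 * norm (snd p) \<le> r" "norm (fst p) \<le> r" "norm (snd p) \<le> r"
      using norm_ge_zero[of "fst p"] norm_ge_zero[of "snd p"] by linarith+
    note b = bdd2_line[OF r(2) p(1,2) r(1)] bdd2_line[OF r(3) p(1,2) r(1)]
    have rad: "norm (1::complex) < fps_conv_radius (subst2 f (line p))"
      "norm (1::complex) < fps_conv_radius (subst2 g (line p))"
      using bdd2_2_conv_radius[OF b(1)] bdd2_2_conv_radius[OF b(2)] by blast+
    have "eval2 (f + g) p = eval_fps (subst2 (f + g) (line p)) 1"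
      using r(1) by (intro eval2_line[OF bdd2_add[OF r(2,3)] r(1) p(3,4)]) simp
    also have "\<dots> = eval_fps (subst2 f (line p)) 1 + eval_fps (subst2 g (line p)) 1"
      using rad by (simp add: line_def subst2_add eval_fps_add)
    also have "\<dots> = eval2 f p + eval2 g p"
      by (simp only: eval2_line[OF r(2,1) p(3,4)] eval2_line[OF r(3,1) p(3,4)])
    finally show ?case .
  qed
qed

lemma eval2_mult:
  assumes "convergent2 f" "convergent2 g"
  shows "\<forall>\<^sub>F p in nhds 0. eval2 (f * g) p = eval2 f p * eval2 g p"
proof -
  obtain r C D where r: "r > 0" "bdd2 r f C" "bdd2 r g D" using convergent2_common[OF assms] .
  show ?thesis
    using eventually_small[OF r(1)]
  proof eventually_elim
    case (elim p)
    then have p: "2 * norm (fst p) \<le> r" "2 * norm (snd p) \<le> r" "norm (fst p) \<le> r" "norm (snd p) \<le> r"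
      using norm_ge_zero[of "fst p"] norm_ge_zero[of "snd p"] by linarith+
    note b = bdd2_line[OF r(2) p(1,2) r(1)] bdd2_line[OF r(3) p(1,2) r(1)]
    have rad: "norm (1::complex) < fps_conv_radius (subst2 f (line p))"
      "norm (1::complex) < fps_conv_radius (subst2 g (line p))"
      using bdd2_2_conv_radius[OF b(1)] bdd2_2_conv_radius[OF b(2)] by blast+
    have "eval2 (f * g) p = eval_fps (subst2 (f * g) (line p)) 1"
      using r(1) by (intro eval2_line[OF bdd2_mult[OF r(2,3)] r(1) p(3,4)]) simp
    also have "\<dots> = eval_fps (subst2 f (line p)) 1 * eval_fps (subst2 g (line p)) 1"
      using rad by (simp add: line_def subst2_mult eval_fps_mult)
    also have "\<dots> = eval2 f p * eval2 g p"
      by (simp only: eval2_line[OF r(2,1) p(3,4)] eval2_line[OF r(3,1) p(3,4)])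
    finally show ?case .
  qed
qed

lemma eval2_subst22:
  assumes f: "convergent2 f" and g: "convergent2 g" "max_ideal g" and h: "convergent2 h" "max_ideal h"
  shows "\<forall>\<^sub>F p in nhds 0. eval2 (subst22 f (g, h)) p = eval2 f (eval2 g p, eval2 h p)"
proof -
  obtain s C where s: "s > 0" and C: "bdd2 s f C" using f by (auto simp: convergent2_iff_bdd2)
  obtain r where r: "r > 0" "bdd2 r g s" "bdd2 r h s"
    using bdd2_small2[OF g h s] by (metis less_imp_le order_refl)
  show ?thesis
    using eventually_small[OF r(1)]
  proof eventually_elim
    case (elim p)
    then have p: "2 * norm (fst p) \<le> r" "2 * norm (snd p) \<le> r" "norm (fst p) \<le> r" "norm (snd p) \<le> r"
      using norm_ge_zero[of "fst p"] norm_ge_zero[of "snd p"] by linarith+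
    note b = bdd2_line[OF r(2) p(1,2) r(1)] bdd2_line[OF r(3) p(1,2) r(1)]
    have rad: "norm (1::complex) < fps_conv_radius (subst2 g (line p))"
      "norm (1::complex) < fps_conv_radius (subst2 h (line p))"
      using bdd2_2_conv_radius[OF b(1)] bdd2_2_conv_radius[OF b(2)] by blast+
    have z: "fps_nth (subst2 u (line p)) 0 = coeff2 u 0 0" for u
      by (simp add: line_def subst2_nth_0)
    have "eval2 (subst22 f (g, h)) p = eval_fps (subst2 (subst22 f (g, h)) (line p)) 1"
      using r(1) by (intro eval2_line[OF bdd2_subst22[OF C r(2,3)] r(1) p(3,4)]) simp
    also have "subst2 (subst22 f (g, h)) (line p) = subst2 f (subst2 g (line p), subst2 h (line p))"
      unfolding line_def using g h by (intro subst2_subst22) auto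
    also have "eval_fps \<dots> 1 = eval2 f (eval_fps (subst2 g (line p)) 1, eval_fps (subst2 h (line p)) 1)"
      using g h b by (intro eval2_subst2_aux[OF C s] rad)
        (auto simp: z max_ideal_def intro: bdd2_mono[of 2])
    also have "\<dots> = eval2 f (eval2 g p, eval2 h p)"
      by (simp only: eval2_line[OF r(2,1) p(3,4)] eval2_line[OF r(3,1) p(3,4)])
    finally show ?case .
  qed
qed

lemma eval_fps_subst2:
  assumes f: "convergent2 f" and a: "fps_conv_radius a > 0" "fps_nth a 0 = 0"
    and b: "fps_conv_radius b > 0" "fps_nth b 0 = 0"
  shows "\<forall>\<^sub>F t in nhds 0. eval_fps (subst2 f (a, b)) t = eval2 f (eval_fps a t, eval_fps b t)"
proof -
  obtain s C where s: "s > 0" and C: "bdd2 s f C" using f by (auto simp: convergent2_iff_bdd2)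
  obtain r where r: "r > 0" "\<And>r'. 0 \<le> r' \<Longrightarrow> r' \<le> r \<Longrightarrow> bdd2 r' (fps_const a) s \<and> bdd2 r' (fps_const b) s"
    by (rule bdd2_small2[OF convergent2_fps_const[THEN iffD2, OF a(1)] max_ideal_intros(9)[OF a(2)]
          convergent2_fps_const[THEN iffD2, OF b(1)] max_ideal_intros(9)[OF b(2)] s]) blast
  have "\<forall>\<^sub>F t in nhds 0. t \<in> ball 0 r \<inter> eball 0 (fps_conv_radius a) \<inter> eball 0 (fps_conv_radius b)"
    using r a b by (intro eventually_nhds_in_open) (auto simp: zero_ereal_def)
  then show ?thesis
  proof eventually_elim
    case (elim t)
    then show ?case
      using r(2)[of "norm t"] a b by (intro eval2_subst2_aux[OF C s]) auto
  qed
qed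

lemma eval2_fps_const:
  assumes "fps_conv_radius a > 0"
  shows "\<forall>\<^sub>F p in nhds 0. eval2 (fps_const a) p = eval_fps a (fst p)"
proof -
  obtain r C where r: "r > 0" "bdd2 r (fps_const a) C"
    using assms by (auto simp: convergent2_iff_bdd2 simp flip: convergent2_fps_const)
  show ?thesis
    using eventually_small[OF r(1)]
  proof eventually_elim
    case (elim p)
    then have p: "norm (fst p) \<le> r" "norm (snd p) \<le> r"
      using norm_ge_zero[of "fst p"] norm_ge_zero[of "snd p"] by linarith+
    have "eval2 (fps_const a) p = eval_fps (subst2 (fps_const a) (line p)) 1"
      by (rule eval2_line[OF r(2,1) p])
    also have "\<dots> = eval_fps a (fst p)"
      unfolding line_def subst2_fps_const eval_fps_def fps_nth_compose_linear by (simp add: mult.commute)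
    finally show ?case .
  qed
qed

lemma eval2_var:
  "\<forall>\<^sub>F p in nhds 0. eval2 var_x p = fst p" "\<forall>\<^sub>F p in nhds 0. eval2 var_y p = snd p"
proof -
  obtain r C D where r: "r > 0" "bdd2 r var_x C" "bdd2 r var_y D"
    by (rule convergent2_common[of var_x var_y]) auto
  have *: "\<forall>\<^sub>F p in nhds 0. eval2 var_x p = fst p \<and> eval2 var_y p = snd p"
    using eventually_small[OF r(1)]
  proof eventually_elim
    case (elim p)
    then have p: "norm (fst p) \<le> r" "norm (snd p) \<le> r"
      using norm_ge_zero[of "fst p"] norm_ge_zero[of "snd p"] by linarith+
    show ?case
      unfolding eval2_line[OF r(2,1) p] eval2_line[OF r(3,1) p] by (simp add: line_def line_simps)
  qed
  show "\<forall>\<^sub>F p in nhds 0. eval2 var_x p = fst p" "\<forall>\<^sub>F p in nhds 0. eval2 var_y p = snd p"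
    using * by (auto elim: eventually_mono)
qed

lemma eval2_prod:
  assumes "finite A" "\<And>a. a \<in> A \<Longrightarrow> convergent2 (f a)"
  shows "\<forall>\<^sub>F p in nhds 0. eval2 (prod f A) p = (\<Prod>a\<in>A. eval2 (f a) p)"
  using assms
proof (induction A rule: finite_induct)
  case empty
  have "\<forall>\<^sub>F p in nhds 0. eval2 (fps_const 1) p = eval_fps 1 (fst p)"
    by (rule eval2_fps_const) simp
  then show ?case by simp
next
  case (insert a A)
  have "\<forall>\<^sub>F p in nhds 0. eval2 (f a * prod f A) p = eval2 (f a) p * eval2 (prod f A) p"
    using insert.prems by (intro eval2_mult) auto
  moreover have "\<forall>\<^sub>F p in nhds 0. eval2 (prod f A) p = (\<Prod>a\<in>A. eval2 (f a) p)"
    using insert by simp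
  ultimately show ?case
    by eventually_elim (use insert in simp)
qed

lemma fps_eqI_eventually:
  fixes a b :: "complex fps"
  assumes "fps_conv_radius a > 0" "fps_conv_radius b > 0" "\<forall>\<^sub>F t in nhds 0. eval_fps a t = eval_fps b t"
  shows "a = b"
proof (rule fps_expansion_unique_complex)
  show "eval_fps a has_fps_expansion a" "eval_fps a has_fps_expansion b"
    using assms by (auto simp: has_fps_expansion_def elim: eventually_mono)
qed

lemma eval_fps_tendsto_0:
  fixes a :: "complex fps"
  assumes "fps_conv_radius a > 0" "fps_nth a 0 = 0"
  shows "(eval_fps a \<longlongrightarrow> 0) (nhds 0)"
proof -
  have "isCont (eval_fps a) 0"
    using assms by (intro continuous_eval_fps) (auto simp: zero_ereal_def)
  then have "(eval_fps a \<longlongrightarrow> eval_fps a 0) (nhds 0)"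
    by (simp add: isCont_def tendsto_at_iff_tendsto_nhds)
  then show ?thesis using assms by (simp add: eval_fps_at_0)
qed

lemma eval_fps_compose:
  fixes a b :: "complex fps"
  assumes "fps_conv_radius a > 0" "fps_conv_radius b > 0" "fps_nth b 0 = 0"
  shows "\<forall>\<^sub>F t in nhds 0. eval_fps (a oo b) t = eval_fps a (eval_fps b t)"
proof -
  have "\<forall>\<^sub>F t in nhds 0. eval_fps (subst2 (fps_const a) (b, 0)) t = eval2 (fps_const a) (eval_fps b t, eval_fps 0 t)"
    using assms by (intro eval_fps_subst2) (auto simp: convergent2_fps_const)
  moreover have "filterlim (\<lambda>t. (eval_fps b t, eval_fps 0 t)) (nhds 0) (nhds 0)"
    using tendsto_Pair[OF eval_fps_tendsto_0[OF assms(2,3)] tendsto_const[of 0]]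
    by (simp add: zero_prod_def)
  from eventually_compose_filterlim[OF eval2_fps_const[OF assms(1)] this]
  have "\<forall>\<^sub>F t in nhds 0. eval2 (fps_const a) (eval_fps b t, eval_fps 0 t) = eval_fps a (eval_fps b t)"
    by simp
  ultimately show ?thesis
    by eventually_elim (simp add: subst2_fps_const)
qed

lemma eval_map_tendsto_0:
  assumes "holomorphic_map_germ \<phi>"
  shows "(eval_map \<phi> \<longlongrightarrow> 0) (nhds 0)"
proof -
  have "((\<lambda>p. (eval2 (fst \<phi>) p, eval2 (snd \<phi>) p)) \<longlongrightarrow> (0, 0)) (nhds 0)"
    using assms by (intro tendsto_Pair eval2_tendsto_0) (auto simp: holomorphic_map_germ_def max_ideal_def)
  then show ?thesis by (simp add: eval_map_def[abs_def] zero_prod_def)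
qed

section \<open>Exponentials of vector fields\<close>

lemma deriv_x_mult: "deriv_x (f * g) = deriv_x f * g + f * deriv_x g"
  by (rule fps_ext)
     (simp add: deriv_x_def fps_mult_nth fps_deriv_sum sum.distrib add.commute)

lemma deriv_y_mult: "deriv_y (f * g) = deriv_y f * g + f * deriv_y g"
  by (simp add: deriv_y_def add.commute)

lemma deriv_x_add: "deriv_x (f + g) = deriv_x f + deriv_x g"
  by (rule fps_ext) (simp add: deriv_x_def)

lemma deriv_y_add: "deriv_y (f + g) = deriv_y f + deriv_y g"
  by (simp add: deriv_y_def)

lemma deriv_var [simp]:
  "deriv_x var_x = 1" "deriv_x var_y = 0" "deriv_y var_x = 0" "deriv_y var_y = 1"
  by (rule fps2_eqI; auto simp: coeff2_deriv_x coeff2_deriv_y coeff2_var_x coeff2_var_y coeff2_1)+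

lemma deriv_fps_const [simp]: "deriv_x (fps_const a) = fps_const (fps_deriv a)" "deriv_y (fps_const a) = 0"
  by (rule fps2_eqI; auto simp: coeff2_deriv_x coeff2_deriv_y coeff2_fps_const)+

lemma vanish_deriv:
  assumes "vanish (Suc N) f"
  shows "vanish N (deriv_x f)" "vanish N (deriv_y f)"
  using assms by (auto simp: vanish_def coeff2_deriv_x coeff2_deriv_y)

lemma vf_apply_add: "vf_apply X (f + g) = vf_apply X f + vf_apply X g"
  by (simp add: vf_apply_def deriv_x_add deriv_y_add algebra_simps)

lemma vf_apply_mult: "vf_apply X (f * g) = vf_apply X f * g + f * vf_apply X g"
  by (simp add: vf_apply_def deriv_x_mult deriv_y_mult algebra_simps)

lemma vf_apply_var [simp]: "vf_apply X var_x = fst X" "vf_apply X var_y = snd X"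
  by (simp_all add: vf_apply_def)

lemma vf_apply_const2 [simp]: "vf_apply X (const2 c) = 0"
  by (simp add: vf_apply_def)

lemma vf_apply_1 [simp]: "vf_apply X 1 = 0"
  using vf_apply_const2[of X 1] by simp

lemma vf_apply_const2_mult: "vf_apply X (const2 c * f) = const2 c * vf_apply X f"
  by (simp add: vf_apply_mult)

lemma vf_apply_sum: "vf_apply X (sum f A) = (\<Sum>a\<in>A. vf_apply X (f a))"
  using vf_apply_const2[of X 0]
  by (induction A rule: infinite_finite_induct) (simp_all add: vf_apply_add)

lemma vf_apply_uminus_vf: "vf_apply (- X) f = - vf_apply X f"
  by (simp add: vf_apply_def)

lemma singular_formal_vf_iff: "singular_formal_vf X \<longleftrightarrow> max_ideal (fst X) \<and> max_ideal (snd X)"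
  by (simp add: singular_formal_vf_def max_ideal_def)

lemma filtered_linear_vanish: "filtered_linear L \<Longrightarrow> vanish N f \<Longrightarrow> vanish N (L f)"
  by (simp add: filtered_linear_def)

lemma filtered_linear_vf_apply:
  assumes "singular_formal_vf X"
  shows "filtered_linear (vf_apply X)"
proof -
  have "vanish N (vf_apply X f)" if "vanish N f" for N f
  proof (cases N)
    case (Suc M)
    then have "vanish M (deriv_x f)" "vanish M (deriv_y f)" using that vanish_deriv by auto
    then show ?thesis
      using assms vanish_mult[of 1 "fst X" M "deriv_x f"] vanish_mult[of 1 "snd X" M "deriv_y f"] Suc
      by (auto simp: vf_apply_def singular_formal_vf_iff max_ideal_vanish intro: vanish_add)
  qed simp
  then show ?thesis
    by (auto simp: filtered_linear_def vf_apply_add vf_apply_const2_mult)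
qed

lemma filtered_linear_vf_power:
  assumes "singular_formal_vf X"
  shows "filtered_linear (vf_apply X ^^ n)"
proof (induction n)
  case 0
  show ?case by (simp add: id_def filtered_linear_id)
next
  case (Suc n)
  show ?case
    using filtered_linear_compose[OF filtered_linear_vf_apply[OF assms] Suc] by (simp add: o_def)
qed

lemma diag_norm_deriv_x: "diag_norm (deriv_x f) m \<le> real (Suc m) * diag_norm f (Suc m)"
proof -
  have "diag_norm (deriv_x f) m = (\<Sum>i\<le>m. real (Suc i) * norm (coeff2 f (Suc i) (m - i)))"
    unfolding diag_norm_def coeff2_deriv_x norm_mult norm_of_nat ..
  also have "\<dots> \<le> (\<Sum>i\<le>m. real (Suc m) * norm (coeff2 f (Suc i) (Suc m - Suc i)))"
    by (intro sum_mono mult_mono) auto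
  also have "\<dots> \<le> real (Suc m) * diag_norm f (Suc m)"
    unfolding diag_norm_def sum_distrib_left[symmetric]
    by (intro mult_left_mono) (simp_all add: sum.atMost_Suc_shift del: sum.atMost_Suc)
  finally show ?thesis .
qed

lemma diag_norm_deriv_y: "diag_norm (deriv_y f) m \<le> real (Suc m) * diag_norm f (Suc m)"
proof -
  have "diag_norm (deriv_y f) m = (\<Sum>i\<le>m. real (Suc (m - i)) * norm (coeff2 f i (Suc (m - i))))"
    unfolding diag_norm_def coeff2_deriv_y norm_mult norm_of_nat ..
  also have "\<dots> \<le> (\<Sum>i\<le>m. real (Suc m) * norm (coeff2 f i (Suc m - i)))"
    by (intro sum_mono mult_mono) (auto simp: Suc_diff_le)
  also have "\<dots> \<le> real (Suc m) * diag_norm f (Suc m)"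
    unfolding diag_norm_def sum_distrib_left[symmetric]
    by (intro mult_left_mono) auto
  finally show ?thesis .
qed

text \<open>A derivative lowers the degree by one and costs a factor of at most \<open>m\<close>; as
  \<open>A\<close> has no constant term, the product restores the degree. So degree \<open>m\<close>
  of the result involves no degree of \<open>f\<close> above \<open>m\<close>.\<close>

lemma diag_norm_mult_deriv:
  assumes "max_ideal A" and D: "\<And>m. diag_norm D m \<le> real (Suc m) * diag_norm f (Suc m)"
  shows "diag_norm (A * D) m \<le> real m * (\<Sum>l<m. diag_norm A (Suc l) * diag_norm f (m - l))"
proof -
  have "diag_norm (A * D) m \<le> (\<Sum>l\<le>m. diag_norm A l * diag_norm D (m - l))"
    by (rule diag_norm_mult)
  also have "\<dots> = (\<Sum>l<m. diag_norm A (Suc l) * diag_norm D (m - Suc l))"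
    using assms(1) unfolding sum.atMost_shift by (simp add: diag_norm_def max_ideal_def)
  also have "\<dots> \<le> (\<Sum>l<m. diag_norm A (Suc l) * (real m * diag_norm f (m - l)))"
  proof (intro sum_mono mult_left_mono)
    fix l assume "l \<in> {..<m}"
    then have *: "Suc (m - Suc l) = m - l" by auto
    have "diag_norm D (m - Suc l) \<le> real (m - l) * diag_norm f (m - l)"
      using D[of "m - Suc l"] by (simp only: *)
    also have "\<dots> \<le> real m * diag_norm f (m - l)" by (intro mult_right_mono) auto
    finally show "diag_norm D (m - Suc l) \<le> real m * diag_norm f (m - l)" .
  qed auto
  finally show ?thesis by (simp add: sum_distrib_left mult_ac)
qed

text \<open>
  On the jets of order at most \<open>m\<close> a singular vector field acts with norm \<open>O(m)\<close>, uniformly in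
  the weight \<open>\<rho>\<close>; hence its exponential has coefficients of size \<open>exp(O(m)) \<rho>\<^sup>-\<^sup>m\<close>.
\<close>

lemma diag_norm_vf_power:
  assumes X: "singular_formal_vf X" and \<rho>: "\<rho> > 0"
    and K: "(\<Sum>l<m. (diag_norm (fst X) (Suc l) + diag_norm (snd X) (Suc l)) * \<rho> ^ l) \<le> K"
    and C: "\<And>k. k \<le> m \<Longrightarrow> diag_norm f k * \<rho> ^ k \<le> C"
    and k: "k \<le> m"
  shows "diag_norm ((vf_apply X ^^ n) f) k * \<rho> ^ k \<le> (real m * K) ^ n * C"
  using k
proof (induction n arbitrary: k)
  case 0
  then show ?case using C by simp
next
  case (Suc n)
  let ?\<psi> = "\<lambda>l. diag_norm (fst X) (Suc l) + diag_norm (snd X) (Suc l)"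
  let ?u = "(vf_apply X ^^ n) f"
  let ?E = "(real m * K) ^ n * C"
  have E: "?E \<ge> 0" using Suc.IH[of k] Suc.prems \<rho> by (meson diag_norm_nonneg mult_nonneg_nonneg order_trans zero_le_power less_imp_le)
  have "diag_norm (vf_apply X ?u) k \<le> diag_norm (fst X * deriv_x ?u) k + diag_norm (snd X * deriv_y ?u) k"
    unfolding vf_apply_def by (rule diag_norm_add)
  also have "\<dots> \<le> real k * (\<Sum>l<k. diag_norm (fst X) (Suc l) * diag_norm ?u (k - l)) +
      real k * (\<Sum>l<k. diag_norm (snd X) (Suc l) * diag_norm ?u (k - l))"
    using X by (intro add_mono diag_norm_mult_deriv diag_norm_deriv_x diag_norm_deriv_y)
      (auto simp: singular_formal_vf_iff)
  also have "\<dots> = real k * (\<Sum>l<k. ?\<psi> l * diag_norm ?u (k - l))"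
    by (simp add: sum.distrib algebra_simps)
  finally have "diag_norm (vf_apply X ?u) k * \<rho> ^ k \<le> real k * (\<Sum>l<k. ?\<psi> l * diag_norm ?u (k - l)) * \<rho> ^ k"
    using \<rho> by (intro mult_right_mono) auto
  also have "\<dots> = real k * (\<Sum>l<k. (?\<psi> l * \<rho> ^ l) * (diag_norm ?u (k - l) * \<rho> ^ (k - l)))"
  proof -
    have "(\<Sum>l<k. ?\<psi> l * diag_norm ?u (k - l)) * \<rho> ^ k =
        (\<Sum>l<k. (?\<psi> l * \<rho> ^ l) * (diag_norm ?u (k - l) * \<rho> ^ (k - l)))"
      unfolding sum_distrib_right
    proof (intro sum.cong refl)
      fix l assume "l \<in> {..<k}"
      then have "\<rho> ^ k = \<rho> ^ l * \<rho> ^ (k - l)" by (simp flip: power_add)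
      then show "?\<psi> l * diag_norm ?u (k - l) * \<rho> ^ k =
          (?\<psi> l * \<rho> ^ l) * (diag_norm ?u (k - l) * \<rho> ^ (k - l))"
        by (simp only: mult_ac)
    qed
    then show ?thesis by (simp only: mult.assoc)
  qed
  also have "\<dots> \<le> real k * (\<Sum>l<k. (?\<psi> l * \<rho> ^ l) * ?E)"
    using Suc \<rho> by (intro mult_left_mono sum_mono Suc.IH) auto
  also have "\<dots> = real k * (\<Sum>l<k. ?\<psi> l * \<rho> ^ l) * ?E"
    by (simp add: sum_distrib_right mult.assoc)
  also have "\<dots> \<le> real m * (\<Sum>l<m. ?\<psi> l * \<rho> ^ l) * ?E"
    using Suc.prems \<rho> E by (intro mult_right_mono mult_mono sum_mono2 sum_nonneg) auto
  also have "\<dots> \<le> real m * K * ?E"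
    using K E by (intro mult_right_mono mult_left_mono) auto
  finally show ?case by (simp add: mult_ac)
qed

text \<open>A single coefficient depends only on jets of order \<open>i + j\<close>, a
  finite-dimensional space. For a formal \<open>X\<close> the weight 1 can thus be taken, and
  \<open>K\<close> is a finite sum.\<close>

lemma vf_power_bound:
  assumes X: "singular_formal_vf X"
  obtains C A where "C \<ge> 0" "A \<ge> 0" "\<And>n. norm (coeff2 ((vf_apply X ^^ n) f) i j) \<le> C * A ^ n"
proof -
  define m where "m = i + j"
  define K where "K = (\<Sum>l<m. (diag_norm (fst X) (Suc l) + diag_norm (snd X) (Suc l)) * 1 ^ l)"
  define C where "C = (\<Sum>k\<le>m. diag_norm f k)"
  have C: "diag_norm f k * 1 ^ k \<le> C" if "k \<le> m" for k
    unfolding C_def using that by (auto intro: member_le_sum)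
  have "norm (coeff2 ((vf_apply X ^^ n) f) i j) \<le> C * (real m * K) ^ n" for n
  proof -
    have "norm (coeff2 ((vf_apply X ^^ n) f) i j) \<le> diag_norm ((vf_apply X ^^ n) f) m * 1 ^ m"
      using norm_coeff2_le_diag_norm by (simp add: m_def)
    also have "\<dots> \<le> (real m * K) ^ n * C"
      by (rule diag_norm_vf_power[OF X]) (use C in \<open>auto simp: K_def\<close>)
    finally show ?thesis by (simp add: mult.commute)
  qed
  moreover have "C \<ge> 0" "real m * K \<ge> 0"
    unfolding C_def K_def by (auto intro!: sum_nonneg mult_nonneg_nonneg)
  ultimately show thesis using that by blast
qed

lemma summable_exp_bound:
  fixes c :: "nat \<Rightarrow> complex"
  assumes "\<And>n. norm (c n) \<le> C * A ^ n"
  shows "summable (\<lambda>n. norm (c n / fact n))"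
proof (rule summable_comparison_test')
  show "summable (\<lambda>n. C * (A ^ n /\<^sub>R fact n))"
    by (intro summable_mult summable_exp_generic)
  show "norm (norm (c n / fact n)) \<le> C * (A ^ n /\<^sub>R fact n)" if "n \<ge> 0" for n
    using assms[of n] by (simp add: norm_divide field_simps)
qed

lemma exp_vf_summable:
  assumes "singular_formal_vf X"
  shows "summable (\<lambda>n. norm (coeff2 ((vf_apply X ^^ n) f) i j / fact n))"
  by (rule vf_power_bound[OF assms, where f = f and i = i and j = j]) (rule summable_exp_bound)

lemma exp_vf_sums:
  assumes "singular_formal_vf X"
  shows "(\<lambda>n. coeff2 ((vf_apply X ^^ n) f) i j / fact n) sums coeff2 (exp_vf_apply X f) i j"
  using summable_sums[OF summable_norm_cancel[OF exp_vf_summable[OF assms]]]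
  by (simp add: exp_vf_apply_def)

lemma coeff2_exp_vf_eqI:
  assumes "singular_formal_vf X"
    and "\<And>i j. (\<lambda>n. coeff2 ((vf_apply X ^^ n) f) i j / fact n) sums coeff2 g i j"
  shows "exp_vf_apply X f = g"
  by (rule fps2_eqI) (rule sums_unique2[OF exp_vf_sums[OF assms(1)] assms(2)])

lemma filtered_linear_exp_vf:
  assumes X: "singular_formal_vf X"
  shows "filtered_linear (exp_vf_apply X)"
  unfolding filtered_linear_def
proof (intro conjI allI impI)
  note fl = filtered_linear_vf_power[OF X, unfolded filtered_linear_def]
  show "exp_vf_apply X (f + g) = exp_vf_apply X f + exp_vf_apply X g" for f g
    by (rule coeff2_exp_vf_eqI[OF X])
       (simp add: fl add_divide_distrib exp_vf_sums[OF X] sums_add)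
  show "exp_vf_apply X (const2 c * f) = const2 c * exp_vf_apply X f" for c f
    using sums_mult[OF exp_vf_sums[OF X], of c]
    by (intro coeff2_exp_vf_eqI[OF X]) (simp add: fl)
  show "vanish N (exp_vf_apply X f)" if "vanish N f" for N f
    unfolding vanish_def
  proof (intro allI impI)
    fix i j assume "i + j < N"
    then have "coeff2 ((vf_apply X ^^ n) f) i j = 0" for n
      using that fl unfolding vanish_def by blast
    then show "coeff2 (exp_vf_apply X f) i j = 0"
      by (simp add: exp_vf_apply_def)
  qed
qed

text \<open>\<open>T X n\<close> is the divided power \<open>X^n / n!\<close>, for which the Leibniz
  rule has no binomial coefficients and takes the shape of a Cauchy product.\<close>

lemma vf_power_leibniz:
  defines "T \<equiv> \<lambda>X n f. const2 (1 / fact n) * (vf_apply X ^^ n) f"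
  shows "T X n (f * g) = (\<Sum>k\<le>n. T X k f * T X (n - k) g)"
proof (induction n)
  case 0
  show ?case by (simp add: T_def)
next
  case (Suc n)
  have T_Suc: "vf_apply X (T X k h) = const2 (of_nat (Suc k)) * T X (Suc k) h" for k h
  proof -
    have "const2 (of_nat (Suc k)) * T X (Suc k) h = const2 (of_nat (Suc k) * (1 / fact (Suc k))) * (vf_apply X ^^ Suc k) h"
      by (simp add: T_def mult.assoc flip: fps_const_mult)
    also have "of_nat (Suc k) * (1 / fact (Suc k)) = (1 / fact k :: complex)"
      using of_nat_neq_0[of k, where 'a = complex] unfolding fact_Suc by (simp del: of_nat_Suc)
    also have "const2 (1 / fact k) * (vf_apply X ^^ Suc k) h = vf_apply X (T X k h)"
      by (simp add: T_def vf_apply_const2_mult)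
    finally show ?thesis ..
  qed
  let ?t = "\<lambda>k. T X k f * T X (Suc n - k) g"
  have "const2 (of_nat (Suc n)) * T X (Suc n) (f * g) = vf_apply X (T X n (f * g))"
    by (rule T_Suc[symmetric])
  also have "\<dots> = vf_apply X (\<Sum>k\<le>n. T X k f * T X (n - k) g)"
    by (simp only: Suc)
  also have "\<dots> = (\<Sum>k\<le>n. vf_apply X (T X k f * T X (n - k) g))"
    by (rule vf_apply_sum)
  also have "\<dots> = (\<Sum>k\<le>n. const2 (of_nat (Suc k)) * ?t (Suc k)) + (\<Sum>k\<le>n. const2 (of_nat (Suc n - k)) * ?t k)"
    unfolding sum.distrib[symmetric] vf_apply_mult T_Suc
    by (intro sum.cong refl) (auto simp: Suc_diff_le mult_ac)
  also have "(\<Sum>k\<le>n. const2 (of_nat (Suc k)) * ?t (Suc k)) = (\<Sum>k\<le>Suc n. const2 (of_nat k) * ?t k)"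
    unfolding sum.atMost_Suc_shift[of _ n] by simp
  also have "(\<Sum>k\<le>n. const2 (of_nat (Suc n - k)) * ?t k) = (\<Sum>k\<le>Suc n. const2 (of_nat (Suc n - k)) * ?t k)"
    by simp
  \<comment> \<open>The weights \<open>k\<close> and \<open>n + 1 - k\<close>, from differentiating
    the left and the right factor, add up to \<open>n + 1\<close>, which is finally
    cancelled.\<close>
  also have "(\<Sum>k\<le>Suc n. const2 (of_nat k) * ?t k) + (\<Sum>k\<le>Suc n. const2 (of_nat (Suc n - k)) * ?t k) =
      (\<Sum>k\<le>Suc n. const2 (of_nat (Suc n)) * ?t k)"
    unfolding sum.distrib[symmetric] distrib_right[symmetric] fps_const_add of_nat_add[symmetric]
    by (intro sum.cong refl) simp
  finally have eq: "const2 (of_nat (Suc n)) * T X (Suc n) (f * g) = const2 (of_nat (Suc n)) * (\<Sum>k\<le>Suc n. ?t k)"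
    by (simp only: sum_distrib_left)
  have nz: "const2 (of_nat (Suc n)) \<noteq> 0"
    using of_nat_neq_0[of n, where 'a = complex] by (simp del: of_nat_Suc)
  show ?case
    by (rule mult_left_cancel[OF nz, THEN iffD1, OF eq])
qed

text \<open>The Leibniz rule for divided powers makes each coefficient of the left-hand side a
  finite sum of Cauchy products of absolutely convergent series. Multiplicativity is what turns the
  exponential into a substitution.\<close>

lemma exp_vf_apply_mult:
  assumes X: "singular_formal_vf X"
  shows "exp_vf_apply X (f * g) = exp_vf_apply X f * exp_vf_apply X g"
proof (rule coeff2_exp_vf_eqI[OF X])
  fix i j
  let ?c = "\<lambda>n f i j. coeff2 ((vf_apply X ^^ n) f) i j / fact n"
  have "coeff2 ((vf_apply X ^^ n) (f * g)) i j / fact n =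
      (\<Sum>b\<le>j. \<Sum>a\<le>i. \<Sum>k\<le>n. ?c k f a b * ?c (n - k) g (i - a) (j - b))" for n
  proof -
    have "coeff2 ((vf_apply X ^^ n) (f * g)) i j / fact n =
        coeff2 (const2 (1 / fact n) * (vf_apply X ^^ n) (f * g)) i j"
      by simp
    also have "\<dots> = (\<Sum>k\<le>n. \<Sum>b\<le>j. \<Sum>a\<le>i. ?c k f a b * ?c (n - k) g (i - a) (j - b))"
      unfolding vf_power_leibniz coeff2_sum
        coeff2_mult[of "const2 a * u" "const2 b * v" for a b u v] coeff2_const2_mult
      by simp
    also have "\<dots> = (\<Sum>b\<le>j. \<Sum>a\<le>i. \<Sum>k\<le>n. ?c k f a b * ?c (n - k) g (i - a) (j - b))"
      by (rule trans[OF sum.swap], rule sum.cong[OF refl], rule sum.swap)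
    finally show ?thesis .
  qed
  moreover have "(\<lambda>n. \<Sum>k\<le>n. ?c k f a b * ?c (n - k) g a' b') sums
      (coeff2 (exp_vf_apply X f) a b * coeff2 (exp_vf_apply X g) a' b')" for a b a' b'
    using Cauchy_product_sums[OF exp_vf_summable[OF X] exp_vf_summable[OF X]]
    by (simp add: exp_vf_apply_def)
  then have "(\<lambda>n. \<Sum>b\<le>j. \<Sum>a\<le>i. \<Sum>k\<le>n. ?c k f a b * ?c (n - k) g (i - a) (j - b)) sums
      (\<Sum>b\<le>j. \<Sum>a\<le>i. coeff2 (exp_vf_apply X f) a b * coeff2 (exp_vf_apply X g) (i - a) (j - b))"
    by (intro sums_sum)
  ultimately show "(\<lambda>n. coeff2 ((vf_apply X ^^ n) (f * g)) i j / fact n) sums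
      coeff2 (exp_vf_apply X f * exp_vf_apply X g) i j"
    by (simp add: coeff2_mult)
qed

lemma max_ideal_exp_vf:
  assumes "singular_formal_vf X"
  shows "max_ideal (fst (exp_vf X))" "max_ideal (snd (exp_vf X))"
proof -
  have "max_ideal (exp_vf_apply X f)" if "max_ideal f" for f
    using filtered_linear_vanish[OF filtered_linear_exp_vf[OF assms]] that
    unfolding max_ideal_vanish by this
  from this[of var_x] this[of var_y]
  show "max_ideal (fst (exp_vf X))" "max_ideal (snd (exp_vf X))"
    by (simp_all only: exp_vf_def fst_conv snd_conv max_ideal_intros)
qed

lemma exp_vf_apply_1:
  assumes X: "singular_formal_vf X"
  shows "exp_vf_apply X 1 = 1"
proof (rule coeff2_exp_vf_eqI[OF X])
  fix i j
  have 0: "(vf_apply X ^^ n) 0 = 0" for n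
    using filtered_linear_sum[OF filtered_linear_vf_power[OF X], of n "\<lambda>_. 0" "{}"] by simp
  have "coeff2 ((vf_apply X ^^ n) 1) i j / fact n = (if n = 0 then coeff2 1 i j else 0)" for n
  proof (cases n)
    case (Suc k)
    have "(vf_apply X ^^ Suc k) 1 = (vf_apply X ^^ k) (vf_apply X 1)"
      by (simp only: funpow_Suc_right o_apply)
    then show ?thesis using Suc by (simp only: vf_apply_1 0) simp
  qed simp
  then show "(\<lambda>n. coeff2 ((vf_apply X ^^ n) 1) i j / fact n) sums coeff2 1 i j"
    using sums_single[of 0 "\<lambda>_. coeff2 1 i j"] by simp
qed

text \<open>A filtered ring endomorphism is determined by the images of \<open>x\<close> and
  \<open>y\<close>. This identifies the exponential as an operator with composition with the time 1
  flow.\<close>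

lemma exp_vf_apply_eq_subst22:
  assumes X: "singular_formal_vf X"
  shows "exp_vf_apply X f = subst22 f (exp_vf X)"
proof -
  note mi = max_ideal_exp_vf[OF X]
  have p: "exp_vf_apply X (g ^ n) = exp_vf_apply X g ^ n" for g n
    by (induction n) (simp_all add: exp_vf_apply_1 exp_vf_apply_mult X)
  have "exp_vf_apply X f = subst22 f (fst (exp_vf X), snd (exp_vf X))"
    by (rule filtered_linear_eqI[OF filtered_linear_exp_vf[OF X] filtered_linear_subst22[OF mi]])
       (subst subst22_mon[OF mi], simp add: mon_def exp_vf_apply_mult X p exp_vf_def)
  then show ?thesis by simp
qed

text \<open>Each coefficient of the derivative along \<open>X\<close> is a finite linear combination
  of coefficients of the argument, so coefficientwise limits pass through.\<close>

lemma vf_apply_sums: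
  assumes "\<And>i j. (\<lambda>l. coeff2 (u l) i j) sums coeff2 U i j"
  shows "(\<lambda>l. coeff2 (vf_apply X (u l)) i j) sums coeff2 (vf_apply X U) i j"
  unfolding vf_apply_def coeff2_add coeff2_mult coeff2_deriv_x coeff2_deriv_y
  by (intro sums_add sums_sum sums_mult assms)

lemma vf_power_sums:
  assumes "\<And>i j. (\<lambda>l. coeff2 (u l) i j) sums coeff2 U i j"
  shows "(\<lambda>l. coeff2 ((vf_apply X ^^ n) (u l)) i j) sums coeff2 ((vf_apply X ^^ n) U) i j"
  by (induction n arbitrary: i j) (simp_all add: assms vf_apply_sums)

text \<open>The scalar form of \<open>exp(X) exp(-X) = id\<close>, with \<open>c n\<close> in the
  role of a coefficient of \<open>X^n f\<close>. The double family is dominated by a product of two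
  exponential series; grouped by \<open>n = k + l\<close>, its inner sum is \<open>(1 - 1)^n\<close>
  times \<open>c n / n!\<close>.\<close>

lemma exp_double_series:
  fixes c :: "nat \<Rightarrow> complex"
  assumes c: "\<And>n. norm (c n) \<le> C * A ^ n" and A: "A \<ge> 0"
  shows "(\<lambda>k. (\<Sum>l. (-1) ^ l * c (k + l) / fact l) / fact k) sums c 0"
proof -
  define \<phi> where "\<phi> = (\<lambda>(k, l). (-1) ^ l * c (k + l) / (fact k * fact l))"
  define M where "M = (\<lambda>(k, l). C * (A ^ k / fact k) * (A ^ l / fact l))"
  have "C \<ge> 0" using c[of 0] norm_ge_zero[of "c 0"] by (simp del: norm_ge_zero)
  have ex: "((\<lambda>l. A ^ l / fact l) has_sum exp A) UNIV"
    using exp_converges[of A] A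
    by (intro norm_summable_imp_has_sum) (auto simp: field_simps sums_iff)
  have M: "M summable_on (UNIV \<times> UNIV)"
  proof (rule summable_on_SigmaI)
    show "((\<lambda>l. M (k, l)) has_sum C * (A ^ k / fact k) * exp A) UNIV" for k
      using has_sum_cmult_right[OF ex, of "C * (A ^ k / fact k)"] by (simp add: M_def)
    show "(\<lambda>k. C * (A ^ k / fact k) * exp A) summable_on UNIV"
      by (rule summable_on_cmult_left[OF summable_on_cmult_right[OF has_sum_imp_summable[OF ex]]])
  qed (use A \<open>C \<ge> 0\<close> in \<open>auto simp: M_def\<close>)
  have "norm (\<phi> x) \<le> M x" for x
    using divide_right_mono[OF c[of "fst x + snd x"], of "fact (fst x) * fact (snd x)"]
    by (simp add: \<phi>_def M_def case_prod_unfold norm_mult norm_divide norm_power power_add)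
  then have abs: "(\<lambda>x. norm (\<phi> x)) summable_on (UNIV \<times> UNIV)"
    by (rule summable_on_comparison_test[OF M]) simp
  note sm = abs_summable_summable[OF abs]
  have row: "(\<Sum>\<^sub>\<infinity>l\<in>UNIV. \<phi> (k, l)) = (\<Sum>l. (-1) ^ l * c (k + l) / fact l) / fact k" for k
  proof -
    have s: "summable (\<lambda>l. norm ((-1) ^ l * c (k + l) / fact l))"
    proof (rule summable_exp_bound[of _ "C * A ^ k" A])
      show "norm ((-1) ^ l * c (k + l)) \<le> C * A ^ k * A ^ l" for l
        using c[of "k + l"] by (simp add: norm_mult norm_power power_add mult.assoc)
    qed
    have "((\<lambda>l. (-1) ^ l * c (k + l) / fact l) has_sum (\<Sum>l. (-1) ^ l * c (k + l) / fact l)) UNIV"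
      by (rule norm_summable_imp_has_sum[OF s summable_sums[OF summable_norm_cancel[OF s]]])
    from infsumI[OF has_sum_cmult_right[OF this, of "1 / fact k"]]
    show ?thesis by (simp add: \<phi>_def field_simps)
  qed
  have "(\<lambda>k. \<Sum>\<^sub>\<infinity>l\<in>UNIV. \<phi> (k, l)) summable_on UNIV"
    using summable_on_Sigma_banach[of "\<lambda>k l. \<phi> (k, l)" UNIV "\<lambda>_. UNIV"] sm by simp
  then have "((\<lambda>k. \<Sum>\<^sub>\<infinity>l\<in>UNIV. \<phi> (k, l)) has_sum (\<Sum>\<^sub>\<infinity>k\<in>UNIV. \<Sum>\<^sub>\<infinity>l\<in>UNIV. \<phi> (k, l))) UNIV"
    by (rule has_sum_infsum)
  then have "(\<lambda>k. \<Sum>\<^sub>\<infinity>l\<in>UNIV. \<phi> (k, l)) sums (\<Sum>\<^sub>\<infinity>k\<in>UNIV. \<Sum>\<^sub>\<infinity>l\<in>UNIV. \<phi> (k, l))"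
    by (rule has_sum_imp_sums)
  also have "(\<Sum>\<^sub>\<infinity>k\<in>UNIV. \<Sum>\<^sub>\<infinity>l\<in>UNIV. \<phi> (k, l)) = infsum \<phi> (UNIV \<times> UNIV)"
    by (rule infsum_Sigma_banach[OF sm])
  also have "\<dots> = (\<Sum>\<^sub>\<infinity>(n, k)\<in>(SIGMA n:UNIV. {..n}). \<phi> (k, n - k))"
    by (rule infsum_reindex_bij_witness[where i = "\<lambda>(n, k). (k, n - k)" and j = "\<lambda>(k, l). (k + l, k)"]) auto
  also have "\<dots> = (\<Sum>\<^sub>\<infinity>n\<in>UNIV. \<Sum>\<^sub>\<infinity>k\<in>{..n}. \<phi> (k, n - k))"
  proof -
    have "(\<lambda>(n, k). \<phi> (k, n - k)) summable_on (SIGMA n:UNIV. {..n})"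
      using sm by (subst summable_on_reindex_bij_witness[where
            i = "\<lambda>(k, l). (k + l, k)" and j = "\<lambda>(n, k). (k, n - k)" and T = "UNIV \<times> UNIV" and h = \<phi>]) auto
    from infsum_Sigma_banach[OF this] show ?thesis by simp
  qed
  also have "\<dots> = (\<Sum>\<^sub>\<infinity>n::nat\<in>UNIV. if n = 0 then c 0 else 0)"
  proof (rule infsum_cong)
    fix n :: nat
    have "(\<Sum>\<^sub>\<infinity>k\<in>{..n}. \<phi> (k, n - k)) = (\<Sum>k\<le>n. \<phi> (k, n - k))" by simp
    also have "\<dots> = (\<Sum>k\<le>n. of_nat (n choose k) * 1 ^ k * (-1) ^ (n - k)) * (c n / fact n)"
      unfolding sum_distrib_right
      by (intro sum.cong refl) (auto simp: \<phi>_def binomial_fact field_simps)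
    also have "\<dots> = (1 + (-1)) ^ n * (c n / fact n)"
      by (simp only: binomial_ring)
    also have "\<dots> = (if n = 0 then c 0 else 0)"
      by (simp add: power_0_left)
    finally show "(\<Sum>\<^sub>\<infinity>k\<in>{..n}. \<phi> (k, n - k)) = (if n = 0 then c 0 else 0)" .
  qed
  also have "\<dots> = (\<Sum>\<^sub>\<infinity>n\<in>{0::nat}. c 0)"
    by (rule infsum_cong_neutral) auto
  finally show ?thesis by (simp add: row)
qed

lemma singular_formal_vf_uminus: "singular_formal_vf X \<Longrightarrow> singular_formal_vf (- X)"
  by (simp add: singular_formal_vf_def)

lemma exp_vf_apply_uminus:
  assumes X: "singular_formal_vf X"
  shows "exp_vf_apply X (exp_vf_apply (- X) f) = f"
proof (rule coeff2_exp_vf_eqI[OF X])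
  fix i j
  have pow: "(vf_apply (- X) ^^ l) f = const2 ((-1) ^ l) * (vf_apply X ^^ l) f" for l
  proof (induction l)
    case (Suc l)
    have "vf_apply (- X) (const2 ((- 1) ^ l) * g) = const2 ((- 1) ^ Suc l) * vf_apply X g" for g
      by (rule fps2_eqI) (simp add: vf_apply_uminus_vf vf_apply_const2_mult)
    then show ?case using Suc by simp
  qed simp
  define c where "c = (\<lambda>n. coeff2 ((vf_apply X ^^ n) f) i j)"
  obtain C A where A: "A \<ge> 0" and C: "\<And>n. norm (c n) \<le> C * A ^ n"
    unfolding c_def using vf_power_bound[OF X] by metis
  have "coeff2 ((vf_apply X ^^ k) (exp_vf_apply (- X) f)) i j = (\<Sum>l. (-1) ^ l * c (k + l) / fact l)" for k
  proof -
    have "(\<lambda>l. coeff2 (const2 ((-1) ^ l / fact l) * (vf_apply X ^^ l) f) i j) sums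
        coeff2 (exp_vf_apply (- X) f) i j" for i j
      using exp_vf_sums[OF singular_formal_vf_uminus[OF X], of f i j] by (simp add: pow)
    from vf_power_sums[where X = X and n = k, OF this, of i j]
    have "(\<lambda>l. (-1) ^ l / fact l * coeff2 ((vf_apply X ^^ k) ((vf_apply X ^^ l) f)) i j) sums
        coeff2 ((vf_apply X ^^ k) (exp_vf_apply (- X) f)) i j"
      using filtered_linear_vf_power[OF X, unfolded filtered_linear_def] by simp
    then show ?thesis
      by (simp add: sums_iff c_def funpow_add mult.commute)
  qed
  then have eq: "(\<lambda>k. coeff2 ((vf_apply X ^^ k) (exp_vf_apply (- X) f)) i j / fact k) =
      (\<lambda>k. (\<Sum>l. (-1) ^ l * c (k + l) / fact l) / fact k)"
    by simp
  have "c 0 = coeff2 f i j" by (simp add: c_def)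
  then show "(\<lambda>k. coeff2 ((vf_apply X ^^ k) (exp_vf_apply (- X) f)) i j / fact k) sums coeff2 f i j"
    unfolding eq using exp_double_series[OF C A] by simp
qed

lemma exp_vf_uminus:
  assumes "singular_formal_vf X"
  shows "subst22 (fst (exp_vf (- X))) (exp_vf X) = var_x" "subst22 (snd (exp_vf (- X))) (exp_vf X) = var_y"
  using exp_vf_apply_uminus[OF assms, of var_x] exp_vf_apply_uminus[OF assms, of var_y]
  by (simp_all only: exp_vf_apply_eq_subst22[OF assms] exp_vf_def[of "- X"] fst_conv snd_conv)

text \<open>If \<open>Z\<close> is \<open>f\<close>-related to \<open>X\<close>, so are all powers;
  a coefficient after substitution of \<open>f\<close> involves finitely many coefficients before,
  so the relation passes to the exponential series. In terms of maps: \<open>f\<close> after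
  \<open>exp(Z)\<close> equals \<open>exp(X)\<close> after \<open>f\<close>.\<close>

lemma exp_vf_intertwine:
  assumes X: "singular_formal_vf X" and Z: "singular_formal_vf Z"
    and f: "max_ideal (fst f)" "max_ideal (snd f)"
    and *: "\<And>g. vf_apply Z (subst22 g f) = subst22 (vf_apply X g) f"
  shows "exp_vf_apply Z (subst22 g f) = subst22 (exp_vf_apply X g) f"
proof (rule coeff2_exp_vf_eqI[OF Z])
  fix i j
  have "(vf_apply Z ^^ n) (subst22 g f) = subst22 ((vf_apply X ^^ n) g) f" for n
    by (induction n) (simp_all add: *)
  then show "(\<lambda>n. coeff2 ((vf_apply Z ^^ n) (subst22 g f)) i j / fact n) sums
      coeff2 (subst22 (exp_vf_apply X g) f) i j"
    by (simp add: coeff2_subst22 case_prod_unfold sum_divide_distrib)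
       (simp only: times_divide_eq_left[symmetric], intro sums_sum sums_mult2 exp_vf_sums X)
qed

text \<open>Induction on the power, from \<open>X u - Y v = X(u - v) + (X - Y) v\<close>. The
  derivatives in the last term may lower the order of \<open>v\<close>, but the coefficients of
  \<open>X - Y\<close> alone already have order \<open>N\<close>.\<close>

lemma exp_vf_jet:
  assumes X: "singular_formal_vf X" and Y: "singular_formal_vf Y"
    and "vanish N (fst X - fst Y)" "vanish N (snd X - snd Y)"
  shows "vanish N (exp_vf_apply X f - exp_vf_apply Y f)"
proof -
  have "vanish N ((vf_apply X ^^ n) f - (vf_apply Y ^^ n) f)" for n
  proof (induction n)
    case (Suc n)
    let ?u = "(vf_apply X ^^ n) f" and ?v = "(vf_apply Y ^^ n) f"
    have "vf_apply X ?u - vf_apply Y ?v = vf_apply X (?u - ?v) +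
        ((fst X - fst Y) * deriv_x ?v + (snd X - snd Y) * deriv_y ?v)"
      unfolding filtered_linear_minus[OF filtered_linear_vf_apply[OF X]]
      by (simp add: vf_apply_def algebra_simps)
    then show ?case
      using Suc assms(3,4) filtered_linear_vf_apply[OF X]
      by (auto simp: filtered_linear_def intro!: vanish_add vanish_mult_right)
  qed simp
  then have "coeff2 ((vf_apply X ^^ n) f) i j = coeff2 ((vf_apply Y ^^ n) f) i j" if "i + j < N" for n i j
    using that by (simp add: vanish_def)
  then show ?thesis by (simp add: vanish_def exp_vf_apply_def)
qed

lemma convergent2_exp_vf_apply:
  assumes X: "singular_holomorphic_vf X" and f: "convergent2 f"
  shows "convergent2 (exp_vf_apply X f)"
proof -
  have sX: "singular_formal_vf X" and cX: "convergent2 (fst X)" "convergent2 (snd X)"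
    using X by (auto simp: singular_holomorphic_vf_def)
  obtain r C1 C2 where r: "r > 0" "bdd2 r (fst X) C1" "bdd2 r (snd X) C2"
    using convergent2_common[OF cX] .
  obtain s C where s: "s > 0" "bdd2 s f C" using f by (auto simp: convergent2_iff_bdd2)
  \<comment> \<open>The bound 1 ensures \<open>exp K / \<rho> \<ge> 1\<close>, as
    \<open>convergent2_iff_geometric\<close> requires.\<close>
  define \<rho> where "\<rho> = min 1 (min r s)"
  have \<rho>: "\<rho> > 0" "\<rho> \<le> 1" using r s by (auto simp: \<rho>_def)
  have b: "bdd2 \<rho> (fst X) C1" "bdd2 \<rho> (snd X) C2" "bdd2 \<rho> f C"
    using r s \<rho> by (auto simp: \<rho>_def intro: bdd2_mono)
  \<comment> \<open>The division by \<open>\<rho>\<close> compensates an index shift: the norms of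
    the coefficients of \<open>X\<close> carry \<open>\<rho>^(l + 1)\<close> where the estimate for
    powers of \<open>X\<close> has \<open>\<rho>^l\<close>.\<close>
  define K where "K = (C1 + C2) / \<rho>"
  have K: "(\<Sum>l<m. (diag_norm (fst X) (Suc l) + diag_norm (snd X) (Suc l)) * \<rho> ^ l) \<le> K" for m
  proof -
    have sh: "(\<Sum>l<m. diag_norm u (Suc l) * \<rho> ^ Suc l) \<le> D" if "bdd2 \<rho> u D" for u D
    proof -
      have "(\<Sum>l<m. diag_norm u (Suc l) * \<rho> ^ Suc l) = (\<Sum>l\<in>Suc ` {..<m}. diag_norm u l * \<rho> ^ l)"
        by (simp add: sum.reindex)
      also have "\<dots> \<le> (\<Sum>l\<le>m. diag_norm u l * \<rho> ^ l)"
        using \<rho> by (intro sum_mono2) auto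
      finally show ?thesis using that order_trans unfolding bdd2_def by blast
    qed
    have "(\<Sum>l<m. (diag_norm (fst X) (Suc l) + diag_norm (snd X) (Suc l)) * \<rho> ^ l) * \<rho> \<le> C1 + C2"
    proof -
      have "(\<Sum>l<m. (diag_norm (fst X) (Suc l) + diag_norm (snd X) (Suc l)) * \<rho> ^ l) * \<rho> =
          (\<Sum>l<m. diag_norm (fst X) (Suc l) * \<rho> ^ Suc l) + (\<Sum>l<m. diag_norm (snd X) (Suc l) * \<rho> ^ Suc l)"
        unfolding sum_distrib_right sum.distrib[symmetric]
        by (intro sum.cong refl) (simp add: algebra_simps)
      then show ?thesis using add_mono[OF sh[OF b(1)] sh[OF b(2)]] by simp
    qed
    then show ?thesis using \<rho> by (simp add: K_def pos_le_divide_eq)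
  qed
  have C: "diag_norm f k * \<rho> ^ k \<le> C" for k
  proof -
    have "diag_norm f k * \<rho> ^ k \<le> (\<Sum>m\<le>k. diag_norm f m * \<rho> ^ m)"
      using \<rho> by (intro member_le_sum) auto
    then show ?thesis using b(3) order_trans unfolding bdd2_def by blast
  qed
  have C0: "C \<ge> 0" "K \<ge> 0"
    using bdd2_nonneg[OF b(3)] bdd2_nonneg[OF b(1)] bdd2_nonneg[OF b(2)] \<rho> by (auto simp: K_def)
  have "norm (coeff2 (exp_vf_apply X f) i j) \<le> C * (exp K / \<rho>) ^ (i + j)" for i j
  proof -
    let ?m = "i + j"
    have bd: "norm (coeff2 ((vf_apply X ^^ n) f) i j / fact n) \<le>
        C * (1 / \<rho>) ^ ?m * ((real ?m * K) ^ n /\<^sub>R fact n)" for n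
    proof -
      have "norm (coeff2 ((vf_apply X ^^ n) f) i j) * \<rho> ^ ?m \<le> (real ?m * K) ^ n * C"
        using diag_norm_vf_power[OF sX \<rho>(1) K C, of ?m ?m n] \<rho>
        by (meson mult_right_mono norm_coeff2_le_diag_norm order_trans zero_le_power less_imp_le order_refl)
      then show ?thesis using \<rho> by (simp add: norm_divide field_simps)
    qed
    have s: "summable (\<lambda>n. C * (1 / \<rho>) ^ ?m * ((real ?m * K) ^ n /\<^sub>R fact n))"
      by (intro summable_mult summable_exp_generic)
    have "norm (\<Sum>n. coeff2 ((vf_apply X ^^ n) f) i j / fact n) \<le>
        (\<Sum>n. C * (1 / \<rho>) ^ ?m * ((real ?m * K) ^ n /\<^sub>R fact n))"
      by (rule order_trans[OF summable_norm[OF exp_vf_summable[OF sX]] suminf_le[OF bd exp_vf_summable[OF sX] s]])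
    \<comment> \<open>The norm of \<open>X\<close> on jets grows only linearly with the degree
      \<open>m\<close>, so that its exponential is geometric in \<open>m\<close>, which is what
      convergence asks for.\<close>
    also have "\<dots> = C * (1 / \<rho>) ^ ?m * exp (real ?m * K)"
      unfolding exp_def by (rule suminf_mult) (rule summable_exp_generic)
    also have "\<dots> = C * (exp K / \<rho>) ^ ?m"
      by (simp only: exp_of_nat_mult power_divide power_one) simp
    finally show ?thesis by (simp add: exp_vf_apply_def)
  qed
  moreover have "exp K / \<rho> \<ge> 1" using \<rho> C0 by (simp add: field_simps order_trans[OF _ one_le_exp_iff[THEN iffD2]])
  ultimately show ?thesis
    unfolding convergent2_iff_geometric using C0 by blast
qed

lemma holomorphic_map_germ_exp_vf:
  assumes "singular_holomorphic_vf X"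
  shows "holomorphic_map_germ (exp_vf X)"
proof -
  have "singular_formal_vf X" using assms by (simp add: singular_holomorphic_vf_def)
  from max_ideal_exp_vf[OF this] show ?thesis
    using convergent2_exp_vf_apply[OF assms]
    by (auto simp: holomorphic_map_germ_def max_ideal_def exp_vf_def)
qed

section \<open>Implicit functions and ramified coverings\<close>

definition agree :: "nat \<Rightarrow> complex fps \<Rightarrow> complex fps \<Rightarrow> bool" where
  "agree m u v \<longleftrightarrow> (\<forall>k<m. fps_nth u k = fps_nth v k)"

lemma agree_refl [simp]: "agree m u u"
  by (simp add: agree_def)

lemma agree_sym: "agree m u v \<Longrightarrow> agree m v u"
  by (simp add: agree_def)

lemma agree_trans: "agree m u v \<Longrightarrow> agree m v w \<Longrightarrow> agree m u w"
  by (simp add: agree_def)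

lemma agree_mono: "agree m u v \<Longrightarrow> k \<le> m \<Longrightarrow> agree k u v"
  by (simp add: agree_def)

lemma agree_eqI: "(\<And>m. agree m u v) \<Longrightarrow> u = v"
  by (rule fps_ext) (meson agree_def lessI)

lemma agree_add: "agree m u u' \<Longrightarrow> agree m v v' \<Longrightarrow> agree m (u + v) (u' + v')"
  by (simp add: agree_def)

lemma agree_mult:
  assumes "agree m u u'" "agree m v v'"
  shows "agree m (u * v) (u' * v')"
  using assms unfolding agree_def fps_mult_nth by (auto intro!: sum.cong)

lemma agree_power: "agree m u u' \<Longrightarrow> agree m (u ^ n) (u' ^ n)"
  by (induction n) (simp_all add: agree_mult)

text \<open>In the coefficient of degree \<open>m\<close> of the product, the coefficients of degree
  \<open>m\<close> of the factors meet only constant terms, which vanish; hence one order is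
  gained.\<close>

lemma agree_mult_Suc:
  assumes "agree m u u'" "agree m v v'"
    and "fps_nth u 0 = 0" "fps_nth u' 0 = 0" "fps_nth v 0 = 0" "fps_nth v' 0 = 0"
  shows "agree (Suc m) (u * v) (u' * v')"
  unfolding agree_def fps_mult_nth
proof (intro allI impI sum.cong refl)
  fix k i assume k: "k < Suc m" and i: "i \<in> {0..k}"
  show "fps_nth u i * fps_nth v (k - i) = fps_nth u' i * fps_nth v' (k - i)"
  proof (cases "i = 0 \<or> i = k")
    case True
    then show ?thesis using assms(3-6) by auto
  next
    case False
    then have "i < m" "k - i < m" using i k by auto
    then show ?thesis using assms(1,2) by (simp add: agree_def)
  qed
qed

lemma agree_subst2:
  assumes "agree m u u'" "agree m v v'"
  shows "agree m (subst2 f (u, v)) (subst2 f (u', v'))"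
proof -
  have "agree m (u ^ i * v ^ j) (u' ^ i * v' ^ j)" for i j
    using assms by (intro agree_mult agree_power)
  then show ?thesis
    unfolding agree_def subst2_def by (auto intro!: sum.cong)
qed

text \<open>Writing \<open>q = x r(x) + y q2\<close> with \<open>r\<close> and \<open>q2\<close>
  free of constant terms makes both summands products of two series without constant term.
  Substitution into a series of order 2 is thus a contraction in the \<open>t\<close>-adic
  metric.\<close>

lemma agree_subst2_Suc:
  assumes "agree m u u'" "agree m v v'" and q: "vanish 2 q"
    and z: "fps_nth u 0 = 0" "fps_nth u' 0 = 0" "fps_nth v 0 = 0" "fps_nth v' 0 = 0"
  shows "agree (Suc m) (subst2 q (u, v)) (subst2 q (u', v'))"
proof -
  define r where "r = fps_shift 1 (fps_nth q 0)"
  define q2 :: fps2 where "q2 = fps_shift 1 q"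
  have c: "coeff2 q 0 0 = 0" "coeff2 q 1 0 = 0" "coeff2 q 0 1 = 0"
    using q by (simp_all add: vanish_def)
  have "fps_nth q 0 = fps_X * r"
    using c(1) by (intro fps_ext) (auto simp: r_def coeff2_def)
  then have "q = var_x * fps_const r + var_y * q2"
    by (intro fps_ext) (auto simp: var_x_def var_y_def q2_def fps_X_mult_nth)
  then have eq: "subst2 q (a, b) = a * subst2 (fps_const r) (a, b) + b * subst2 q2 (a, b)"
    if "fps_nth a 0 = 0" "fps_nth b 0 = 0" for a b
    using that by (simp add: subst2_add subst2_mult)
  have "coeff2 (fps_const r) 0 0 = 0" "coeff2 q2 0 0 = 0"
    using c by (simp_all add: r_def q2_def coeff2_def)
  then show ?thesis
    unfolding eq[OF z(1,3)] eq[OF z(2,4)]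
    using assms by (intro agree_add agree_mult_Suc agree_subst2) (simp_all add: subst2_nth_0)
qed

text \<open>The solution is the fixed point of \<open>u \<mapsto> G(x, u)\<close>, a
  \<open>t\<close>-adic contraction since \<open>G\<close> has no term linear in \<open>y\<close>.
  For convergence, the same iteration preserves the bound \<open>s\<close> on the norm at radius
  \<open>r\<close>, and the bound passes to the limit because each partial sum already occurs in
  some iterate.\<close>

lemma implicit_function_aux:
  assumes G: "convergent2 G" "coeff2 G 0 0 = 0" "coeff2 G 0 1 = 0"
  obtains \<phi> where "fps_conv_radius \<phi> > 0" "fps_nth \<phi> 0 = 0" "subst2 G (fps_X, \<phi>) = \<phi>"
proof -
  define ph where "ph n = ((\<lambda>u. subst2 G (fps_X, u)) ^^ n) 0" for n
  have ph_Suc: "ph (Suc n) = subst2 G (fps_X, ph n)" and ph_0: "ph 0 = 0" for n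
    by (simp_all add: ph_def)
  have z: "fps_nth (ph n) 0 = 0" for n
  proof (induction n)
    case (Suc n)
    then show ?case using G(2) by (simp add: ph_Suc subst2_nth_0)
  qed (simp add: ph_0)
  \<comment> \<open>The linear term in \<open>x\<close> contributes the same to all iterates;
    splitting it off leaves a series of order 2.\<close>
  define H where "H = G - const2 (coeff2 G 1 0) * var_x"
  have H: "vanish 2 H"
    unfolding vanish_def
  proof (intro allI impI)
    fix i j :: nat assume "i + j < 2"
    then have "(i, j) \<in> {(0, 0), (1, 0), (0, 1)}" by auto
    then show "coeff2 H i j = 0" using G by (auto simp: H_def coeff2_var_x)
  qed
  have G_eq: "subst2 G (fps_X, u) = subst2 H (fps_X, u) + fps_const (coeff2 G 1 0) * fps_X"
    if "fps_nth u 0 = 0" for u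
  proof -
    have "G = H + const2 (coeff2 G 1 0) * var_x" by (simp add: H_def)
    then have "subst2 G (fps_X, u) = subst2 (H + const2 (coeff2 G 1 0) * var_x) (fps_X, u)" by simp
    also have "\<dots> = subst2 H (fps_X, u) + fps_const (coeff2 G 1 0) * fps_X"
      using that by (simp add: subst2_add subst2_mult)
    finally show ?thesis .
  qed
  have step: "agree (Suc m) (subst2 G (fps_X, u)) (subst2 G (fps_X, v))"
    if "agree m u v" "fps_nth u 0 = 0" "fps_nth v 0 = 0" for m u v
    unfolding G_eq[OF that(2)] G_eq[OF that(3)]
    using that H by (intro agree_add agree_subst2_Suc) auto
  have ag: "agree (Suc n) (ph (Suc n)) (ph n)" for n
  proof (induction n)
    case 0
    show ?case using z by (simp add: agree_def)
  next
    case (Suc n)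
    from step[OF Suc z z] show ?case by (simp only: ph_Suc)
  qed
  have ag': "agree (Suc n) (ph (n + k)) (ph n)" for n k
  proof (induction k)
    case (Suc k)
    have "agree (Suc n) (ph (Suc (n + k))) (ph (n + k))"
      using ag[of "n + k"] by (rule agree_mono) simp
    with Suc show ?case by (auto intro: agree_trans)
  qed simp
  define \<phi> where "\<phi> = Abs_fps (\<lambda>m. fps_nth (ph m) m)"
  have \<phi>_ag: "agree (Suc n) \<phi> (ph n)" for n
    unfolding agree_def
  proof (intro allI impI)
    fix k assume "k < Suc n"
    then have "fps_nth (ph n) k = fps_nth (ph k) k"
      using ag'[of k "n - k"] by (simp add: agree_def)
    then show "fps_nth \<phi> k = fps_nth (ph n) k" by (simp add: \<phi>_def)
  qed
  have \<phi>0: "fps_nth \<phi> 0 = 0" using z by (simp add: \<phi>_def)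
  have "subst2 G (fps_X, \<phi>) = \<phi>"
  proof (rule agree_eqI)
    fix m
    have "agree (Suc (Suc m)) (subst2 G (fps_X, \<phi>)) (ph (Suc m))"
      unfolding ph_Suc by (rule step[OF \<phi>_ag \<phi>0 z])
    moreover have "agree (Suc (Suc m)) \<phi> (ph (Suc m))" by (rule \<phi>_ag)
    ultimately have "agree (Suc (Suc m)) (subst2 G (fps_X, \<phi>)) \<phi>"
      using agree_sym agree_trans by blast
    then show "agree m (subst2 G (fps_X, \<phi>)) \<phi>" by (rule agree_mono) simp
  qed
  moreover have "fps_conv_radius \<phi> > 0"
  proof -
    obtain R C where R: "R > 0" and C: "bdd2 R G C" using G by (auto simp: convergent2_iff_bdd2)
    have C0: "C \<ge> 0" using C by (rule bdd2_nonneg)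
    \<comment> \<open>With this \<open>s\<close> the terms \<open>y^b\<close>,
      \<open>b \<ge> 2\<close>, contribute at most \<open>s / 2\<close>; the choice of
      \<open>r\<close> below does the same for the terms divisible by \<open>x\<close>. Together
      they keep the iterates within the bound \<open>s\<close>.\<close>
    define s where "s = min R (R\<^sup>2 / (2 * (C + 1)))"
    have s: "s > 0" "s \<le> R" using R C0 by (auto simp: s_def)
    have sC: "C * (s / R)\<^sup>2 \<le> s / 2"
    proof -
      have "s \<le> R\<^sup>2 / (2 * (C + 1))" by (simp add: s_def)
      then have "s * (2 * (C + 1)) \<le> R\<^sup>2" using C0 by (simp add: pos_le_divide_eq)
      moreover have "2 * C * s \<le> s * (2 * (C + 1))" using s by (simp add: algebra_simps)
      ultimately have "2 * C * s \<le> R\<^sup>2" by simp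
      then have "2 * C * s * s \<le> R\<^sup>2 * s" using s by (intro mult_right_mono) auto
      then show ?thesis using R by (simp add: power2_eq_square field_simps)
    qed
    define r where "r = min s (s * R / (2 * (C + 1)))"
    have r: "r > 0" "r \<le> s" using R C0 s by (auto simp: r_def)
    have rC: "C * (r / R) \<le> s / 2"
    proof -
      have "r \<le> s * R / (2 * (C + 1))" by (simp add: r_def)
      then have "r * (2 * (C + 1)) \<le> s * R" using C0 by (simp add: pos_le_divide_eq)
      moreover have "2 * C * r \<le> r * (2 * (C + 1))" using r by (simp add: algebra_simps)
      ultimately show ?thesis using R by (simp add: field_simps)
    qed
    have bd: "norm (coeff2 G a b) * (r ^ a * s ^ b) \<le> norm (coeff2 G a b) * R ^ (a + b) * ((s / R)\<^sup>2 + r / R)" for a b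
    proof (cases "a = 0 \<and> b < 2")
      case True
      then have "coeff2 G a b = 0" using G(2,3) by (cases "b = 0") (auto simp: less_2_cases_iff)
      then show ?thesis by simp
    next
      case False
      have "(r / R) ^ a * (s / R) ^ b \<le> (s / R)\<^sup>2 + r / R"
      proof (cases "a = 0")
        case True
        then have "(s / R) ^ b \<le> (s / R)\<^sup>2"
          using False s R by (intro power_decreasing) auto
        then show ?thesis using True r R by (simp add: add_increasing2)
      next
        case False
        then have "(r / R) ^ a \<le> (r / R) ^ 1"
          using r s R by (intro power_decreasing) auto
        moreover have "(s / R) ^ b \<le> 1" using s R by (intro power_le_one) auto
        ultimately have "(r / R) ^ a * (s / R) ^ b \<le> (r / R) ^ 1 * 1"
          using r s R by (intro mult_mono) auto
        then show ?thesis by (simp add: add_increasing)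
      qed
      then have "r ^ a * s ^ b \<le> R ^ (a + b) * ((s / R)\<^sup>2 + r / R)"
        using R by (simp add: power_divide power_add field_simps)
      then show ?thesis unfolding mult.assoc by (rule mult_left_mono) simp
    qed
    have wt: "(\<Sum>(a, b) | a + b \<le> N. norm (coeff2 G a b) * (r ^ a * s ^ b)) \<le> s" for N
    proof -
      have "(\<Sum>(a, b) | a + b \<le> N. norm (coeff2 G a b) * (r ^ a * s ^ b)) \<le>
          (\<Sum>(a, b) | a + b \<le> N. norm (coeff2 G a b) * R ^ (a + b) * ((s / R)\<^sup>2 + r / R))"
        using bd by (intro sum_mono) auto
      also have "\<dots> = (\<Sum>(a, b) | a + b \<le> N. norm (coeff2 G a b) * R ^ (a + b)) * ((s / R)\<^sup>2 + r / R)"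
        by (simp add: sum_distrib_right case_prod_unfold)
      also have "\<dots> \<le> C * ((s / R)\<^sup>2 + r / R)"
        using C r R unfolding bdd2_def sum_pairs_eq_diag_norm[symmetric]
        by (intro mult_right_mono) auto
      also have "\<dots> \<le> s" using sC rC unfolding distrib_left by linarith
      finally show ?thesis .
    qed
    have rX: "bdd2 r (fps_const fps_X) r"
      using bdd2_linear[of r 1] r by simp
    have b: "bdd2 r (fps_const (ph n)) s" for n
    proof (induction n)
      case 0
      then show ?case using s by (simp add: ph_0 bdd2_def diag_norm_def)
    next
      case (Suc n)
      have "fps_const (ph (Suc n)) = subst22 G (fps_const fps_X, fps_const (ph n))"
        unfolding ph_Suc using z by (intro fps_const_subst2) auto
      then show ?case
        using bdd2_subst22_weighted[OF wt rX Suc] r by simp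
    qed
    have "bdd2 r (fps_const \<phi>) s"
      unfolding bdd2_def
    proof
      fix N
      have "(\<Sum>m\<le>N. diag_norm (fps_const \<phi>) m * r ^ m) = (\<Sum>m\<le>N. diag_norm (fps_const (ph N)) m * r ^ m)"
        using \<phi>_ag[of N] by (intro sum.cong refl) (auto simp: diag_norm_fps_const agree_def)
      also have "\<dots> \<le> s" using b[of N] by (simp add: bdd2_def)
      finally show "(\<Sum>m\<le>N. diag_norm (fps_const \<phi>) m * r ^ m) \<le> s" .
    qed
    then show ?thesis
      unfolding convergent2_fps_const[symmetric] convergent2_iff_bdd2 using r by blast
  qed
  ultimately show thesis using that \<phi>0 by blast
qed

lemma implicit_function:
  assumes F: "convergent2 F" "coeff2 F 0 0 = 0" "coeff2 F 0 1 \<noteq> 0"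
  obtains \<phi> where "fps_conv_radius \<phi> > 0" "fps_nth \<phi> 0 = 0" "subst2 F (fps_X, \<phi>) = 0"
proof -
  define c where "c = inverse (coeff2 F 0 1)"
  \<comment> \<open>Zeros of \<open>F\<close> become fixed points, and the factor \<open>c\<close>
    removes the linear term in \<open>y\<close>.\<close>
  define G where "G = var_y - const2 c * F"
  have "convergent2 G" using F by (auto simp: G_def)
  moreover have "coeff2 G 0 0 = 0" "coeff2 G 0 1 = 0"
    using F by (simp_all add: G_def coeff2_var_y c_def)
  ultimately obtain \<phi> where \<phi>: "fps_conv_radius \<phi> > 0" "fps_nth \<phi> 0 = 0" "subst2 G (fps_X, \<phi>) = \<phi>"
    by (rule implicit_function_aux)
  have "subst2 G (fps_X, \<phi>) = \<phi> - fps_const c * subst2 F (fps_X, \<phi>)"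
    using \<phi>(2) by (simp add: G_def subst2_diff subst2_mult)
  then have "fps_const c * subst2 F (fps_X, \<phi>) = 0" using \<phi>(3) by simp
  then have "subst2 F (fps_X, \<phi>) = 0" using F(3) by (simp add: c_def)
  then show thesis using that \<phi> by blast
qed

text \<open>The implicit function theorem for \<open>\<tau>(y) = x\<close> gives a convergent right
  inverse. It coincides with the formal inverse \<open>fps_inv \<tau>\<close> and is therefore a
  left inverse too.\<close>

lemma convergent_compositional_inverse:
  fixes \<tau> :: "complex fps"
  assumes \<tau>: "fps_conv_radius \<tau> > 0" "fps_nth \<tau> 0 = 0" "fps_nth \<tau> 1 \<noteq> 0"
  obtains \<sigma> where "fps_conv_radius \<sigma> > 0" "fps_nth \<sigma> 0 = 0" "fps_nth \<sigma> 1 \<noteq> 0"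
    "\<tau> oo \<sigma> = fps_X" "\<sigma> oo \<tau> = fps_X"
proof -
  define F where "F = subst22 (fps_const \<tau>) (var_y, 0) - var_x"
  have sub: "subst2 F (a, b) = (\<tau> oo b) - a" if "fps_nth a 0 = 0" "fps_nth b 0 = 0" for a b
    using that by (simp add: F_def subst2_diff subst2_subst22 subst2_fps_const)
  have "convergent2 F"
    using \<tau> unfolding F_def by (intro convergent2_diff convergent2_subst22) (auto simp: convergent2_fps_const)
  moreover have "coeff2 F 0 0 = 0" "coeff2 F 0 1 \<noteq> 0"
    using sub[of 0 fps_X] \<tau> by (simp_all flip: fps_nth_subst2_0_X)
  ultimately obtain \<sigma> where \<sigma>: "fps_conv_radius \<sigma> > 0" "fps_nth \<sigma> 0 = 0" "subst2 F (fps_X, \<sigma>) = 0"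
    by (rule implicit_function)
  have 1: "\<tau> oo \<sigma> = fps_X" using sub[of fps_X \<sigma>] \<sigma> by simp
  have inv: "fps_inv \<tau> oo \<tau> = fps_X" using \<tau> by (intro fps_inv) auto
  have "\<sigma> = (fps_inv \<tau> oo \<tau>) oo \<sigma>" using \<sigma>(2) inv by simp
  also have "\<dots> = fps_inv \<tau> oo (\<tau> oo \<sigma>)"
    using \<tau>(2) \<sigma>(2) by (intro fps_compose_assoc[symmetric])
  also have "\<dots> = fps_inv \<tau>" by (simp add: 1)
  finally have 2: "\<sigma> oo \<tau> = fps_X" using inv by simp
  have "fps_nth \<sigma> 1 \<noteq> 0"
  proof
    assume "fps_nth \<sigma> 1 = 0"
    then have "fps_nth (\<tau> oo \<sigma>) 1 = 0" using \<sigma>(2) by (simp add: fps_compose_nth)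
    then show False by (simp add: 1)
  qed
  with \<sigma> 1 2 show thesis by (intro that)
qed

text \<open>A root \<open>c\<close> of the constant term is extended to a solution of
  \<open>(c + y)^n = u(x)\<close>; the derivative \<open>n c^(n - 1)\<close> in \<open>y\<close> at
  the origin is nonzero.\<close>

lemma convergent_nth_root:
  fixes u :: "complex fps"
  assumes u: "fps_conv_radius u > 0" "fps_nth u 0 \<noteq> 0" and n: "n > 0"
  obtains R where "fps_conv_radius R > 0" "fps_nth R 0 \<noteq> 0" "R ^ n = u"
proof -
  define c where "c = exp (Ln (fps_nth u 0) / of_nat n)"
  have c: "c ^ n = fps_nth u 0" "c \<noteq> 0"
    using u(2) n by (simp_all add: c_def flip: exp_of_nat_mult)
  define F where "F = (const2 c + var_y) ^ n - fps_const u"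
  have sub: "subst2 F (a, b) = (fps_const c + b) ^ n - (u oo a)" if "fps_nth a 0 = 0" "fps_nth b 0 = 0" for a b
    using that by (simp add: F_def subst2_diff subst2_power subst2_add subst2_fps_const)
  have "convergent2 F"
    using u unfolding F_def
    by (intro convergent2_diff convergent2_power convergent2_add) (auto simp: convergent2_fps_const)
  moreover have "coeff2 F 0 0 = 0"
    using sub[of 0 fps_X] c by (simp add: fps_power_zeroth flip: fps_nth_subst2_0_X)
  moreover have "coeff2 F 0 1 \<noteq> 0"
  proof -
    have "fps_nth ((fps_const c + fps_X) ^ n) 1 = fps_nth (fps_deriv ((fps_const c + fps_X) ^ n)) 0"
      by simp
    also have "\<dots> = of_nat n * c ^ (n - 1)"
      by (simp add: fps_deriv_power fps_power_zeroth)
    finally show ?thesis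
      using sub[of 0 fps_X] c n by (simp flip: fps_nth_subst2_0_X)
  qed
  ultimately obtain \<phi> where \<phi>: "fps_conv_radius \<phi> > 0" "fps_nth \<phi> 0 = 0" "subst2 F (fps_X, \<phi>) = 0"
    by (rule implicit_function)
  have "fps_conv_radius (fps_const c + \<phi>) > 0"
    using fps_conv_radius_add[of "fps_const c" \<phi>] \<phi>(1) by (simp add: less_le_trans)
  moreover have "(fps_const c + \<phi>) ^ n = u" using sub[of fps_X \<phi>] \<phi> by simp
  ultimately show thesis using that[of "fps_const c + \<phi>"] \<phi>(2) c by simp
qed

lemma fps_conv_radius_mult_pos:
  fixes a b :: "complex fps"
  assumes "fps_conv_radius a > 0" "fps_conv_radius b > 0"
  shows "fps_conv_radius (a * b) > 0"
  using fps_conv_radius_mult[of a b] assms by (meson less_le_trans min_less_iff_conj)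

text \<open>With \<open>a = t^n u\<close>, take \<open>\<tau> = t R\<close> for an
  \<open>n\<close>-th root \<open>R\<close> of the unit \<open>u\<close>. In the parameter
  \<open>\<tau>\<close> the first component of a branch becomes a pure power.\<close>

lemma fps_as_power:
  fixes a :: "complex fps"
  assumes a: "fps_conv_radius a > 0" "fps_nth a 0 = 0" "a \<noteq> 0"
  obtains n \<tau> where "n > 0" "fps_conv_radius \<tau> > 0" "fps_nth \<tau> 0 = 0" "fps_nth \<tau> 1 \<noteq> 0" "a = \<tau> ^ n"
proof -
  define n where "n = subdegree a"
  define u where "u = fps_shift n a"
  have n: "n > 0" using a(2) nth_subdegree_nonzero[OF a(3)] unfolding n_def by (metis gr0I)
  have "fps_conv_radius u > 0" "fps_nth u 0 \<noteq> 0"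
    using a by (simp_all add: u_def n_def)
  then obtain R where R: "fps_conv_radius R > 0" "fps_nth R 0 \<noteq> 0" "R ^ n = u"
    using convergent_nth_root n by blast
  have "a = fps_X ^ n * u" unfolding u_def n_def by (metis subdegree_decompose mult.commute)
  also have "\<dots> = (fps_X * R) ^ n" by (simp add: power_mult_distrib R)
  finally have "a = (fps_X * R) ^ n" .
  moreover have "fps_conv_radius (fps_X * R) > 0" using R by (intro fps_conv_radius_mult_pos) auto
  ultimately show thesis using R by (intro that[OF n]) auto
qed

section \<open>Roots of unity and the covering of degree n in the variable x\<close>

definition roots_unity :: "nat \<Rightarrow> complex set" where
  "roots_unity n = {z. z ^ n = 1}"

lemma roots_unity_simps:
  assumes "n > 0"
  shows "finite (roots_unity n)" "1 \<in> roots_unity n" "0 \<notin> roots_unity n"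
  using finite_roots_unity[of n] assms by (auto simp: roots_unity_def power_0_left)

lemma primitive_root_unity:
  assumes "n > 0"
  obtains z where "z \<in> roots_unity n" "\<And>i. z ^ i = 1 \<Longrightarrow> n dvd i"
proof
  let ?z = "exp (2 * of_real pi * \<i> * of_nat 1 / of_nat n) :: complex"
  have p: "?z ^ i = exp (2 * of_real pi * \<i> * of_nat i / of_nat n)" for i
    by (simp add: mult_ac flip: exp_of_nat_mult)
  show "n dvd i" if "?z ^ i = 1" for i
    using that complex_root_unity_eq_1[of n i] assms unfolding p by auto
  show "?z \<in> roots_unity n"
    using assms unfolding roots_unity_def mem_Collect_eq p by simp
qed

text \<open>The action of the covering transformation \<open>x \<mapsto> z x\<close> on series, with
  \<open>y\<close> fixed.\<close>

definition rot :: "complex \<Rightarrow> fps2 \<Rightarrow> fps2" where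
  "rot z f = Abs_fps (\<lambda>j. Abs_fps (\<lambda>i. z ^ i * coeff2 f i j))"

lemma coeff2_rot: "coeff2 (rot z f) i j = z ^ i * coeff2 f i j"
  by (simp add: rot_def)

lemma rot_diff: "rot z (f - g) = rot z f - rot z g"
  by (rule fps2_eqI) (simp add: coeff2_rot right_diff_distrib)

lemma rot_sum: "rot z (sum f A) = (\<Sum>a\<in>A. rot z (f a))"
  by (rule fps2_eqI) (simp add: coeff2_rot coeff2_sum sum_distrib_left)

lemma rot_mult: "rot z (f * g) = rot z f * rot z g"
proof (rule fps2_eqI)
  fix i j
  show "coeff2 (rot z (f * g)) i j = coeff2 (rot z f * rot z g) i j"
    unfolding coeff2_rot coeff2_mult sum_distrib_left
  proof (intro sum.cong refl)
    fix a b assume "a \<in> {..i}"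
    then have "z ^ i = z ^ a * z ^ (i - a)" by (simp flip: power_add)
    then show "z ^ i * (coeff2 f a b * coeff2 g (i - a) (j - b)) =
        z ^ a * coeff2 f a b * (z ^ (i - a) * coeff2 g (i - a) (j - b))"
      by (simp only: mult_ac)
  qed
qed

lemma rot_1 [simp]: "rot z 1 = 1"
  by (rule fps2_eqI) (simp add: coeff2_rot coeff2_1)

lemma rot_prod: "rot z (prod f A) = (\<Prod>a\<in>A. rot z (f a))"
  by (induction A rule: infinite_finite_induct) (simp_all add: rot_mult)

lemma rot_var_y [simp]: "rot z var_y = var_y"
  by (rule fps2_eqI) (simp add: coeff2_rot coeff2_var_y)

definition rot1 :: "complex \<Rightarrow> complex fps \<Rightarrow> complex fps" where
  "rot1 z a = a oo (fps_const z * fps_X)"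

lemma rot1_nth [simp]: "fps_nth (rot1 z a) i = z ^ i * fps_nth a i"
  by (simp add: rot1_def)

lemma rot1_1 [simp]: "rot1 1 a = a"
  by (rule fps_ext) simp

lemma rot1_rot1: "rot1 z (rot1 v a) = rot1 (z * v) a"
  by (rule fps_ext) (simp add: power_mult_distrib)

lemma rot_fps_const [simp]: "rot z (fps_const a) = fps_const (rot1 z a)"
  by (rule fps2_eqI) (simp add: coeff2_rot coeff2_fps_const)

lemma fps_conv_radius_rot1:
  assumes "fps_conv_radius a > 0"
  shows "fps_conv_radius (rot1 z a) > 0"
  unfolding rot1_def
  using assms line_simps(2)[of z] by (intro fps_conv_radius_compose) auto

text \<open>Base change along the covering \<open>x \<mapsto> x^n\<close>.\<close>

definition ramify :: "nat \<Rightarrow> fps2 \<Rightarrow> fps2" where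
  "ramify n f = subst22 f (var_x ^ n, var_y)"

lemma coeff2_ramify:
  assumes "n > 0"
  shows "coeff2 (ramify n f) i j = (if n dvd i then coeff2 f (i div n) j else 0)"
proof -
  define L where "L f = Abs_fps (\<lambda>j. Abs_fps (\<lambda>i. if n dvd i then coeff2 f (i div n) j else 0))" for f
  have L: "coeff2 (L f) i j = (if n dvd i then coeff2 f (i div n) j else 0)" for f i j
    by (simp add: L_def)
  have fl: "filtered_linear L"
    unfolding filtered_linear_def
  proof (intro conjI allI impI)
    show "L (f + g) = L f + L g" for f g
      by (rule fps2_eqI) (simp add: L)
    show "L (const2 c * f) = const2 c * L f" for c f
      by (rule fps2_eqI) (simp add: L)
    show "vanish N (L f)" if "vanish N f" for N f
      unfolding vanish_def
    proof (intro allI impI)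
      fix i j assume "i + j < N"
      then have "i div n + j < N" using div_le_dividend[of i n] by linarith
      then show "coeff2 (L f) i j = 0" using that by (simp add: L vanish_def)
    qed
  qed
  have "subst22 f (var_x ^ n, var_y) = L f"
  proof (rule filtered_linear_eqI[OF filtered_linear_subst22 fl])
    fix a b
    have "L (mon a b) = mon (n * a) b"
      using assms by (intro fps2_eqI) (auto simp: L coeff2_mon)
    then show "subst22 (mon a b) (var_x ^ n, var_y) = L (mon a b)"
      using assms by (simp add: subst22_mon) (simp add: mon_def power_mult)
  qed (use assms in auto)
  then show ?thesis by (simp add: ramify_def L)
qed

lemma subst2_ramify:
  assumes "n > 0" "fps_nth b 0 = 0"
  shows "subst2 (ramify n f) (fps_X, b) = subst2 f (fps_X ^ n, b)"
  using assms unfolding ramify_def by (subst subst2_subst22) (simp_all add: subst2_power)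

text \<open>Descent along the covering: invariance under a primitive root of unity kills the
  coefficients of \<open>x^i\<close> with \<open>i\<close> not divisible by \<open>n\<close>. The
  descended series is bounded with \<open>R^n\<close> in place of \<open>R\<close>, since
  \<open>n i + j \<le> n (i + j)\<close>.\<close>

lemma ramify_exists:
  assumes n: "n > 0" and inv: "\<And>z. z \<in> roots_unity n \<Longrightarrow> rot z G = G" and G: "convergent2 G"
  obtains g where "convergent2 g" "ramify n g = G"
proof -
  obtain z where z: "z \<in> roots_unity n" "\<And>i. z ^ i = 1 \<Longrightarrow> n dvd i"
    by (rule primitive_root_unity[OF n]) blast
  have van: "coeff2 G i j = 0" if "\<not> n dvd i" for i j
  proof -
    have "z ^ i * coeff2 G i j = coeff2 G i j" using inv[OF z(1)] by (metis coeff2_rot)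
    then have "(z ^ i - 1) * coeff2 G i j = 0" by (simp add: algebra_simps)
    moreover have "z ^ i - 1 \<noteq> 0" using z(2)[of i] that by auto
    ultimately show ?thesis by simp
  qed
  define g where "g = Abs_fps (\<lambda>j. Abs_fps (\<lambda>i. coeff2 G (n * i) j))"
  have g: "coeff2 g i j = coeff2 G (n * i) j" for i j by (simp add: g_def)
  have "ramify n g = G"
    using n van by (intro fps2_eqI) (auto simp: coeff2_ramify g)
  moreover have "convergent2 g"
  proof -
    obtain C R where R: "R \<ge> 1" and C: "C \<ge> 0" "\<And>i j. norm (coeff2 G i j) \<le> C * R ^ (i + j)"
      using G by (auto simp: convergent2_iff_geometric)
    have "norm (coeff2 g i j) \<le> C * (R ^ n) ^ (i + j)" for i j
    proof -
      have "norm (coeff2 g i j) \<le> C * R ^ (n * i + j)" unfolding g by (rule C)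
      also have "\<dots> \<le> C * R ^ (n * (i + j))"
        using R C n by (intro mult_left_mono power_increasing) (auto simp: distrib_left)
      finally show ?thesis by (simp add: power_mult)
    qed
    moreover have "R ^ n \<ge> 1" using R by (rule one_le_power)
    ultimately show ?thesis unfolding convergent2_iff_geometric using C(1) by blast
  qed
  ultimately show thesis using that by blast
qed

text \<open>\<open>d\<close> is the multiplicative order of \<open>z\<close>, at least 2 as
  \<open>z \<noteq> 1\<close>; a series fixed by \<open>t \<mapsto> z t\<close> contains only powers
  of \<open>t^d\<close>.\<close>

lemma factor_through_power:
  assumes n: "n > 0" and z: "z \<in> roots_unity n" "z \<noteq> 1" and b: "rot1 z b = b"
    and conv: "fps_conv_radius b > 0"
  obtains d b' where "d > 1" "d dvd n" "b = b' oo fps_X ^ d" "fps_conv_radius b' > 0"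
proof -
  define d where "d = (LEAST d. d > 0 \<and> z ^ d = 1)"
  have zn: "z ^ n = 1" using z by (simp add: roots_unity_def)
  have d: "d > 0" "z ^ d = 1"
    using LeastI[of "\<lambda>d. d > 0 \<and> z ^ d = 1" n] n zn by (auto simp: d_def)
  have min: "d \<le> k" if "k > 0" "z ^ k = 1" for k
    unfolding d_def using that by (intro Least_le) auto
  have dvd: "d dvd k" if "z ^ k = 1" for k
  proof -
    have "z ^ k = z ^ (d * (k div d) + k mod d)" by simp
    also have "\<dots> = z ^ (k mod d)" using d(2) by (simp only: power_add power_mult power_one mult_1)
    finally have "z ^ (k mod d) = 1" using that by simp
    then have "k mod d = 0" using min[of "k mod d"] mod_less_divisor[OF d(1), of k] by fastforce
    then show ?thesis by auto
  qed
  have "d \<noteq> 1" using d(2) z(2) by auto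
  then have d1: "d > 1" using d(1) by simp
  define b' where "b' = Abs_fps (\<lambda>i. fps_nth b (d * i))"
  have zero: "fps_nth b i = 0" if "\<not> d dvd i" for i
  proof -
    have "z ^ i * fps_nth b i = fps_nth b i" using b by (metis rot1_nth)
    then have "(z ^ i - 1) * fps_nth b i = 0" by (simp add: algebra_simps)
    then show ?thesis using dvd[of i] that by auto
  qed
  have "b = b' oo fps_X ^ d"
    using d(1) zero by (intro fps_ext) (auto simp: fps_nth_compose_X_power b'_def)
  moreover have "fps_conv_radius b' > 0"
  proof -
    obtain C R where R: "R \<ge> 1" and C: "C \<ge> 0" "\<And>i j. norm (coeff2 (fps_const b) i j) \<le> C * R ^ (i + j)"
      using conv by (auto simp: convergent2_iff_geometric simp flip: convergent2_fps_const)
    have Rd: "R ^ d \<ge> 1" using R by (rule one_le_power)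
    have "norm (coeff2 (fps_const b') i j) \<le> C * (R ^ d) ^ (i + j)" for i j
    proof (cases "j = 0")
      case True
      then show ?thesis
        using C(2)[of "d * i" 0] by (simp add: coeff2_fps_const b'_def power_mult)
    next
      case False
      have "0 \<le> C * (R ^ d) ^ (i + j)" using C R by simp
      then show ?thesis using False by (simp add: coeff2_fps_const)
    qed
    then show ?thesis unfolding convergent2_fps_const[symmetric] convergent2_iff_geometric
      using C(1) Rd by blast
  qed
  ultimately show thesis using that d1 dvd[OF zn] by blast
qed

section \<open>The conductor of a branch\<close>

text \<open>After scaling, \<open>f = 1 - u\<close> with \<open>u\<close> in the maximal ideal, and
  the inverse is \<open>u\<close> substituted into the geometric series; its convergence is that of
  a substitution.\<close>

lemma unit_conv2I:
  assumes "convergent2 f" "coeff2 f 0 0 \<noteq> 0"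
  shows "unit_conv2 f"
proof -
  define c where "c = coeff2 f 0 0"
  define u where "u = 1 - const2 (1 / c) * f"
  have c: "c \<noteq> 0" using assms by (simp add: c_def)
  have u: "convergent2 u" "max_ideal u"
    using assms c by (auto simp: u_def max_ideal_def coeff2_1 c_def)
  define e :: "complex fps" where "e = inverse (1 - fps_X)"
  have e: "fps_conv_radius e > 0"
    unfolding e_def using fps_conv_radius_diff[of 1 "fps_X :: complex fps"]
    by (intro fps_conv_radius_inverse_pos) auto
  have "(1 - fps_X) * e = 1"
    unfolding e_def by (intro inverse_mult_eq_1') simp
  moreover have "(1 - var_x) * fps_const e = fps_const ((1 - fps_X) * e)"
    unfolding var_x_def fps_const_mult[symmetric] fps_const_sub[symmetric] by simp
  ultimately have "(1 - var_x) * fps_const e = 1" by simp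
  then have "subst22 ((1 - var_x) * fps_const e) (u, 0) = subst22 1 (u, 0)" by simp
  then have *: "(1 - u) * subst22 (fps_const e) (u, 0) = 1"
    using u by (simp add: subst22_mult subst22_diff)
  have "f * (const2 (1 / c) * subst22 (fps_const e) (u, 0)) = 1"
    using * by (simp add: u_def mult_ac)
  moreover have "convergent2 (const2 (1 / c) * subst22 (fps_const e) (u, 0))"
    using e u by (intro convergent2_mult convergent2_subst22) (auto simp: convergent2_fps_const)
  ultimately show ?thesis
    unfolding unit_conv2_def using assms(1) by blast
qed

lemma unit_conv2_coeff:
  assumes "unit_conv2 f"
  shows "coeff2 f 0 0 \<noteq> 0"
proof
  assume 0: "coeff2 f 0 0 = 0"
  obtain g where "f * g = 1" using assms by (auto simp: unit_conv2_def)
  then have "coeff2 (f * g) 0 0 = 1" by (simp add: coeff2_1)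
  then show False using 0 by (simp add: coeff2_mult)
qed

definition irreducible_pair :: "complex fps \<times> complex fps \<Rightarrow> bool" where
  "irreducible_pair \<alpha> \<longleftrightarrow> (\<forall>\<gamma>1 \<gamma>2 \<sigma>. fps_conv_radius \<gamma>1 > 0 \<and> fps_conv_radius \<gamma>2 > 0 \<and>
     fps_conv_radius \<sigma> > 0 \<and> fps_nth \<sigma> 0 = 0 \<and> \<alpha> = (\<gamma>1 oo \<sigma>, \<gamma>2 oo \<sigma>) \<longrightarrow> fps_nth \<sigma> 1 \<noteq> 0)"

lemma bij_betw_roots_unity:
  assumes "n > 0" "u \<in> roots_unity n"
  shows "bij_betw ((*) u) (roots_unity n) (roots_unity n)"
proof (rule bij_betwI[where g = "(*) (1 / u)"])
  have "u \<noteq> 0" using assms roots_unity_simps by metis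
  then show "u * (1 / u * x) = x" "1 / u * (u * x) = x" for x by auto
qed (use assms in \<open>auto simp: roots_unity_def power_mult_distrib power_divide\<close>)

lemma bij_betw_roots_unity_diff:
  assumes "n > 0" "u \<in> roots_unity n" "z \<in> roots_unity n"
  shows "bij_betw ((*) u) (roots_unity n - {z}) (roots_unity n - {u * z})"
proof (rule bij_betw_DiffI[OF bij_betw_roots_unity[OF assms(1,2)]])
  show "{u * z} \<subseteq> roots_unity n"
    using assms by (simp add: roots_unity_def power_mult_distrib)
qed (use assms in \<open>auto simp: bij_betw_def\<close>)

context
  fixes n :: nat and b :: "complex fps"
  assumes n: "n > 0" and b: "fps_conv_radius b > 0" "fps_nth b 0 = 0"
    and distinct: "\<And>z. z \<in> roots_unity n \<Longrightarrow> z \<noteq> 1 \<Longrightarrow> rot1 z b \<noteq> b"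
begin

lemma rot1_inj:
  assumes "u \<in> roots_unity n" "v \<in> roots_unity n" "rot1 u b = rot1 v b"
  shows "u = v"
proof (rule ccontr)
  assume "u \<noteq> v"
  have u0: "u \<noteq> 0" using assms(1) roots_unity_simps[OF n] by metis
  have "rot1 (1 / u) (rot1 u b) = rot1 (1 / u) (rot1 v b)" using assms(3) by simp
  then have "rot1 (v / u) b = b" using u0 by (simp add: rot1_rot1)
  moreover have "v / u \<in> roots_unity n" using assms by (simp add: roots_unity_def power_divide)
  moreover have "v / u \<noteq> 1" using u0 \<open>u \<noteq> v\<close> by simp
  ultimately show False using distinct by blast
qed

text \<open>Lagrange interpolation over the conjugates of \<open>b\<close>: each \<open>T z\<close>
  vanishes at all conjugates but the one belonging to \<open>z\<close>. The sum \<open>H\<close> is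
  invariant under the covering transformations and descends to \<open>h\<close>. The product on the
  right is the derivative in \<open>y\<close> of the Weierstrass polynomial of the branch, taken
  along the branch.\<close>

lemma conductor_normalized:
  assumes w: "fps_conv_radius w > 0"
  shows "\<exists>h. convergent2 h \<and>
    subst2 h (fps_X ^ n, b) = w * (\<Prod>v\<in>roots_unity n - {1}. b - rot1 v b)"
proof -
  let ?U = "roots_unity n"
  have U: "finite ?U" "1 \<in> ?U" using roots_unity_simps[OF n] by auto
  define T where "T z = fps_const (rot1 z w) * (\<Prod>v\<in>?U - {z}. var_y - fps_const (rot1 v b))" for z
  define H where "H = (\<Sum>z\<in>?U. T z)"
  have "convergent2 H"
    unfolding H_def T_def using w b
    by (intro convergent2_sum convergent2_mult convergent2_prod convergent2_diff)
       (auto simp: convergent2_fps_const fps_conv_radius_rot1)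
  moreover have "rot u H = H" if u: "u \<in> ?U" for u
  proof -
    have "rot u (T z) = T (u * z)" if z: "z \<in> ?U" for z
    proof -
      have "rot u (T z) = fps_const (rot1 (u * z) w) * (\<Prod>v\<in>?U - {z}. var_y - fps_const (rot1 (u * v) b))"
        unfolding T_def by (simp add: rot_mult rot_prod rot_diff rot1_rot1)
      also have "(\<Prod>v\<in>?U - {z}. var_y - fps_const (rot1 (u * v) b)) =
          (\<Prod>v\<in>?U - {u * z}. var_y - fps_const (rot1 v b))"
        by (rule prod.reindex_bij_betw[OF bij_betw_roots_unity_diff[OF n u z]])
      finally show ?thesis by (simp add: T_def)
    qed
    then have "rot u H = (\<Sum>z\<in>?U. T (u * z))"
      unfolding H_def rot_sum by (intro sum.cong) auto
    also have "\<dots> = H"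
      unfolding H_def by (rule sum.reindex_bij_betw[OF bij_betw_roots_unity[OF n u]])
    finally show ?thesis .
  qed
  ultimately obtain h where h: "convergent2 h" "ramify n h = H"
    using ramify_exists[OF n] by blast
  have z0: "fps_nth (fps_X :: complex fps) 0 = 0" by simp
  have sub: "subst2 (T z) (fps_X, b) = rot1 z w * (\<Prod>v\<in>?U - {z}. b - rot1 v b)" for z
    unfolding T_def
    by (simp add: subst2_mult[OF z0 b(2)] subst2_prod[OF z0 b(2)] subst2_diff[OF z0 b(2)]
        subst2_var[OF z0 b(2)] subst2_fps_const)
  have "subst2 h (fps_X ^ n, b) = subst2 H (fps_X, b)"
    using h(2) subst2_ramify[OF n b(2), of h] by simp
  also have "\<dots> = (\<Sum>z\<in>?U. rot1 z w * (\<Prod>v\<in>?U - {z}. b - rot1 v b))"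
    unfolding H_def subst2_sum[OF z0 b(2)] sub ..
  \<comment> \<open>For \<open>z \<noteq> 1\<close> the product contains the factor with
    \<open>v = 1\<close>, which is \<open>b - b\<close>.\<close>
  also have "\<dots> = (\<Sum>z\<in>{1}. rot1 z w * (\<Prod>v\<in>?U - {z}. b - rot1 v b))"
  proof (rule sum.mono_neutral_right)
    show "\<forall>z\<in>?U - {1}. rot1 z w * (\<Prod>v\<in>?U - {z}. b - rot1 v b) = 0"
      using U by (auto intro!: bexI[of _ 1])
  qed (use U in auto)
  finally show ?thesis using h(1) by auto
qed

lemma conductor_nonzero: "(\<Prod>v\<in>roots_unity n - {1}. b - rot1 v b) \<noteq> 0"
  using roots_unity_simps[OF n] distinct by (auto simp: prod_zero_iff) metis

end

lemma fps_divide_convergent: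
  fixes D w :: "complex fps"
  assumes D: "fps_conv_radius D > 0" "D \<noteq> 0" and w: "fps_conv_radius w > 0" "agree (subdegree D) w 0"
  obtains q where "fps_conv_radius q > 0" "w = q * D"
proof -
  define e where "e = subdegree D"
  define D' where "D' = fps_shift e D"
  define w' where "w' = fps_shift e w"
  have D': "D = fps_X ^ e * D'" unfolding e_def D'_def by (metis subdegree_decompose mult.commute)
  have w': "w = fps_X ^ e * w'"
    using w(2) unfolding w'_def e_def
    by (intro fps_ext) (auto simp: fps_X_power_mult_nth agree_def)
  have D0: "fps_nth D' 0 \<noteq> 0" using D(2) by (simp add: D'_def e_def)
  have "w = w' * inverse D' * D"
    using inverse_mult_eq_1[OF D0] by (simp add: D' w' mult_ac)
  moreover have "fps_conv_radius (w' * inverse D') > 0"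
    using D w D0 by (intro fps_conv_radius_mult_pos fps_conv_radius_inverse_pos) (simp_all add: w'_def D'_def)
  ultimately show thesis using that by blast
qed

lemma fps_power_nth_1: "fps_nth \<tau> 0 = 0 \<Longrightarrow> d > 1 \<Longrightarrow> fps_nth (\<tau> ^ d) 1 = (0 :: complex)"
proof -
  assume *: "fps_nth \<tau> 0 = 0" "d > 1"
  then obtain k where "d = Suc (Suc k)" by (metis less_imp_Suc_add add_Suc_right plus_1_eq_Suc)
  then show ?thesis using *(1) by (simp add: fps_mult_nth)
qed

text \<open>In the parameter \<open>\<tau>\<close> with \<open>\<beta>1 = \<tau>^n\<close> the
  branch takes the form \<open>(t^n, b)\<close> and interpolation applies. A series of at least the
  order of \<open>D\<close>, the product of the differences of conjugates, becomes a multiple of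
  \<open>D\<close> in this parameter, so the order of \<open>D\<close> can serve as
  \<open>c\<close>.\<close>

lemma conductor_aux:
  assumes \<beta>: "fps_conv_radius \<beta>1 > 0" "fps_conv_radius \<beta>2 > 0" "fps_nth \<beta>1 0 = 0" "fps_nth \<beta>2 0 = 0"
    and irr: "irreducible_pair (\<beta>1, \<beta>2)" and nz: "\<beta>1 \<noteq> 0"
  shows "\<exists>c. \<forall>w. fps_conv_radius w > 0 \<longrightarrow> agree c w 0 \<longrightarrow>
    (\<exists>h. convergent2 h \<and> subst2 h (\<beta>1, \<beta>2) = w)"
proof -
  obtain n \<tau> where n: "n > 0" and \<tau>: "fps_conv_radius \<tau> > 0" "fps_nth \<tau> 0 = 0" "fps_nth \<tau> 1 \<noteq> 0"
    and \<beta>1: "\<beta>1 = \<tau> ^ n"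
    using fps_as_power[OF \<beta>(1,3) nz] by metis
  obtain \<sigma> where \<sigma>: "fps_conv_radius \<sigma> > 0" "fps_nth \<sigma> 0 = 0" "\<tau> oo \<sigma> = fps_X" "\<sigma> oo \<tau> = fps_X"
    using convergent_compositional_inverse[OF \<tau>] by metis
  have cancel: "(a oo \<sigma>) oo \<tau> = a" for a
    using fps_compose_assoc[OF \<tau>(2) \<sigma>(2), of a] \<sigma>(4) by simp
  define b where "b = \<beta>2 oo \<sigma>"
  have b: "fps_conv_radius b > 0" "fps_nth b 0 = 0"
    using \<beta> \<sigma> by (auto simp: b_def intro: fps_conv_radius_compose)
  \<comment> \<open>If \<open>b\<close> were equal to a conjugate, \<open>b\<close> and
    \<open>t^n\<close> would be series in \<open>t^d\<close> with \<open>d > 1\<close>, and the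
    given pair would factor through \<open>\<tau>^d\<close>, against irreducibility.\<close>
  have distinct: "rot1 z b \<noteq> b" if z: "z \<in> roots_unity n" "z \<noteq> 1" for z
  proof
    assume "rot1 z b = b"
    then obtain d b' where d: "d > 1" "d dvd n" "b = b' oo fps_X ^ d" "fps_conv_radius b' > 0"
      using factor_through_power[OF n z _ b(1)] by metis
    have X: "(a oo fps_X ^ d) oo \<tau> = a oo \<tau> ^ d" for a
      using d(1) \<tau>(2) fps_compose_assoc[of \<tau> "fps_X ^ d" a]
      by (simp add: fps_X_power_compose)
    have "\<beta>2 = b' oo \<tau> ^ d" using cancel[of \<beta>2] d(3) X by (simp add: b_def)
    moreover have "\<beta>1 = fps_X ^ (n div d) oo \<tau> ^ d"
      using d \<tau>(2) by (simp add: \<beta>1 fps_X_power_compose flip: power_mult)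
    moreover have "fps_conv_radius (\<tau> ^ d) > 0"
      using fps_conv_radius_power[of \<tau> d] \<tau>(1) by (simp add: less_le_trans)
    moreover have "fps_nth (\<tau> ^ d) 0 = 0" using \<tau>(2) d(1) by (simp add: fps_power_zeroth)
    ultimately have "fps_nth (\<tau> ^ d) 1 \<noteq> 0"
      using irr[unfolded irreducible_pair_def, rule_format, of "fps_X ^ (n div d)" b' "\<tau> ^ d"] d(4)
      by simp
    then show False using fps_power_nth_1[OF \<tau>(2) d(1)] by simp
  qed
  define D where "D = (\<Prod>v\<in>roots_unity n - {1}. b - rot1 v b)"
  have D0: "D \<noteq> 0" unfolding D_def by (rule conductor_nonzero[OF n b distinct])
  have "convergent2 (\<Prod>v\<in>roots_unity n - {1}. fps_const (b - rot1 v b))"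
    unfolding fps_const_sub[symmetric] using b(1)
    by (intro convergent2_prod convergent2_diff) (auto simp: convergent2_fps_const fps_conv_radius_rot1)
  moreover have "(\<Prod>v\<in>A. fps_const (b - rot1 v b)) = fps_const (\<Prod>v\<in>A. b - rot1 v b)" for A
    by (induction A rule: infinite_finite_induct) simp_all
  ultimately have D: "fps_conv_radius D > 0" by (simp add: D_def convergent2_fps_const)
  show ?thesis
  proof (intro exI[of _ "subdegree D"] allI impI)
    fix w :: "complex fps" assume w: "fps_conv_radius w > 0" "agree (subdegree D) w 0"
    have "fps_conv_radius (w oo \<sigma>) > 0" using w \<sigma> by (intro fps_conv_radius_compose)
    moreover have "agree (subdegree D) (w oo \<sigma>) 0"
      using w(2) by (auto simp: agree_def fps_compose_nth intro!: sum.neutral)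
    ultimately obtain q where q: "fps_conv_radius q > 0" "w oo \<sigma> = q * D"
      using fps_divide_convergent[OF D D0] by metis
    obtain h where h: "convergent2 h" "subst2 h (fps_X ^ n, b) = q * D"
      using conductor_normalized[OF n b distinct q(1)] unfolding D_def by blast
    have X: "\<beta>1 = fps_X ^ n oo \<tau>" "\<beta>2 = b oo \<tau>"
      using \<tau>(2) cancel[of \<beta>2] by (simp_all add: \<beta>1 fps_X_power_compose b_def)
    have "subst2 h (\<beta>1, \<beta>2) = subst2 h (fps_X ^ n, b) oo \<tau>"
      unfolding X using n b \<tau> by (intro subst2_compose) (auto simp: fps_X_power_nth)
    also have "\<dots> = w" using h(2) q(2) cancel[of w] by simp
    finally show "\<exists>h. convergent2 h \<and> subst2 h (\<beta>1, \<beta>2) = w" using h(1) by blast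
  qed
qed

lemma conductor:
  assumes \<beta>: "fps_conv_radius \<beta>1 > 0" "fps_conv_radius \<beta>2 > 0" "fps_nth \<beta>1 0 = 0" "fps_nth \<beta>2 0 = 0"
    and irr: "irreducible_pair (\<beta>1, \<beta>2)"
  shows "\<exists>c. \<forall>w. fps_conv_radius w > 0 \<longrightarrow> agree c w 0 \<longrightarrow>
    (\<exists>h. convergent2 h \<and> max_ideal h \<and> subst2 h (\<beta>1, \<beta>2) = w)"
proof -
  have "\<exists>c. \<forall>w. fps_conv_radius w > 0 \<longrightarrow> agree c w 0 \<longrightarrow>
    (\<exists>h. convergent2 h \<and> subst2 h (\<beta>1, \<beta>2) = w)"
  proof (cases "\<beta>1 = 0")
    case False
    then show ?thesis using conductor_aux assms by blast
  next
    case True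
    \<comment> \<open>The zero pair factors through \<open>t^2\<close> and is not
      irreducible.\<close>
    have "\<beta>2 \<noteq> 0"
    proof
      assume "\<beta>2 = 0"
      then have "(\<beta>1, \<beta>2) = (0 oo (fps_X ^ 2), 0 oo (fps_X ^ 2))" using True by simp
      then have "fps_nth ((fps_X :: complex fps) ^ 2) 1 \<noteq> 0"
        using irr unfolding irreducible_pair_def
        by (elim allE[of _ 0] allE[of _ "fps_X ^ 2"]) (auto simp: fps_X_power_nth)
      then show False by (simp add: fps_X_power_nth)
    qed
    moreover have "irreducible_pair (\<beta>2, \<beta>1)"
      using irr unfolding irreducible_pair_def by auto
    ultimately obtain c where c: "\<forall>w. fps_conv_radius w > 0 \<longrightarrow> agree c w 0 \<longrightarrow>
        (\<exists>h. convergent2 h \<and> subst2 h (\<beta>2, \<beta>1) = w)"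
      using conductor_aux[of \<beta>2 \<beta>1] \<beta> by blast
    have "\<forall>w. fps_conv_radius w > 0 \<longrightarrow> agree c w 0 \<longrightarrow>
        (\<exists>h. convergent2 h \<and> subst2 h (\<beta>1, \<beta>2) = w)"
      using c subst2_swap2 convergent2_swap2 by blast
    then show ?thesis by blast
  qed
  then obtain c where c: "\<forall>w. fps_conv_radius w > 0 \<longrightarrow> agree c w 0 \<longrightarrow>
    (\<exists>h. convergent2 h \<and> subst2 h (\<beta>1, \<beta>2) = w)" by blast
  show ?thesis
  \<comment> \<open>The successor matters if \<open>c = 0\<close>: it forces \<open>w\<close>, and
    with it \<open>h\<close>, to vanish at the origin.\<close>
  proof (intro exI[of _ "Suc c"] allI impI)
    fix w :: "complex fps" assume w: "fps_conv_radius w > 0" "agree (Suc c) w 0"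
    then have "agree c w 0" using agree_mono by (metis le_SucI order_refl)
    then obtain h where h: "convergent2 h" "subst2 h (\<beta>1, \<beta>2) = w" using c w(1) by blast
    have "coeff2 h 0 0 = fps_nth w 0" using subst2_nth_0[OF \<beta>(3,4), of h] h(2) by simp
    also have "\<dots> = 0" using w(2) by (simp add: agree_def)
    finally show "\<exists>h. convergent2 h \<and> max_ideal h \<and> subst2 h (\<beta>1, \<beta>2) = w"
      using h by (auto simp: max_ideal_def)
  qed
qed

text \<open>The divided derivative of order \<open>k\<close> in \<open>y\<close>, that is, the
  \<open>k\<close>-th derivative over \<open>k!\<close>.\<close>

definition taylor_y :: "nat \<Rightarrow> fps2 \<Rightarrow> fps2" where
  "taylor_y k f = Abs_fps (\<lambda>j. Abs_fps (\<lambda>i. of_nat ((j + k) choose k) * coeff2 f i (j + k)))"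

lemma coeff2_taylor_y: "coeff2 (taylor_y k f) i j = of_nat ((j + k) choose k) * coeff2 f i (j + k)"
  by (simp add: taylor_y_def)

text \<open>Covers division by a power of a variable and divided derivatives at once; the factor
  \<open>2^(i + j)\<close> leaves room for binomial coefficients.\<close>

lemma convergent2_coeff_shift:
  assumes "convergent2 f" "A \<ge> 0" "\<And>i j. norm (coeff2 g i j) \<le> A * 2 ^ (i + j) * norm (coeff2 f (i + a) (j + b))"
  shows "convergent2 g"
proof -
  obtain C R where R: "R \<ge> 1" and C: "C \<ge> 0" "\<And>i j. norm (coeff2 f i j) \<le> C * R ^ (i + j)"
    using assms(1) by (auto simp: convergent2_iff_geometric)
  have "norm (coeff2 g i j) \<le> (A * C * R ^ (a + b)) * (2 * R) ^ (i + j)" for i j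
  proof -
    have "norm (coeff2 g i j) \<le> A * 2 ^ (i + j) * (C * R ^ (i + a + (j + b)))"
      using assms(2) by (intro order_trans[OF assms(3)] mult_left_mono C(2)) simp
    also have "\<dots> = (A * C * R ^ (a + b)) * (2 * R) ^ (i + j)"
      by (simp add: power_mult_distrib power_add mult_ac)
    finally show ?thesis .
  qed
  moreover have "2 * R \<ge> 1" "A * C * R ^ (a + b) \<ge> 0" using R C assms(2) by auto
  ultimately show ?thesis unfolding convergent2_iff_geometric by blast
qed

lemma convergent2_taylor_y: "convergent2 f \<Longrightarrow> convergent2 (taylor_y k f)"
proof (rule convergent2_coeff_shift[where A = "2 ^ k" and a = 0 and b = k])
  fix i j
  have "real ((j + k) choose k) \<le> 2 ^ (j + k)"
    using binomial_le_pow2[of "j + k" k] by (metis of_nat_le_iff of_nat_numeral of_nat_power)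
  also have "\<dots> \<le> 2 ^ k * 2 ^ (i + j)" by (simp add: power_add)
  finally have "real ((j + k) choose k) * norm (coeff2 f i (j + k)) \<le> 2 ^ k * 2 ^ (i + j) * norm (coeff2 f i (j + k))"
    by (rule mult_right_mono) simp
  then show "norm (coeff2 (taylor_y k f) i j) \<le> 2 ^ k * 2 ^ (i + j) * norm (coeff2 f (i + 0) (j + k))"
    by (simp add: coeff2_taylor_y norm_mult)
qed auto

lemma fps_nth_y_plus_const_power:
  "fps_nth ((var_y + fps_const a) ^ b) k = of_nat (b choose k) * a ^ (b - k)"
proof -
  have "fps_nth ((var_y + fps_const a) ^ b) k = fps_nth (\<Sum>l\<le>b. of_nat (b choose l) * fps_X ^ l * fps_const a ^ (b - l)) k"
    unfolding var_y_def binomial_ring ..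
  also have "\<dots> = (\<Sum>l\<le>b. if l = k then of_nat (b choose k) * a ^ (b - k) else 0)"
    unfolding fps_sum_nth
  proof (intro sum.cong refl)
    fix l assume "l \<in> {..b}"
    have "of_nat (b choose l) * fps_X ^ l * fps_const a ^ (b - l) =
        fps_X ^ l * fps_const (of_nat (b choose l) * a ^ (b - l))"
      by (simp add: mult_ac fps_const_power flip: fps_of_nat fps_const_mult)
    then show "fps_nth (of_nat (b choose l) * fps_X ^ l * fps_const a ^ (b - l)) k =
        (if l = k then of_nat (b choose k) * a ^ (b - k) else 0)"
      by (auto simp: fps_X_power_mult_nth)
  qed
  also have "\<dots> = of_nat (b choose k) * a ^ (b - k)"
    by (auto simp: sum.delta not_le binomial_eq_0)
  finally show ?thesis .
qed

text \<open>Taylor's formula along \<open>y = \<phi>(x)\<close>, checked on monomials by the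
  binomial theorem. Extracting the coefficient of \<open>y^k\<close> may lower the order by
  \<open>k\<close>; the factor \<open>x^k\<close> in \<open>L1\<close> and \<open>L2\<close>
  compensates this, so that both maps are filtered, and is cancelled at the end.\<close>

lemma fps_nth_shift_y:
  assumes \<phi>: "fps_nth \<phi> 0 = 0"
  shows "fps_nth (subst22 G (var_x, var_y + fps_const \<phi>)) k = subst2 (taylor_y k G) (fps_X, \<phi>)"
proof -
  define L1 where "L1 G = var_x ^ k * fps_const (fps_nth (subst22 G (var_x, var_y + fps_const \<phi>)) k)" for G
  define L2 where "L2 G = var_x ^ k * subst22 (taylor_y k G) (var_x, fps_const \<phi>)" for G
  have mi: "max_ideal (var_y + fps_const \<phi>)" "max_ideal (fps_const \<phi>)" using \<phi> by auto
  note fl1 = filtered_linear_subst22[OF max_ideal_intros(1) mi(1)]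
  note fl2 = filtered_linear_subst22[OF max_ideal_intros(1) mi(2)]
  have vx: "vanish N (var_x ^ k * u)" if "vanish (N - k) u" for N u
    using that by (auto simp: vanish_def coeff2_var_x_power_mult)
  have "filtered_linear L1"
    unfolding filtered_linear_def
  proof (intro conjI allI impI)
    show "L1 (f + g) = L1 f + L1 g" for f g
      by (simp add: L1_def subst22_add mi distrib_left flip: fps_const_add)
    show "L1 (const2 c * f) = const2 c * L1 f" for c f
      by (simp add: L1_def subst22_const2_mult mi mult.left_commute flip: fps_const_mult)
    show "vanish N (L1 f)" if "vanish N f" for N f
    proof -
      have "vanish N (subst22 f (var_x, var_y + fps_const \<phi>))"
        using filtered_linear_vanish[OF fl1 that] .
      then show ?thesis unfolding L1_def
        by (intro vx) (auto simp: vanish_def coeff2_fps_const coeff2_def)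
    qed
  qed
  moreover have "filtered_linear L2"
    unfolding filtered_linear_def
  proof (intro conjI allI impI)
    have "taylor_y k (f + g) = taylor_y k f + taylor_y k g" for f g
      by (rule fps2_eqI) (simp add: coeff2_taylor_y distrib_left)
    then show "L2 (f + g) = L2 f + L2 g" for f g
      by (simp add: L2_def subst22_add mi distrib_left)
    have "taylor_y k (const2 c * f) = const2 c * taylor_y k f" for c f
      by (rule fps2_eqI) (simp add: coeff2_taylor_y)
    then show "L2 (const2 c * f) = const2 c * L2 f" for c f
      by (simp add: L2_def subst22_const2_mult mi mult.left_commute)
    show "vanish N (L2 f)" if "vanish N f" for N f
    proof -
      have "vanish (N - k) (taylor_y k f)" using that by (auto simp: vanish_def coeff2_taylor_y)
      then show ?thesis unfolding L2_def by (intro vx filtered_linear_vanish[OF fl2])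
    qed
  qed
  moreover have "L1 (mon a b) = L2 (mon a b)" for a b
  proof -
    have "taylor_y k (mon a b) = const2 (of_nat (b choose k)) * mon a (b - k)"
    proof (rule fps2_eqI)
      fix i j
      show "coeff2 (taylor_y k (mon a b)) i j = coeff2 (const2 (of_nat (b choose k)) * mon a (b - k)) i j"
        by (cases "k \<le> b") (auto simp: coeff2_taylor_y coeff2_mon binomial_eq_0)
    qed
    then have "L2 (mon a b) = var_x ^ k * (const2 (of_nat (b choose k)) * (var_x ^ a * fps_const \<phi> ^ (b - k)))"
      by (simp add: L2_def subst22_const2_mult subst22_mon mi)
    moreover have "fps_nth (subst22 (mon a b) (var_x, var_y + fps_const \<phi>)) k =
        fps_X ^ a * (of_nat (b choose k) * \<phi> ^ (b - k))"
    proof -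
      have "var_x ^ a = (fps_const (fps_X ^ a) :: fps2)" by (simp add: var_x_def fps_const_power)
      then have "fps_nth (var_x ^ a * u) k = fps_X ^ a * fps_nth u k" for u :: fps2 by simp
      then show ?thesis by (simp add: subst22_mon mi fps_nth_y_plus_const_power)
    qed
    moreover have "fps_const (fps_X ^ a * (of_nat (b choose k) * \<phi> ^ (b - k))) =
        const2 (of_nat (b choose k)) * (var_x ^ a * fps_const \<phi> ^ (b - k))"
      by (simp add: var_x_def fps_const_power mult_ac fps_of_nat flip: fps_const_mult)
    ultimately show ?thesis by (simp add: L1_def)
  qed
  ultimately have eq: "L1 G = L2 G" by (rule filtered_linear_eqI)
  have nz: "var_x ^ k \<noteq> (0 :: fps2)"
    by (simp add: var_x_def)
  have "fps_const (fps_nth (subst22 G (var_x, var_y + fps_const \<phi>)) k) =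
      subst22 (taylor_y k G) (var_x, fps_const \<phi>)"
    by (rule mult_left_cancel[OF nz, THEN iffD1, OF eq[unfolded L1_def L2_def]])
  also have "\<dots> = subst22 (taylor_y k G) (fps_const fps_X, fps_const \<phi>)"
    by (simp only: var_x_def)
  also have "\<dots> = fps_const (subst2 (taylor_y k G) (fps_X, \<phi>))"
    using \<phi> by (intro fps_const_subst2[symmetric]) auto
  finally show ?thesis by (simp only: fps_const_eq_iff2)
qed

section \<open>Puiseux roots\<close>

lemma coeff2_const_plus_y_power:
  "coeff2 ((const2 c + var_y) ^ b) i l = (if i = 0 then of_nat (b choose l) * c ^ (b - l) else 0)"
proof -
  have "fps_nth ((const2 c + var_y) ^ b) l = fps_const (of_nat (b choose l) * c ^ (b - l))"
    using fps_nth_y_plus_const_power[of "fps_const c" b l]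
    by (simp add: add.commute fps_const_power fps_of_nat flip: fps_const_mult)
  then show ?thesis by (simp add: coeff2_def)
qed

text \<open>
  One step of the Newton-Puiseux algorithm. Since the coefficient of \<open>y\<^sup>d\<^sup>-\<^sup>1\<close> vanishes, the
  polynomial attached to the edge of the Newton polygon is not a \<open>d\<close>-th power, so that the
  multiplicity drops below \<open>d\<close>.
\<close>

lemma newton_step:
  assumes F: "convergent2 F" and d: "d \<ge> 2"
    and low: "\<And>j. j < d \<Longrightarrow> coeff2 F 0 j = 0" and top: "coeff2 F 0 d \<noteq> 0"
    and killed: "fps_nth F (d - 1) = 0"
    and ex: "\<exists>j<d. fps_nth F j \<noteq> 0"
  obtains p q c G e where "p > 0" "q > 0" "convergent2 G" "1 \<le> e" "e < d"
    "\<And>j. j < e \<Longrightarrow> coeff2 G 0 j = 0" "coeff2 G 0 e \<noteq> 0"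
    "subst22 F (var_x ^ q, var_x ^ p * (const2 c + var_y)) = var_x ^ (p * d) * G"
proof -
  define J where "J = {j. j < d \<and> fps_nth F j \<noteq> 0}"
  define s where "s j = subdegree (fps_nth F j)" for j
  have J: "finite J" "J \<noteq> {}" using ex by (auto simp: J_def)
  \<comment> \<open>\<open>r j\<close> measures the inclination of the segment from
    \<open>(0, d)\<close> to the first monomial of \<open>F\<close> in \<open>y^j\<close>. Its
    minimum selects the edge of the Newton polygon at \<open>(0, d)\<close>, on which
    \<open>x^i y^j\<close> satisfies \<open>q i + p j = p d\<close>.\<close>
  define r where "r j = real (s j) / real (d - j)" for j
  obtain j0 where j0: "j0 \<in> J" "\<And>j. j \<in> J \<Longrightarrow> r j0 \<le> r j"
    using arg_min_if_finite[OF J, of r] by (metis not_le)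
  define p where "p = s j0"
  define q where "q = d - j0"
  have j0d: "j0 < d" and j0nz: "fps_nth F j0 \<noteq> 0" using j0(1) by (auto simp: J_def)
  have coef_p: "coeff2 F p j0 \<noteq> 0"
    using nth_subdegree_nonzero[OF j0nz] by (simp add: p_def s_def coeff2_def)
  have p: "p > 0" using coef_p low[OF j0d] by (cases "p = 0") auto
  have q: "q > 0" using j0d by (simp add: q_def)
  \<comment> \<open>No monomial of \<open>F\<close> lies below the edge, which makes the substituted
    series divisible by \<open>x^(p d)\<close>.\<close>
  have ineq: "p * d \<le> q * i + p * j" if nz: "coeff2 F i j \<noteq> 0" for i j
  proof (cases "j < d")
    case True
    have jJ: "j \<in> J" using nz True by (auto simp: J_def coeff2_def)
    have "real (s j0) * real (d - j) \<le> real (s j) * real (d - j0)"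
      using j0(2)[OF jJ] True j0d by (simp add: r_def field_simps)
    then have "p * (d - j) \<le> s j * q"
      unfolding p_def q_def of_nat_mult[symmetric] of_nat_le_iff .
    also have "\<dots> \<le> i * q"
      using nz by (intro mult_le_mono1) (auto simp: s_def coeff2_def intro: subdegree_leI)
    finally have "p * (d - j) + p * j \<le> q * i + p * j" by (simp add: mult.commute)
    then show ?thesis using True by (simp flip: distrib_left)
  next
    case False
    then show ?thesis by (simp add: trans_le_add2)
  qed
  define S where "S = {(a, b). q * a + p * b = p * d}"
  have S_le: "a + b \<le> p * d" if "(a, b) \<in> S" for a b
  proof -
    have "a + b \<le> q * a + p * b" using p q by (intro add_mono) simp_all
    then show ?thesis using that by (simp add: S_def)
  qed
  have S: "finite S"
    by (rule finite_subset[OF _ finite_pairs_le[of "p * d"]]) (use S_le in auto)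
  have S_d: "b \<le> d" if "(a, b) \<in> S" for a b
    using that p by (auto simp: S_def) (metis le_add2 mult_le_cancel1)
  \<comment> \<open>The polynomial of the edge. \<open>G(0, y)\<close> will be
    \<open>Q(c + y)\<close>, so that a root \<open>c\<close> makes \<open>G\<close> vanish at the
    origin; the root may be 0.\<close>
  define Q where "Q = (\<Sum>x\<in>S. monom (coeff2 F (fst x) (snd x)) (snd x))"
  have pcQ: "poly Q z = (\<Sum>x\<in>S. coeff2 F (fst x) (snd x) * z ^ snd x)" for z
    by (simp add: Q_def poly_sum poly_monom)
  \<comment> \<open>On the edge the exponent of \<open>y\<close> determines that of
    \<open>x\<close>, so each power of \<open>y\<close> comes from at most one monomial of
    \<open>F\<close>.\<close>
  have single: "(\<Sum>x\<in>S. coeff2 F (fst x) (snd x) * (if snd x = b then w x else 0)) = coeff2 F a b * w (a, b)"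
    if ab: "(a, b) \<in> S" for a b w
  proof -
    have "(\<Sum>x\<in>S. coeff2 F (fst x) (snd x) * (if snd x = b then w x else 0)) =
        (\<Sum>x\<in>S. if x = (a, b) then coeff2 F a b * w (a, b) else 0)"
    proof (intro sum.cong refl)
      fix x assume x: "x \<in> S"
      have "x = (a, b)" if "snd x = b"
      proof -
        have "q * fst x + p * b = q * a + p * b" using x ab that by (auto simp: S_def)
        then have "fst x = a" using q by simp
        then show ?thesis using that by (simp add: prod_eq_iff)
      qed
      then have iff: "snd x = b \<longleftrightarrow> x = (a, b)" by (metis snd_conv)
      show "coeff2 F (fst x) (snd x) * (if snd x = b then w x else 0) =
          (if x = (a, b) then coeff2 F a b * w (a, b) else 0)"
        unfolding iff by (simp only: if_distrib[of "(*) _"] mult_zero_right fst_conv snd_conv cong: if_cong)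
    qed
    then show ?thesis using S ab by simp
  qed
  have Sd: "(0, d) \<in> S" by (simp add: S_def)
  have "coeff Q d \<noteq> 0"
  proof -
    have "coeff Q d = (\<Sum>x\<in>S. coeff2 F (fst x) (snd x) * (if snd x = d then 1 else 0))"
      unfolding Q_def coeff_sum by (intro sum.cong refl) auto
    then show ?thesis using single[OF Sd, of "\<lambda>_. 1"] top by simp
  qed
  then have "degree Q \<noteq> 0" using d le_degree[of Q d] by auto
  then obtain c where c: "poly Q c = 0"
    using alg_closed_imp_poly_has_root[of Q] by blast
  define H where "H = subst22 F (var_x ^ q, var_x ^ p * (const2 c + var_y))"
  have mi: "max_ideal (var_x ^ q)" "max_ideal (var_x ^ p * (const2 c + var_y))"
    using p q by auto
  have H: "convergent2 H"
    unfolding H_def using F mi by (intro convergent2_subst22 convergent2_mult convergent2_power convergent2_add) auto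
  have mono: "coeff2 ((var_x ^ q) ^ a * (var_x ^ p * (const2 c + var_y)) ^ b) k l =
      (if k = q * a + p * b then of_nat (b choose l) * c ^ (b - l) else 0)" for a b k l
  proof -
    have "(var_x ^ q) ^ a * (var_x ^ p * (const2 c + var_y)) ^ b =
        var_x ^ (q * a + p * b) * (const2 c + var_y) ^ b"
      by (simp add: power_mult_distrib power_add mult.assoc flip: power_mult)
    then show ?thesis
      by (auto simp: coeff2_var_x_power_mult coeff2_const_plus_y_power)
  qed
  have coH: "coeff2 H k l = (\<Sum>(a, b) | a + b \<le> k + l. coeff2 F a b *
      (if k = q * a + p * b then of_nat (b choose l) * c ^ (b - l) else 0))" for k l
    unfolding H_def coeff2_subst22 fst_conv snd_conv mono ..
  have H0: "coeff2 H k l = 0" if "k < p * d" for k l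
    unfolding coH
  proof (intro sum.neutral ballI)
    fix x assume "x \<in> {(a, b). a + b \<le> k + l}"
    show "(case x of (a, b) \<Rightarrow> coeff2 F a b * (if k = q * a + p * b then of_nat (b choose l) * c ^ (b - l) else 0)) = 0"
      using ineq[of "fst x" "snd x"] that by (auto simp: case_prod_unfold)
  qed
  have Hd: "coeff2 H (p * d) l = (\<Sum>x\<in>S. coeff2 F (fst x) (snd x) * (of_nat (snd x choose l) * c ^ (snd x - l)))" for l
    unfolding coH case_prod_unfold
  proof (rule sum.mono_neutral_cong_right)
    show "finite {p'. fst p' + snd p' \<le> p * d + l}"
      using finite_pairs_le[of "p * d + l"] by (simp add: case_prod_unfold)
    show "S \<subseteq> {p'. fst p' + snd p' \<le> p * d + l}" using S_le by fastforce
  qed (auto simp: S_def)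
  define G where "G = Abs_fps (\<lambda>j. Abs_fps (\<lambda>i. coeff2 H (i + p * d) j))"
  have G: "coeff2 G i j = coeff2 H (i + p * d) j" for i j by (simp add: G_def)
  have HG: "H = var_x ^ (p * d) * G"
    by (rule fps2_eqI) (auto simp: coeff2_var_x_power_mult G H0)
  have "convergent2 G"
  proof (rule convergent2_coeff_shift[OF H, of 1 _ "p * d" 0])
    show "norm (coeff2 G i j) \<le> 1 * 2 ^ (i + j) * norm (coeff2 H (i + p * d) (j + 0))" for i j
      using mult_right_mono[of 1 "2 ^ (i + j)" "norm (coeff2 H (i + p * d) j)"]
      by (simp add: G)
  qed simp
  have "coeff2 G 0 0 = 0"
    using c by (simp add: G Hd pcQ)
  have "\<exists>l<d. coeff2 G 0 l \<noteq> 0"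
  \<comment> \<open>For \<open>c = 0\<close> the other point \<open>(p, j0)\<close> of the edge
    keeps its coefficient at \<open>y^j0\<close>. For \<open>c \<noteq> 0\<close> the coefficient of
    \<open>y^(d - 1)\<close> in \<open>Q(c + y)\<close> is \<open>d c\<close> times the leading one,
    since by \<open>killed\<close> the edge has no term in \<open>y^(d - 1)\<close>.\<close>
  proof (cases "c = 0")
    case True
    have "p * (d - j0) + p * j0 = p * d" using j0d by (simp flip: distrib_left)
    then have "(p, j0) \<in> S" by (simp add: S_def q_def mult.commute)
    moreover have "of_nat (snd x choose j0) * c ^ (snd x - j0) = (if snd x = j0 then 1 else 0)" for x :: "nat \<times> nat"
      using True by (cases "snd x < j0") (auto simp: power_0_left binomial_eq_0)
    ultimately have "coeff2 G 0 j0 = coeff2 F p j0"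
      using single[of p j0 "\<lambda>_. 1"] by (simp add: G Hd)
    then show ?thesis using coef_p j0d by auto
  next
    case False
    have "coeff2 F (fst x) (snd x) * (of_nat (snd x choose (d - 1)) * c ^ (snd x - (d - 1))) =
        coeff2 F (fst x) (snd x) * (if snd x = d then of_nat d * c else 0)" if "x \<in> S" for x
    proof -
      have "snd x \<le> d" using S_d that by (metis prod.collapse)
      then consider "snd x = d" | "snd x = d - 1" | "snd x < d - 1" using d by linarith
      then show ?thesis
      proof cases
        case 1
        have "d choose (d - 1) = d" using d binomial_symmetric[of 1 d] by simp
        then show ?thesis using 1 d by simp
      next
        case 2
        then show ?thesis using killed d by (simp add: coeff2_def)
      next
        case 3
        then show ?thesis using d by (simp add: binomial_eq_0)
      qed
    qed
    then have "(\<Sum>x\<in>S. coeff2 F (fst x) (snd x) * (of_nat (snd x choose (d - 1)) * c ^ (snd x - (d - 1)))) =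
        (\<Sum>x\<in>S. coeff2 F (fst x) (snd x) * (if snd x = d then of_nat d * c else 0))"
      by (rule sum.cong[OF refl])
    then have "coeff2 G 0 (d - 1) = (\<Sum>x\<in>S. coeff2 F (fst x) (snd x) * (if snd x = d then of_nat d * c else 0))"
      by (simp only: G Hd add_0)
    also have "\<dots> = coeff2 F 0 d * (of_nat d * c)" by (rule single[OF Sd])
    finally have "coeff2 G 0 (d - 1) \<noteq> 0" using top d False by simp
    then show ?thesis using d by (intro exI[of _ "d - 1"]) auto
  qed
  then obtain l where l: "l < d" "coeff2 G 0 l \<noteq> 0" by blast
  define e where "e = (LEAST l. coeff2 G 0 l \<noteq> 0)"
  have e: "coeff2 G 0 e \<noteq> 0" "e \<le> l"
    unfolding e_def
    by (rule LeastI[of "\<lambda>l. coeff2 G 0 l \<noteq> 0", OF l(2)], rule Least_le[of "\<lambda>l. coeff2 G 0 l \<noteq> 0", OF l(2)])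
  have e3: "coeff2 G 0 j = 0" if "j < e" for j
    using not_less_Least[of j "\<lambda>l. coeff2 G 0 l \<noteq> 0"] that unfolding e_def by blast
  have "e \<noteq> 0"
  proof
    assume "e = 0"
    then show False using e(1) \<open>coeff2 G 0 0 = 0\<close> by simp
  qed
  then have e1: "1 \<le> e" "e < d" using e(2) l(1) by simp_all
  show thesis
    by (rule that[OF p q \<open>convergent2 G\<close> e1 e3 e(1)]) (use HG in \<open>simp_all add: H_def\<close>)
qed

text \<open>Induction on the order \<open>d\<close> of \<open>F(0, y)\<close>. A Tschirnhausen shift
  of \<open>y\<close> by a zero \<open>\<phi>\<close> of the divided derivative of order
  \<open>d - 1\<close> removes the coefficient of \<open>y^(d - 1)\<close>. Then either all lower
  coefficients vanish and \<open>y = \<phi>\<close> is a root, or a Newton step lowers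
  \<open>d\<close>.\<close>

lemma puiseux_root:
  assumes "convergent2 F" "d \<ge> 1" "\<And>j. j < d \<Longrightarrow> coeff2 F 0 j = 0" "coeff2 F 0 d \<noteq> 0"
  shows "\<exists>n>0. \<exists>b. fps_conv_radius b > 0 \<and> fps_nth b 0 = 0 \<and> subst2 F (fps_X ^ n, b) = 0"
  using assms
proof (induction d arbitrary: F rule: less_induct)
  case (less d F)
  define T where "T = taylor_y (d - 1) F"
  have "convergent2 T" using less.prems by (simp add: T_def convergent2_taylor_y)
  moreover have "coeff2 T 0 0 = 0" "coeff2 T 0 1 \<noteq> 0"
    using less.prems(3)[of "d - 1"] less.prems(2,4) by (simp_all add: T_def coeff2_taylor_y)
  ultimately obtain \<phi> where \<phi>: "fps_conv_radius \<phi> > 0" "fps_nth \<phi> 0 = 0" "subst2 T (fps_X, \<phi>) = 0"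
    by (rule implicit_function)
  define F1 where "F1 = subst22 F (var_x, var_y + fps_const \<phi>)"
  have mi: "max_ideal (var_y + fps_const \<phi>)" using \<phi> by auto
  have F1: "convergent2 F1"
    unfolding F1_def using less.prems(1) \<phi> mi
    by (intro convergent2_subst22 convergent2_add) (auto simp: convergent2_fps_const)
  have sub: "subst2 F1 (u, v) = subst2 F (u, v + (\<phi> oo u))" if "fps_nth u 0 = 0" "fps_nth v 0 = 0" for u v
    unfolding F1_def using that mi
    by (subst subst2_subst22) (simp_all add: subst2_add subst2_fps_const)
  have F1_0: "coeff2 F1 0 j = coeff2 F 0 j" for j
    using sub[of 0 fps_X] \<phi>(2) by (simp flip: fps_nth_subst2_0_X)
  have killed: "fps_nth F1 (d - 1) = 0"
    unfolding F1_def fps_nth_shift_y[OF \<phi>(2)] using \<phi>(3) by (simp add: T_def)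
  show ?case
  proof (cases "\<forall>j<d. fps_nth F1 j = 0")
    case True
    then have "subst2 F1 (fps_X, 0) = 0" using less.prems(2) by (simp add: subst2_fps_X_0)
    then have "subst2 F (fps_X ^ 1, \<phi>) = 0" using sub[of fps_X 0] by simp
    then show ?thesis using \<phi> zero_less_one by blast
  next
    case False
    then have ex: "\<exists>j<d. fps_nth F1 j \<noteq> 0" by blast
    have d2: "d \<ge> 2"
    proof (rule ccontr)
      assume "\<not> d \<ge> 2"
      then have "d = 1" using less.prems(2) by simp
      then show False using ex killed by auto
    qed
    have lo: "coeff2 F1 0 j = 0" if "j < d" for j using less.prems(3)[OF that] F1_0 by simp
    have to: "coeff2 F1 0 d \<noteq> 0" using less.prems(4) F1_0 by simp
    obtain p q c G e where G: "p > 0" "q > 0" "convergent2 G" "1 \<le> e" "e < d"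
      "\<And>j. j < e \<Longrightarrow> coeff2 G 0 j = 0" "coeff2 G 0 e \<noteq> 0"
      "subst22 F1 (var_x ^ q, var_x ^ p * (const2 c + var_y)) = var_x ^ (p * d) * G"
      by (rule newton_step[OF F1 d2 lo to killed ex]) blast+
    obtain n w where w: "n > 0" "fps_conv_radius w > 0" "fps_nth w 0 = 0" "subst2 G (fps_X ^ n, w) = 0"
      using less.IH[OF G(5,3,4,6,7)] by blast
    \<comment> \<open>Undoes the substitution of the Newton step at \<open>x = t^n\<close>, and then
      the shift by \<open>\<phi>\<close> at \<open>x = t^(n q)\<close>.\<close>
    define b where "b = fps_X ^ (n * p) * (fps_const c + w) + (\<phi> oo fps_X ^ (n * q))"
    have z: "fps_nth (fps_X ^ k :: complex fps) 0 = 0" if "k > 0" for k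
      using that by (simp add: fps_X_power_nth)
    have z1: "fps_nth (fps_X ^ (n * p) * (fps_const c + w)) 0 = 0"
      using w G by (simp add: fps_X_power_nth)
    have "subst2 F (fps_X ^ (n * q), b) = subst2 F1 (fps_X ^ (n * q), fps_X ^ (n * p) * (fps_const c + w))"
      unfolding b_def using w(1) G(2) by (intro sub[symmetric] z z1) simp
    also have "\<dots> = subst2 (subst22 F1 (var_x ^ q, var_x ^ p * (const2 c + var_y))) (fps_X ^ n, w)"
      using w G by (subst subst2_subst22) (auto simp: z subst2_mult subst2_power subst2_add power_mult)
    also have "\<dots> = 0"
      unfolding G(8) using w by (simp add: subst2_mult z)
    finally have "subst2 F (fps_X ^ (n * q), b) = 0" .
    moreover have "fps_nth b 0 = 0"
      using z1 \<phi>(2) by (simp add: b_def)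
    moreover have "fps_conv_radius b > 0"
    proof -
      have "convergent2 (fps_const (fps_X ^ (n * p)) * (const2 c + fps_const w) + fps_const (\<phi> oo fps_X ^ (n * q)))"
        using w G \<phi> by (intro convergent2_add convergent2_mult)
          (auto simp: convergent2_fps_const z intro!: fps_conv_radius_compose)
      then show ?thesis by (simp add: b_def flip: convergent2_fps_const)
    qed
    ultimately show ?thesis using w(1) G(2) by (intro exI[of _ "n * q"]) auto
  qed
qed

section \<open>Factorization of an irreducible series over its Puiseux roots\<close>

lemma divide_root:
  assumes G: "convergent2 G" and b: "fps_conv_radius b > 0" "fps_nth b 0 = 0"
    and root: "subst2 G (fps_X, b) = 0"
  obtains G' where "convergent2 G'" "G = (var_y - fps_const b) * G'"
proof -
  define S where "S = subst22 G (var_x, var_y + fps_const b)"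
  have mi: "max_ideal (var_y + fps_const b)" "max_ideal (var_y - fps_const b)" using b by auto
  have cb: "convergent2 (var_y + fps_const b)" "convergent2 (var_y - fps_const b)"
    using b by (auto simp: convergent2_fps_const intro: convergent2_add convergent2_diff)
  have S: "convergent2 S" unfolding S_def using G mi cb by (intro convergent2_subst22) auto
  have "fps_nth S 0 = subst2 S (fps_X, 0)" by (simp add: subst2_fps_X_0)
  also have "\<dots> = subst2 G (fps_X, b)"
    unfolding S_def using mi by (subst subst2_subst22) (simp_all add: subst2_add subst2_fps_const)
  finally have S0: "fps_nth S 0 = 0" using root by simp
  define S1 :: fps2 where "S1 = fps_shift 1 S"
  have S1: "S = var_y * S1"
    using S0 by (intro fps_ext) (auto simp: S1_def var_y_def fps_X_mult_nth)
  have "convergent2 S1"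
  proof (rule convergent2_coeff_shift[OF S, of 1 _ 0 1])
    show "norm (coeff2 S1 i j) \<le> 1 * 2 ^ (i + j) * norm (coeff2 S (i + 0) (j + 1))" for i j
      using mult_right_mono[of 1 "2 ^ (i + j)" "norm (coeff2 S i (j + 1))"]
      by (simp add: S1_def coeff2_def)
  qed simp
  then have "convergent2 (subst22 S1 (var_x, var_y - fps_const b))"
    using mi cb by (intro convergent2_subst22) auto
  moreover have "G = (var_y - fps_const b) * subst22 S1 (var_x, var_y - fps_const b)"
  proof -
    have "subst22 S (var_x, var_y - fps_const b) = subst22 G (var_x, (var_y - fps_const b) + fps_const b)"
      unfolding S_def using mi by (subst subst22_assoc) (simp_all add: subst22_add subst22_fps_const_var_x)
    also have "\<dots> = G" by simp
    finally show ?thesis using mi by (simp add: S1 subst22_mult)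
  qed
  ultimately show thesis by (rule that)
qed

text \<open>The series form an integral domain, so a further root, at which none of the linear
  factors already split off vanishes, is a root of the cofactor.\<close>

lemma divide_roots:
  assumes "finite A" "convergent2 G"
    and B: "\<And>z. z \<in> A \<Longrightarrow> fps_conv_radius (B z) > 0" "\<And>z. z \<in> A \<Longrightarrow> fps_nth (B z) 0 = 0"
    and inj: "inj_on B A" and root: "\<And>z. z \<in> A \<Longrightarrow> subst2 G (fps_X, B z) = 0"
  shows "\<exists>G'. convergent2 G' \<and> G = (\<Prod>z\<in>A. var_y - fps_const (B z)) * G'"
  using assms(1) B inj root
proof (induction A rule: finite_induct)
  case empty
  then show ?case using assms(2) by auto
next
  case (insert z A)
  then obtain G' where G': "convergent2 G'" "G = (\<Prod>z\<in>A. var_y - fps_const (B z)) * G'"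
    by (auto simp: inj_on_def)
  have Bz: "fps_conv_radius (B z) > 0" "fps_nth (B z) 0 = 0" using insert.prems by auto
  have X: "fps_nth (fps_X :: complex fps) 0 = 0" by simp
  have "0 = subst2 G (fps_X, B z)" using insert.prems(4) by simp
  also have "\<dots> = (\<Prod>v\<in>A. B z - B v) * subst2 G' (fps_X, B z)"
    unfolding G'(2) subst2_mult[OF X Bz(2)] subst2_prod[OF X Bz(2)] subst2_diff[OF X Bz(2)]
      subst2_var[OF X Bz(2)] subst2_fps_const by simp
  finally have "(\<Prod>v\<in>A. B z - B v) * subst2 G' (fps_X, B z) = 0" ..
  moreover have "(\<Prod>v\<in>A. B z - B v) \<noteq> 0"
    using insert.hyps insert.prems(3) by (auto simp: prod_zero_iff)
  ultimately have "subst2 G' (fps_X, B z) = 0" by simp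
  then obtain G'' where "convergent2 G''" "G' = (var_y - fps_const (B z)) * G''"
    using divide_root[OF G'(1) Bz] by metis
  then show ?case using insert.hyps G'(2) by (intro exI[of _ G'']) (simp add: mult_ac)
qed

lemma ramify_mult: "n > 0 \<Longrightarrow> ramify n (f * g) = ramify n f * ramify n g"
  unfolding ramify_def by (rule subst22_mult) auto

lemma ramify_inj: "n > 0 \<Longrightarrow> ramify n f = ramify n g \<Longrightarrow> f = g"
proof (rule fps2_eqI)
  fix i j assume *: "n > 0" "ramify n f = ramify n g"
  then have "coeff2 (ramify n f) (n * i) j = coeff2 (ramify n g) (n * i) j" by simp
  then show "coeff2 f i j = coeff2 g i j" using *(1) by (simp add: coeff2_ramify)
qed

lemma rot_ramify:
  assumes "n > 0" "z \<in> roots_unity n"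
  shows "rot z (ramify n f) = ramify n f"
  using assms by (intro fps2_eqI) (auto simp: coeff2_rot coeff2_ramify roots_unity_def power_mult)

text \<open>A root \<open>(t^n, b)\<close> with minimal \<open>n\<close> is taken; minimality makes
  its conjugates distinct. The product of their linear factors divides the ramified
  \<open>F\<close>, is invariant, and descends to a nonunit \<open>p\<close> dividing
  \<open>F\<close>; irreducibility leaves a unit as cofactor.\<close>

lemma irreducible_puiseux:
  assumes F: "irreducible_conv2 F" and ex: "\<exists>j. coeff2 F 0 j \<noteq> 0"
  obtains n b p g where "n > 0" "fps_conv_radius b > 0" "fps_nth b 0 = 0"
    "subst2 F (fps_X ^ n, b) = 0"
    "\<And>z. z \<in> roots_unity n \<Longrightarrow> z \<noteq> 1 \<Longrightarrow> rot1 z b \<noteq> b"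
    "convergent2 p" "ramify n p = (\<Prod>z\<in>roots_unity n. var_y - fps_const (rot1 z b))"
    "unit_conv2 g" "F = p * g"
proof -
  have conv: "convergent2 F" and nonunit: "\<not> unit_conv2 F"
    and irr: "\<And>g h. convergent2 g \<Longrightarrow> convergent2 h \<Longrightarrow> F = g * h \<Longrightarrow> unit_conv2 g \<or> unit_conv2 h"
    using F by (auto simp: irreducible_conv2_def)
  have F00: "coeff2 F 0 0 = 0" using unit_conv2I[OF conv] nonunit by blast
  define d where "d = (LEAST j. coeff2 F 0 j \<noteq> 0)"
  have d: "coeff2 F 0 d \<noteq> 0"
    unfolding d_def by (rule LeastI_ex[OF ex])
  have below: "coeff2 F 0 j = 0" if "j < d" for j
    using not_less_Least[of j "\<lambda>j. coeff2 F 0 j \<noteq> 0"] that unfolding d_def by blast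
  have "d \<noteq> 0"
  proof
    assume "d = 0"
    then show False using d F00 by simp
  qed
  then have "1 \<le> d" by simp
  have "\<exists>n>0. \<exists>b. fps_conv_radius b > 0 \<and> fps_nth b 0 = 0 \<and> subst2 F (fps_X ^ n, b) = 0"
    by (rule puiseux_root[OF conv \<open>1 \<le> d\<close> below d])
  then have ex_n: "\<exists>n. n > 0 \<and> (\<exists>b. fps_conv_radius b > 0 \<and> fps_nth b 0 = 0 \<and> subst2 F (fps_X ^ n, b) = 0)"
    by blast
  define n where "n = (LEAST n. n > 0 \<and> (\<exists>b. fps_conv_radius b > 0 \<and> fps_nth b 0 = 0 \<and> subst2 F (fps_X ^ n, b) = 0))"
  obtain b where n: "n > 0" and b: "fps_conv_radius b > 0" "fps_nth b 0 = 0" "subst2 F (fps_X ^ n, b) = 0"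
    using LeastI_ex[OF ex_n, folded n_def] by blast
  \<comment> \<open>Otherwise \<open>t^n\<close> and \<open>b\<close> are series in
    \<open>t^k\<close>, and replacing \<open>t^k\<close> by \<open>t\<close> gives a root with the
    smaller exponent \<open>n div k\<close>.\<close>
  have distinct: "rot1 z b \<noteq> b" if z: "z \<in> roots_unity n" "z \<noteq> 1" for z
  proof
    assume "rot1 z b = b"
    then obtain k b' where k: "k > 1" "k dvd n" "b = b' oo fps_X ^ k" "fps_conv_radius b' > 0"
      using factor_through_power[OF n z _ b(1)] by metis
    have kn: "n div k > 0" "n div k < n" using k n by (auto simp: div_greater_zero_iff dvd_imp_le)
    have Xk: "fps_nth (fps_X ^ k :: complex fps) 0 = 0" using k by (simp add: fps_X_power_nth)
    have "fps_nth b' 0 = 0" using b(2) k(3) by simp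
    then have "subst2 F (fps_X ^ (n div k), b') oo fps_X ^ k = subst2 F (fps_X ^ n, b)"
      using kn k Xk by (subst subst2_compose[symmetric])
        (auto simp: fps_X_power_compose fps_X_power_nth simp flip: power_mult)
    then have "subst2 F (fps_X ^ (n div k), b') = 0"
      using b(3) Xk k by (simp add: fps_compose_eq_0_iff)
    then have "n \<le> n div k"
      unfolding n_def using kn k(4) \<open>fps_nth b' 0 = 0\<close> by (intro Least_le) (auto simp flip: n_def)
    then show False using kn by simp
  qed
  let ?U = "roots_unity n"
  have U: "finite ?U" using roots_unity_simps[OF n] by simp
  define P where "P = (\<Prod>z\<in>?U. var_y - fps_const (rot1 z b))"
  have rad: "fps_conv_radius (rot1 z b) > 0" for z using fps_conv_radius_rot1 b by blast
  have P: "convergent2 P"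
    unfolding P_def using rad by (intro convergent2_prod convergent2_diff) (auto simp: convergent2_fps_const)
  have Pinv: "rot u P = P" if u: "u \<in> ?U" for u
  proof -
    have "rot u P = (\<Prod>z\<in>?U. var_y - fps_const (rot1 (u * z) b))"
      by (simp add: P_def rot_prod rot_diff rot1_rot1)
    also have "\<dots> = P"
      unfolding P_def by (rule prod.reindex_bij_betw[OF bij_betw_roots_unity[OF n u]])
    finally show ?thesis .
  qed
  obtain p where p: "convergent2 p" "ramify n p = P" using ramify_exists[OF n Pinv P] by metis
  have rF: "convergent2 (ramify n F)"
    unfolding ramify_def using conv n by (intro convergent2_subst22 convergent2_power) auto
  have "\<exists>G'. convergent2 G' \<and> ramify n F = (\<Prod>z\<in>?U. var_y - fps_const (rot1 z b)) * G'"
  proof (rule divide_roots[OF U rF])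
    show "inj_on (\<lambda>z. rot1 z b) ?U"
      by (rule inj_onI) (rule rot1_inj[OF n b(1,2) distinct])
    show "subst2 (ramify n F) (fps_X, rot1 z b) = 0" if "z \<in> ?U" for z
    proof -
      have zX: "fps_nth (fps_const z * fps_X) 0 = 0" by simp
      have "(fps_const z * fps_X) ^ n = fps_X ^ n"
        using that by (simp add: power_mult_distrib fps_const_power roots_unity_def)
      then have "fps_X ^ n oo (fps_const z * fps_X) = fps_X ^ n"
        by (simp add: fps_X_power_compose)
      then have "subst2 F (fps_X ^ n, rot1 z b) = subst2 F (fps_X ^ n, b) oo (fps_const z * fps_X)"
        using n b zX subst2_compose[of "fps_X ^ n" b "fps_const z * fps_X" F]
        by (simp add: rot1_def fps_X_power_nth)
      then show ?thesis using b(2,3) n by (subst subst2_ramify) simp_all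
    qed
  qed (use rad b in auto)
  then obtain G' where G': "convergent2 G'" "ramify n F = P * G'" by (auto simp: P_def)
  have "P \<noteq> 0"
  proof -
    have "var_y - fps_const a \<noteq> 0" for a
    proof
      assume "var_y - fps_const a = 0"
      then have "coeff2 (var_y - fps_const a) 0 1 = 0" by simp
      then show False by (simp add: coeff2_var_y coeff2_fps_const)
    qed
    then show ?thesis using U by (simp add: P_def prod_zero_iff)
  qed
  \<comment> \<open>\<open>P\<close> and the ramified \<open>F\<close> are invariant and
    \<open>P\<close> can be cancelled, so the cofactor is invariant and descends as well.\<close>
  have "rot z G' = G'" if z: "z \<in> ?U" for z
  proof -
    have "P * rot z G' = P * G'"
      using rot_ramify[OF n z, of F] Pinv[OF z] unfolding G'(2) rot_mult by simp
    then show ?thesis by (rule mult_left_cancel[OF \<open>P \<noteq> 0\<close>, THEN iffD1])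
  qed
  then obtain g where g: "convergent2 g" "ramify n g = G'" using ramify_exists[OF n _ G'(1)] by metis
  have Fpg: "F = p * g"
    by (rule ramify_inj[OF n]) (simp add: ramify_mult n p g G'(2))
  have "coeff2 p 0 0 = 0"
  proof -
    have X: "fps_nth (fps_X :: complex fps) 0 = 0" by simp
    have "subst2 P (fps_X, b) = (\<Prod>z\<in>?U. b - rot1 z b)"
      unfolding P_def subst2_prod[OF X b(2)] subst2_diff[OF X b(2)] subst2_var[OF X b(2)] subst2_fps_const
      by simp
    also have "\<dots> = 0"
      using U roots_unity_simps[OF n] by (intro prod_zero) (auto intro!: bexI[of _ 1])
    finally have "fps_nth (subst2 P (fps_X, b)) 0 = 0" by simp
    then show ?thesis
      using n by (simp add: subst2_nth_0 b coeff2_ramify flip: p(2))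
  qed
  then have "\<not> unit_conv2 p" using unit_conv2_coeff by blast
  then have "unit_conv2 g" using irr[OF p(1) g(1) Fpg] by blast
  moreover have "ramify n p = (\<Prod>z\<in>?U. var_y - fps_const (rot1 z b))"
    using p(2) by (simp only: P_def)
  ultimately show thesis
    by (intro that[of n b p g] n b distinct p(1) Fpg)
qed

section \<open>Germs of curves and local inverses\<close>

definition curve :: "complex fps \<times> complex fps \<Rightarrow> complex \<Rightarrow> complex \<times> complex" where
  "curve \<alpha> t = (eval_fps (fst \<alpha>) t, eval_fps (snd \<alpha>) t)"

lemma curve_pair: "curve (a, b) t = (eval_fps a t, eval_fps b t)"
  by (simp add: curve_def)

definition parametric_pair :: "complex fps \<times> complex fps \<Rightarrow> bool" where
  "parametric_pair \<alpha> \<longleftrightarrow> fps_conv_radius (fst \<alpha>) > 0 \<and> fps_conv_radius (snd \<alpha>) > 0 \<and>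
     fps_nth (fst \<alpha>) 0 = 0 \<and> fps_nth (snd \<alpha>) 0 = 0"

lemma parametric_pair_simp:
  "parametric_pair (a, b) \<longleftrightarrow> fps_conv_radius a > 0 \<and> fps_conv_radius b > 0 \<and> fps_nth a 0 = 0 \<and> fps_nth b 0 = 0"
  by (simp add: parametric_pair_def)

lemma parametrization_iff:
  "parametrization \<alpha> \<Gamma> \<longleftrightarrow> parametric_pair \<alpha> \<and>
     (\<exists>e>0. \<forall>\<delta>. 0 < \<delta> \<and> \<delta> < e \<longrightarrow> germ_of (curve \<alpha> ` ball 0 \<delta>) = \<Gamma>)"
  unfolding parametrization_def parametric_pair_def curve_def[abs_def] eventually_at_right_field by auto

lemma irreducible_parametrization_iff:
  "irreducible_parametrization \<alpha> \<Gamma> \<longleftrightarrow> parametrization \<alpha> \<Gamma> \<and> irreducible_pair \<alpha>"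
  unfolding irreducible_parametrization_def irreducible_pair_def by (rule refl)

lemma germ_of_eq_iff: "germ_of A = germ_of B \<longleftrightarrow> (\<forall>\<^sub>F p in nhds 0. p \<in> A \<longleftrightarrow> p \<in> B)"
  by (simp add: plane_germ.abs_eq_iff germ_eq_def)

lemma obtain_germ_rep:
  obtains A where "\<Gamma> = germ_of A"
  using Quotient_abs_rep[OF Quotient_plane_germ, of \<Gamma>] by metis

lemma curve_tendsto_0: "parametric_pair \<alpha> \<Longrightarrow> (curve \<alpha> \<longlongrightarrow> 0) (nhds 0)"
  using tendsto_Pair[OF eval_fps_tendsto_0 eval_fps_tendsto_0, of "fst \<alpha>" "snd \<alpha>"]
  by (simp add: parametric_pair_def curve_def[abs_def] zero_prod_def)

lemma eventually_nhds_0_ball: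
  "eventually P (nhds (0 :: 'a :: real_normed_vector)) \<longleftrightarrow> (\<exists>e>0. \<forall>x. norm x < e \<longrightarrow> P x)"
  by (simp add: eventually_nhds_metric)

text \<open>Inverse germs of maps that may be arbitrary away from the origin. Limits along
  \<open>nhds 0\<close> rather than \<open>at 0\<close> include the value at the origin.\<close>

definition local_inverse ::
    "(complex \<times> complex \<Rightarrow> complex \<times> complex) \<Rightarrow> (complex \<times> complex \<Rightarrow> complex \<times> complex) \<Rightarrow> bool" where
  "local_inverse F G \<longleftrightarrow> (F \<longlongrightarrow> 0) (nhds 0) \<and> (G \<longlongrightarrow> 0) (nhds 0) \<and>
     (\<forall>\<^sub>F p in nhds 0. G (F p) = p) \<and> (\<forall>\<^sub>F p in nhds 0. F (G p) = p)"

lemma local_inverse_sym: "local_inverse F G \<Longrightarrow> local_inverse G F"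
  by (simp add: local_inverse_def)

text \<open>Near the origin the image of a small piece of \<open>A\<close> is the preimage of
  \<open>A\<close> under \<open>G\<close>, which no longer depends on the size of the piece. The
  radius \<open>e\<close> keeps \<open>F\<close> injective on the piece.\<close>

lemma maps_germ_iff:
  assumes FG: "local_inverse F G"
  shows "maps_germ F (germ_of A) (germ_of B) \<longleftrightarrow> (\<forall>\<^sub>F p in nhds 0. p \<in> A \<longleftrightarrow> F p \<in> B)"
proof -
  have F: "(F \<longlongrightarrow> 0) (nhds 0)" and G: "(G \<longlongrightarrow> 0) (nhds 0)"
    and GF: "\<forall>\<^sub>F p in nhds 0. G (F p) = p" and FG: "\<forall>\<^sub>F p in nhds 0. F (G p) = p"
    using FG by (auto simp: local_inverse_def)
  obtain e where e: "e > 0" "\<And>p. norm p < e \<Longrightarrow> G (F p) = p"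
    using GF unfolding eventually_nhds_0_ball by blast
  have image: "\<forall>\<^sub>F q in nhds 0. q \<in> F ` (A \<inter> ball 0 \<delta>) \<longleftrightarrow> G q \<in> A" if \<delta>: "0 < \<delta>" "\<delta> < e" for \<delta>
  proof -
    have "\<forall>\<^sub>F q in nhds 0. G q \<in> ball 0 \<delta>"
      using G by (rule topological_tendstoD) (use \<delta> in auto)
    with FG show ?thesis
    proof eventually_elim
      case (elim q)
      show ?case
      proof
        assume "q \<in> F ` (A \<inter> ball 0 \<delta>)"
        then obtain p where p: "q = F p" "p \<in> A" "norm p < \<delta>" by auto
        then have "G q = p" using e(2)[of p] \<delta> by simp
        then show "G q \<in> A" using p by simp
      next
        assume "G q \<in> A"
        then show "q \<in> F ` (A \<inter> ball 0 \<delta>)"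
          using elim by (intro image_eqI[of _ _ "G q"]) auto
      qed
    qed
  qed
  have germ: "germ_eq (F ` (A \<inter> ball 0 \<delta>)) B \<longleftrightarrow> (\<forall>\<^sub>F q in nhds 0. G q \<in> A \<longleftrightarrow> q \<in> B)"
    if "0 < \<delta>" "\<delta> < e" for \<delta>
    unfolding germ_eq_def
    by (rule eventually_subst, rule eventually_mono[OF image[OF that]]) auto
  have "maps_germ F (germ_of A) (germ_of B) \<longleftrightarrow> (\<forall>\<^sub>F q in nhds 0. G q \<in> A \<longleftrightarrow> q \<in> B)"
  proof
    assume "maps_germ F (germ_of A) (germ_of B)"
    then obtain d where "d > 0" "\<And>\<delta>. \<delta> > 0 \<Longrightarrow> \<delta> < d \<Longrightarrow> germ_eq (F ` (A \<inter> ball 0 \<delta>)) B"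
      unfolding maps_germ.abs_eq eventually_at_right_field by blast
    then have "germ_eq (F ` (A \<inter> ball 0 (min d e / 2))) B" using e(1) by auto
    then show "\<forall>\<^sub>F q in nhds 0. G q \<in> A \<longleftrightarrow> q \<in> B"
      using germ[of "min d e / 2"] \<open>d > 0\<close> e(1) by auto
  next
    assume "\<forall>\<^sub>F q in nhds 0. G q \<in> A \<longleftrightarrow> q \<in> B"
    then show "maps_germ F (germ_of A) (germ_of B)"
      unfolding maps_germ.abs_eq eventually_at_right_field using germ e(1) by blast
  qed
  also have "\<dots> \<longleftrightarrow> (\<forall>\<^sub>F p in nhds 0. p \<in> A \<longleftrightarrow> F p \<in> B)"
  proof
    assume "\<forall>\<^sub>F q in nhds 0. G q \<in> A \<longleftrightarrow> q \<in> B"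
    from eventually_compose_filterlim[OF this F] GF
    show "\<forall>\<^sub>F p in nhds 0. p \<in> A \<longleftrightarrow> F p \<in> B" by eventually_elim auto
  next
    assume "\<forall>\<^sub>F p in nhds 0. p \<in> A \<longleftrightarrow> F p \<in> B"
    from eventually_compose_filterlim[OF this G] FG
    show "\<forall>\<^sub>F q in nhds 0. G q \<in> A \<longleftrightarrow> q \<in> B" by eventually_elim auto
  qed
  finally show ?thesis .
qed

lemma maps_germ_inverse:
  assumes FG: "local_inverse F G" and "maps_germ F \<Gamma>1 \<Gamma>2"
  shows "maps_germ G \<Gamma>2 \<Gamma>1"
proof -
  obtain A B where AB: "\<Gamma>1 = germ_of A" "\<Gamma>2 = germ_of B" using obtain_germ_rep by metis
  have "\<forall>\<^sub>F p in nhds 0. p \<in> A \<longleftrightarrow> F p \<in> B" using assms AB by (simp add: maps_germ_iff)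
  moreover have "(G \<longlongrightarrow> 0) (nhds 0)" "\<forall>\<^sub>F p in nhds 0. F (G p) = p"
    using FG by (auto simp: local_inverse_def)
  ultimately have "\<forall>\<^sub>F q in nhds 0. q \<in> B \<longleftrightarrow> G q \<in> A"
    using eventually_compose_filterlim[of "\<lambda>p. p \<in> A \<longleftrightarrow> F p \<in> B" "nhds 0" G "nhds 0"]
    by (auto elim: eventually_elim2)
  then show ?thesis using maps_germ_iff[OF local_inverse_sym[OF FG]] AB by simp
qed

definition comp_map :: "fps2 \<times> fps2 \<Rightarrow> complex fps \<times> complex fps \<Rightarrow> complex fps \<times> complex fps" where
  "comp_map \<phi> \<alpha> = (subst2 (fst \<phi>) \<alpha>, subst2 (snd \<phi>) \<alpha>)"

lemma parametric_pair_comp_map: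
  assumes "holomorphic_map_germ \<phi>" "parametric_pair \<alpha>"
  shows "parametric_pair (comp_map \<phi> \<alpha>)"
  using assms subst2_nth_0[of "fst \<alpha>" "snd \<alpha>"]
    fps_conv_radius_subst2[of "fst \<phi>" "fst \<alpha>" "snd \<alpha>"] fps_conv_radius_subst2[of "snd \<phi>" "fst \<alpha>" "snd \<alpha>"]
  by (simp add: parametric_pair_def comp_map_def holomorphic_map_germ_def)

lemma curve_comp_map:
  assumes "holomorphic_map_germ \<phi>" "parametric_pair \<alpha>"
  shows "\<forall>\<^sub>F t in nhds 0. curve (comp_map \<phi> \<alpha>) t = eval_map \<phi> (curve \<alpha> t)"
proof -
  have "\<forall>\<^sub>F t in nhds 0. eval_fps (subst2 f (fst \<alpha>, snd \<alpha>)) t = eval2 f (curve \<alpha> t)" if "convergent2 f" for f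
    unfolding curve_def using assms(2) that by (intro eval_fps_subst2) (auto simp: parametric_pair_def)
  then have "\<forall>\<^sub>F t in nhds 0. eval_fps (subst2 (fst \<phi>) \<alpha>) t = eval2 (fst \<phi>) (curve \<alpha> t)"
    "\<forall>\<^sub>F t in nhds 0. eval_fps (subst2 (snd \<phi>) \<alpha>) t = eval2 (snd \<phi>) (curve \<alpha> t)"
    using assms(1) by (auto simp: holomorphic_map_germ_def)
  then show ?thesis
    by eventually_elim (simp add: curve_pair comp_map_def eval_map_def)
qed

lemma curve_image:
  assumes \<phi>: "holomorphic_map_germ \<phi>" and FG: "local_inverse (eval_map \<phi>) G" and \<alpha>: "parametric_pair \<alpha>"
  obtains e where "e > 0" "\<And>\<delta>. 0 < \<delta> \<Longrightarrow> \<delta> < e \<Longrightarrow>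
    \<forall>\<^sub>F p in nhds 0. p \<in> curve \<alpha> ` ball 0 \<delta> \<longleftrightarrow> eval_map \<phi> p \<in> curve (comp_map \<phi> \<alpha>) ` ball 0 \<delta>"
proof -
  have GF: "\<forall>\<^sub>F p in nhds 0. G (eval_map \<phi> p) = p" using FG by (simp add: local_inverse_def)
  have "\<forall>\<^sub>F t in nhds 0. G (eval_map \<phi> (curve \<alpha> t)) = curve \<alpha> t"
    by (rule eventually_compose_filterlim[OF GF curve_tendsto_0[OF \<alpha>]])
  with curve_comp_map[OF \<phi> \<alpha>]
  have "\<forall>\<^sub>F t in nhds 0. curve (comp_map \<phi> \<alpha>) t = eval_map \<phi> (curve \<alpha> t) \<and>
      G (eval_map \<phi> (curve \<alpha> t)) = curve \<alpha> t"
    by eventually_elim simp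
  then obtain e where e: "e > 0" "\<And>t. norm t < e \<Longrightarrow> curve (comp_map \<phi> \<alpha>) t = eval_map \<phi> (curve \<alpha> t) \<and>
      G (eval_map \<phi> (curve \<alpha> t)) = curve \<alpha> t"
    unfolding eventually_nhds_0_ball by blast
  have "\<forall>\<^sub>F p in nhds 0. p \<in> curve \<alpha> ` ball 0 \<delta> \<longleftrightarrow> eval_map \<phi> p \<in> curve (comp_map \<phi> \<alpha>) ` ball 0 \<delta>"
    if \<delta>: "0 < \<delta>" "\<delta> < e" for \<delta>
    using GF
  proof eventually_elim
    case (elim p)
    show ?case
    proof
      assume "p \<in> curve \<alpha> ` ball 0 \<delta>"
      then obtain t where t: "norm t < \<delta>" "p = curve \<alpha> t" by auto
      then show "eval_map \<phi> p \<in> curve (comp_map \<phi> \<alpha>) ` ball 0 \<delta>"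
        using e(2)[of t] \<delta> by (intro image_eqI[of _ _ t]) auto
    next
      assume "eval_map \<phi> p \<in> curve (comp_map \<phi> \<alpha>) ` ball 0 \<delta>"
      then obtain t where t: "norm t < \<delta>" "eval_map \<phi> p = curve (comp_map \<phi> \<alpha>) t" by auto
      then have "p = curve \<alpha> t" using e(2)[of t] \<delta> elim by simp
      then show "p \<in> curve \<alpha> ` ball 0 \<delta>" using t(1) by auto
    qed
  qed
  then show thesis using that e(1) by blast
qed

text \<open>The bridge from sets to series: \<open>\<phi> \<circ> \<alpha>\<close> traces an image
  of \<open>\<Gamma>1\<close>, and the image of a germ under a locally invertible map is
  unique.\<close>

lemma maps_germ_parametrization:
  assumes \<phi>: "holomorphic_map_germ \<phi>" and FG: "local_inverse (eval_map \<phi>) G"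
    and \<alpha>: "parametrization \<alpha> \<Gamma>1"
  shows "maps_germ (eval_map \<phi>) \<Gamma>1 \<Gamma>2 \<longleftrightarrow> parametrization (comp_map \<phi> \<alpha>) \<Gamma>2"
proof -
  have pp: "parametric_pair \<alpha>" using \<alpha> by (simp add: parametrization_iff)
  let ?\<beta> = "comp_map \<phi> \<alpha>"
  obtain e1 where e1: "e1 > 0" "\<And>\<delta>. 0 < \<delta> \<Longrightarrow> \<delta> < e1 \<Longrightarrow>
    \<forall>\<^sub>F p in nhds 0. p \<in> curve \<alpha> ` ball 0 \<delta> \<longleftrightarrow> eval_map \<phi> p \<in> curve ?\<beta> ` ball 0 \<delta>"
    by (rule curve_image[OF \<phi> FG pp]) blast
  obtain e2 where e2: "e2 > 0" "\<And>\<delta>. 0 < \<delta> \<Longrightarrow> \<delta> < e2 \<Longrightarrow> germ_of (curve \<alpha> ` ball 0 \<delta>) = \<Gamma>1"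
    using \<alpha> unfolding parametrization_iff by blast
  have m: "maps_germ (eval_map \<phi>) \<Gamma>1 (germ_of (curve ?\<beta> ` ball 0 \<delta>))" if "0 < \<delta>" "\<delta> < min e1 e2" for \<delta>
    using that e1(2)[of \<delta>] e2(2)[of \<delta>] maps_germ_iff[OF FG, of "curve \<alpha> ` ball 0 \<delta>" "curve ?\<beta> ` ball 0 \<delta>"]
    by simp
  have unique: "\<Gamma> = \<Gamma>'" if \<Gamma>: "maps_germ (eval_map \<phi>) \<Gamma>1 \<Gamma>" "maps_germ (eval_map \<phi>) \<Gamma>1 \<Gamma>'" for \<Gamma> \<Gamma>'
  proof -
    obtain A B B' where AB: "\<Gamma>1 = germ_of A" "\<Gamma> = germ_of B" "\<Gamma>' = germ_of B'" using obtain_germ_rep by metis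
    have "\<forall>\<^sub>F p in nhds 0. p \<in> A \<longleftrightarrow> eval_map \<phi> p \<in> B" "\<forall>\<^sub>F p in nhds 0. p \<in> A \<longleftrightarrow> eval_map \<phi> p \<in> B'"
      using \<Gamma> AB maps_germ_iff[OF FG] by auto
    then have BB': "\<forall>\<^sub>F p in nhds 0. eval_map \<phi> p \<in> B \<longleftrightarrow> eval_map \<phi> p \<in> B'"
      by eventually_elim auto
    have G: "(G \<longlongrightarrow> 0) (nhds 0)" and FG': "\<forall>\<^sub>F p in nhds 0. eval_map \<phi> (G p) = p"
      using FG by (auto simp: local_inverse_def)
    from eventually_compose_filterlim[OF BB' G] FG' have "\<forall>\<^sub>F q in nhds 0. q \<in> B \<longleftrightarrow> q \<in> B'" by eventually_elim simp
    then show ?thesis by (simp add: AB germ_of_eq_iff)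
  qed
  show ?thesis
  proof
    assume "maps_germ (eval_map \<phi>) \<Gamma>1 \<Gamma>2"
    then have "germ_of (curve ?\<beta> ` ball 0 \<delta>) = \<Gamma>2" if "0 < \<delta>" "\<delta> < min e1 e2" for \<delta>
      using unique m[OF that] by blast
    moreover have "min e1 e2 > 0" using e1(1) e2(1) by simp
    ultimately show "parametrization ?\<beta> \<Gamma>2"
      unfolding parametrization_iff using parametric_pair_comp_map[OF \<phi> pp] by blast
  next
    assume "parametrization ?\<beta> \<Gamma>2"
    then obtain e3 where e3: "e3 > 0" "\<And>\<delta>. 0 < \<delta> \<Longrightarrow> \<delta> < e3 \<Longrightarrow> germ_of (curve ?\<beta> ` ball 0 \<delta>) = \<Gamma>2"
      unfolding parametrization_iff by blast
    define \<delta> where "\<delta> = min e3 (min e1 e2) / 2"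
    have "0 < \<delta>" "\<delta> < min e1 e2" "\<delta> < e3" using e1(1) e2(1) e3(1) by (auto simp: \<delta>_def)
    then show "maps_germ (eval_map \<phi>) \<Gamma>1 \<Gamma>2" using m e3(2) by metis
  qed
qed

text \<open>The image of a small disc under the new curve lies between the images under
  \<open>curve \<beta>\<close> of two discs, of radii \<open>l\<close> and \<open>e / 2\<close>,
  which both represent \<open>\<Gamma>\<close>. The inclusion from below uses the convergent inverse
  of \<open>\<rho>\<close>.\<close>

lemma parametrization_reparametrize:
  assumes \<beta>: "parametrization \<beta> \<Gamma>" and \<rho>: "fps_conv_radius \<rho> > 0" "fps_nth \<rho> 0 = 0" "fps_nth \<rho> 1 \<noteq> 0"
  shows "parametrization (fst \<beta> oo \<rho>, snd \<beta> oo \<rho>) \<Gamma>"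
proof -
  let ?\<gamma> = "(fst \<beta> oo \<rho>, snd \<beta> oo \<rho>)"
  have pp: "parametric_pair \<beta>" using \<beta> by (simp add: parametrization_iff)
  have pp': "parametric_pair ?\<gamma>"
    using pp \<rho> by (simp add: parametric_pair_def fps_conv_radius_compose)
  obtain \<sigma> where \<sigma>: "fps_conv_radius \<sigma> > 0" "fps_nth \<sigma> 0 = 0" "\<rho> oo \<sigma> = fps_X"
    using convergent_compositional_inverse[OF \<rho>] by metis
  obtain e where e: "e > 0" "\<And>\<delta>. 0 < \<delta> \<Longrightarrow> \<delta> < e \<Longrightarrow> germ_of (curve \<beta> ` ball 0 \<delta>) = \<Gamma>"
    using \<beta> unfolding parametrization_iff by blast
  have "\<forall>\<^sub>F t in nhds 0. eval_fps (fst \<beta> oo \<rho>) t = eval_fps (fst \<beta>) (eval_fps \<rho> t)"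
    "\<forall>\<^sub>F t in nhds 0. eval_fps (snd \<beta> oo \<rho>) t = eval_fps (snd \<beta>) (eval_fps \<rho> t)"
    using pp \<rho> by (auto simp: parametric_pair_def intro!: eval_fps_compose)
  then have c: "\<forall>\<^sub>F t in nhds 0. curve ?\<gamma> t = curve \<beta> (eval_fps \<rho> t)"
    by eventually_elim (simp add: curve_def)
  have "\<forall>\<^sub>F t in nhds 0. eval_fps \<rho> t \<in> ball 0 (e / 2)"
    using eval_fps_tendsto_0[OF \<rho>(1,2)] by (rule topological_tendstoD) (use e in auto)
  with c have "\<forall>\<^sub>F t in nhds 0. curve ?\<gamma> t = curve \<beta> (eval_fps \<rho> t) \<and> norm (eval_fps \<rho> t) < e / 2"
    by eventually_elim simp
  then obtain d where d: "d > 0"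
    "\<And>t. norm t < d \<Longrightarrow> curve ?\<gamma> t = curve \<beta> (eval_fps \<rho> t) \<and> norm (eval_fps \<rho> t) < e / 2"
    unfolding eventually_nhds_0_ball by blast
  have inv: "\<forall>\<^sub>F s in nhds 0. eval_fps \<rho> (eval_fps \<sigma> s) = s"
    using eval_fps_compose[OF \<rho>(1) \<sigma>(1,2)] by eventually_elim (simp add: \<sigma>(3))
  have "germ_of (curve ?\<gamma> ` ball 0 \<delta>) = \<Gamma>" if \<delta>: "0 < \<delta>" "\<delta> < d" for \<delta>
  proof -
    have "\<forall>\<^sub>F s in nhds 0. eval_fps \<sigma> s \<in> ball 0 \<delta>"
      using eval_fps_tendsto_0[OF \<sigma>(1,2)] by (rule topological_tendstoD) (use \<delta> in auto)
    with inv have "\<forall>\<^sub>F s in nhds 0. eval_fps \<rho> (eval_fps \<sigma> s) = s \<and> norm (eval_fps \<sigma> s) < \<delta>"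
      by eventually_elim simp
    then obtain k where k: "k > 0" "\<And>s. norm s < k \<Longrightarrow> eval_fps \<rho> (eval_fps \<sigma> s) = s \<and> norm (eval_fps \<sigma> s) < \<delta>"
      unfolding eventually_nhds_0_ball by blast
    define l where "l = min k e / 2"
    have l: "0 < l" "l < k" "l < e" using k e by (auto simp: l_def)
    have sub1: "curve \<beta> ` ball 0 l \<subseteq> curve ?\<gamma> ` ball 0 \<delta>"
    proof
      fix p assume "p \<in> curve \<beta> ` ball 0 l"
      then obtain s where s: "norm s < l" "p = curve \<beta> s" by auto
      then have "p = curve ?\<gamma> (eval_fps \<sigma> s)" "norm (eval_fps \<sigma> s) < \<delta>"
        using k(2)[of s] d(2)[of "eval_fps \<sigma> s"] l \<delta> by auto
      then show "p \<in> curve ?\<gamma> ` ball 0 \<delta>" by auto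
    qed
    have sub2: "curve ?\<gamma> ` ball 0 \<delta> \<subseteq> curve \<beta> ` ball 0 (e / 2)"
      using d(2) \<delta> by force
    have "germ_of (curve \<beta> ` ball 0 l) = germ_of (curve \<beta> ` ball 0 (e / 2))"
      using e(2)[of l] e(2)[of "e / 2"] l e(1) by simp
    then have "\<forall>\<^sub>F p in nhds 0. p \<in> curve ?\<gamma> ` ball 0 \<delta> \<longleftrightarrow> p \<in> curve \<beta> ` ball 0 l"
      unfolding germ_of_eq_iff by eventually_elim (use sub1 sub2 in blast)
    then have "germ_of (curve ?\<gamma> ` ball 0 \<delta>) = germ_of (curve \<beta> ` ball 0 l)"
      by (simp only: germ_of_eq_iff)
    then show ?thesis using e(2)[of l] l by simp
  qed
  then show ?thesis unfolding parametrization_iff using pp' d(1) by blast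
qed

lemma subst2_eq_0_if_parametrization:
  assumes \<alpha>: "parametrization \<alpha> (germ_of {p. eval2 F p = 0})" and F: "convergent2 F"
  shows "subst2 F \<alpha> = 0"
proof -
  have pp: "parametric_pair \<alpha>" using \<alpha> by (simp add: parametrization_iff)
  obtain e where e: "e > 0" "\<And>\<delta>. 0 < \<delta> \<Longrightarrow> \<delta> < e \<Longrightarrow> germ_of (curve \<alpha> ` ball 0 \<delta>) = germ_of {p. eval2 F p = 0}"
    using \<alpha> unfolding parametrization_iff by blast
  have "\<forall>\<^sub>F p in nhds 0. p \<in> curve \<alpha> ` ball 0 (e / 2) \<longleftrightarrow> p \<in> {p. eval2 F p = 0}"
    using e(2)[of "e / 2"] e(1) by (simp only: germ_of_eq_iff)
  from eventually_compose_filterlim[OF this curve_tendsto_0[OF pp]]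
  have 1: "\<forall>\<^sub>F t in nhds 0. curve \<alpha> t \<in> curve \<alpha> ` ball 0 (e / 2) \<longleftrightarrow> eval2 F (curve \<alpha> t) = 0"
    by simp
  have 2: "\<forall>\<^sub>F t in nhds 0. (t :: complex) \<in> ball 0 (e / 2)"
    using e(1) by (intro eventually_nhds_in_open) auto
  have 3: "\<forall>\<^sub>F t in nhds 0. eval_fps (subst2 F (fst \<alpha>, snd \<alpha>)) t = eval2 F (curve \<alpha> t)"
    unfolding curve_def using pp F by (intro eval_fps_subst2) (auto simp: parametric_pair_def)
  from 1 2 3 have "\<forall>\<^sub>F t in nhds 0. eval_fps (subst2 F \<alpha>) t = eval_fps 0 t"
    by eventually_elim auto
  then show ?thesis
    using pp F fps_conv_radius_subst2[of F "fst \<alpha>" "snd \<alpha>"]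
    by (intro fps_eqI_eventually) (auto simp: parametric_pair_def)
qed

lemma zero_set_if_subst2_eq_0:
  assumes \<beta>: "parametrization \<beta> (germ_of B)" and F: "convergent2 F" and 0: "subst2 F \<beta> = 0"
  shows "\<forall>\<^sub>F p in nhds 0. p \<in> B \<longrightarrow> eval2 F p = 0"
proof -
  have pp: "parametric_pair \<beta>" using \<beta> by (simp add: parametrization_iff)
  obtain e where e: "e > 0" "\<And>\<delta>. 0 < \<delta> \<Longrightarrow> \<delta> < e \<Longrightarrow> germ_of (curve \<beta> ` ball 0 \<delta>) = germ_of B"
    using \<beta> unfolding parametrization_iff by blast
  have "\<forall>\<^sub>F t in nhds 0. eval_fps (subst2 F (fst \<beta>, snd \<beta>)) t = eval2 F (curve \<beta> t)"
    unfolding curve_def using pp F by (intro eval_fps_subst2) (auto simp: parametric_pair_def)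
  then obtain d where d: "d > 0" "\<And>t. norm t < d \<Longrightarrow> eval2 F (curve \<beta> t) = 0"
    unfolding eventually_nhds_0_ball using 0 by auto
  define \<delta> where "\<delta> = min d e / 2"
  have \<delta>: "0 < \<delta>" "\<delta> < e" "\<delta> < d" using d e by (auto simp: \<delta>_def)
  have "\<forall>\<^sub>F p in nhds 0. p \<in> curve \<beta> ` ball 0 \<delta> \<longleftrightarrow> p \<in> B"
    using e(2)[OF \<delta>(1,2)] by (simp only: germ_of_eq_iff)
  then show ?thesis
    by eventually_elim (use d(2) \<delta> in auto)
qed

lemma local_inverse_exp_vf:
  assumes X: "singular_holomorphic_vf X"
  shows "local_inverse (eval_map (exp_vf X)) (eval_map (exp_vf (- X)))"
proof -
  have inv: "\<forall>\<^sub>F p in nhds 0. eval_map (exp_vf (- Y)) (eval_map (exp_vf Y) p) = p"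
    if Y: "singular_holomorphic_vf Y" for Y
  proof -
    have sY: "singular_formal_vf Y" using Y by (simp add: singular_holomorphic_vf_def)
    have Y': "singular_holomorphic_vf (- Y)"
      using Y by (auto simp: singular_holomorphic_vf_def singular_formal_vf_def)
    have h: "convergent2 (fst (exp_vf Z))" "convergent2 (snd (exp_vf Z))" if "singular_holomorphic_vf Z" for Z
      using holomorphic_map_germ_exp_vf[OF that] by (auto simp: holomorphic_map_germ_def)
    have e: "\<forall>\<^sub>F p in nhds 0. eval2 (subst22 f (fst (exp_vf Y), snd (exp_vf Y))) p = eval2 f (eval_map (exp_vf Y) p)"
      if "convergent2 f" for f
      unfolding eval_map_def using that h[OF Y] max_ideal_exp_vf[OF sY] by (intro eval2_subst22)
    from e[OF h(1)[OF Y']] e[OF h(2)[OF Y']] eval2_var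
    show ?thesis
      by eventually_elim (simp add: eval_map_def[of "exp_vf (- Y)"] exp_vf_uminus[OF sY] prod_eq_iff)
  qed
  have X': "singular_holomorphic_vf (- X)"
    using X by (auto simp: singular_holomorphic_vf_def singular_formal_vf_def)
  show ?thesis
    using inv[OF X] inv[OF X'] eval_map_tendsto_0[OF holomorphic_map_germ_exp_vf[OF X]]
      eval_map_tendsto_0[OF holomorphic_map_germ_exp_vf[OF X']]
    by (simp add: local_inverse_def)
qed

text \<open>A factorization of \<open>exp(X) \<circ> \<alpha>\<close> through
  \<open>\<sigma>\<close> is carried back by the convergent map \<open>exp(-X)\<close> to a
  factorization of \<open>\<alpha>\<close> through the same \<open>\<sigma>\<close>.\<close>

lemma irreducible_pair_exp_vf:
  assumes X: "singular_holomorphic_vf X" and \<alpha>: "parametric_pair \<alpha>" "irreducible_pair \<alpha>"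
  shows "irreducible_pair (comp_map (exp_vf X) \<alpha>)"
  unfolding irreducible_pair_def
proof (intro allI impI, elim conjE)
  fix \<gamma>1 \<gamma>2 \<sigma> :: "complex fps"
  assume r: "fps_conv_radius \<gamma>1 > 0" "fps_conv_radius \<gamma>2 > 0" "fps_conv_radius \<sigma> > 0" "fps_nth \<sigma> 0 = 0"
    and eq: "comp_map (exp_vf X) \<alpha> = (\<gamma>1 oo \<sigma>, \<gamma>2 oo \<sigma>)"
  have sX: "singular_formal_vf X" using X by (simp add: singular_holomorphic_vf_def)
  have X': "singular_holomorphic_vf (- X)"
    using X by (auto simp: singular_holomorphic_vf_def singular_formal_vf_def)
  have z: "fps_nth (fst \<alpha>) 0 = 0" "fps_nth (snd \<alpha>) 0 = 0" using \<alpha> by (auto simp: parametric_pair_def)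
  have pp: "parametric_pair (\<gamma>1 oo \<sigma>, \<gamma>2 oo \<sigma>)"
    using parametric_pair_comp_map[OF holomorphic_map_germ_exp_vf[OF X] \<alpha>(1)] eq by simp
  then have z\<gamma>: "fps_nth \<gamma>1 0 = 0" "fps_nth \<gamma>2 0 = 0" by (auto simp: parametric_pair_simp)
  have pp\<gamma>: "parametric_pair (\<gamma>1, \<gamma>2)" using r z\<gamma> by (simp add: parametric_pair_simp)
  have *: "subst2 (subst22 f (exp_vf X)) \<alpha> = subst2 f (\<gamma>1, \<gamma>2) oo \<sigma>" for f
  proof -
    have "subst2 (subst22 f (fst (exp_vf X), snd (exp_vf X))) (fst \<alpha>, snd \<alpha>) =
        subst2 f (subst2 (fst (exp_vf X)) (fst \<alpha>, snd \<alpha>), subst2 (snd (exp_vf X)) (fst \<alpha>, snd \<alpha>))"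
      using max_ideal_exp_vf[OF sX] z by (intro subst2_subst22)
    also have "\<dots> = subst2 f (\<gamma>1 oo \<sigma>, \<gamma>2 oo \<sigma>)" using eq by (simp add: comp_map_def)
    also have "\<dots> = subst2 f (\<gamma>1, \<gamma>2) oo \<sigma>" using z\<gamma> r by (intro subst2_compose)
    finally show ?thesis by simp
  qed
  have "subst2 var_x (fst \<alpha>, snd \<alpha>) = fst \<alpha>" "subst2 var_y (fst \<alpha>, snd \<alpha>) = snd \<alpha>"
    by (rule subst2_var[OF z])+
  then have "\<alpha> = (subst2 (fst (exp_vf (- X))) (\<gamma>1, \<gamma>2) oo \<sigma>, subst2 (snd (exp_vf (- X))) (\<gamma>1, \<gamma>2) oo \<sigma>)"
    using *[of "fst (exp_vf (- X))"] *[of "snd (exp_vf (- X))"] exp_vf_uminus[OF sX]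
    by (simp add: prod_eq_iff)
  moreover have "parametric_pair (comp_map (exp_vf (- X)) (\<gamma>1, \<gamma>2))"
    by (rule parametric_pair_comp_map[OF holomorphic_map_germ_exp_vf[OF X'] pp\<gamma>])
  ultimately show "fps_nth \<sigma> 1 \<noteq> 0"
    using \<alpha>(2) r unfolding irreducible_pair_def comp_map_def parametric_pair_simp by blast
qed

text \<open>If \<open>\<alpha>\<close> factors through \<open>\<sigma>\<close>, its injectivity near
  0 passes to \<open>\<sigma>\<close>, and an injective holomorphic function has nonzero
  derivative.\<close>

lemma irreducible_pair_if_inj:
  assumes \<alpha>: "parametric_pair \<alpha>" and inj: "e > 0" "inj_on (curve \<alpha>) (ball 0 e)"
  shows "irreducible_pair \<alpha>"
  unfolding irreducible_pair_def
proof (intro allI impI, elim conjE)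
  fix \<gamma>1 \<gamma>2 \<sigma> :: "complex fps"
  assume r: "fps_conv_radius \<gamma>1 > 0" "fps_conv_radius \<gamma>2 > 0" "fps_conv_radius \<sigma> > 0" "fps_nth \<sigma> 0 = 0"
    and eq: "\<alpha> = (\<gamma>1 oo \<sigma>, \<gamma>2 oo \<sigma>)"
  have "\<forall>\<^sub>F t in nhds 0. curve \<alpha> t = curve (\<gamma>1, \<gamma>2) (eval_fps \<sigma> t)"
    using eval_fps_compose[OF r(1,3,4)] eval_fps_compose[OF r(2,3,4)]
    by eventually_elim (simp add: eq curve_def)
  moreover have "\<forall>\<^sub>F t in nhds 0. t \<in> eball 0 (fps_conv_radius \<sigma>)"
    using r by (intro eventually_nhds_in_open) (auto simp: zero_ereal_def)
  ultimately have "\<forall>\<^sub>F t in nhds 0. curve \<alpha> t = curve (\<gamma>1, \<gamma>2) (eval_fps \<sigma> t) \<and> t \<in> eball 0 (fps_conv_radius \<sigma>)"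
    by eventually_elim simp
  then obtain d where d: "d > 0" "\<And>t. norm t < d \<Longrightarrow> curve \<alpha> t = curve (\<gamma>1, \<gamma>2) (eval_fps \<sigma> t) \<and>
      t \<in> eball 0 (fps_conv_radius \<sigma>)"
    unfolding eventually_nhds_0_ball by blast
  let ?B = "ball (0 :: complex) (min d e)"
  have "inj_on (eval_fps \<sigma>) ?B"
  proof (rule inj_onI)
    fix t t' assume t: "t \<in> ?B" "t' \<in> ?B" "eval_fps \<sigma> t = eval_fps \<sigma> t'"
    then have "curve \<alpha> t = curve \<alpha> t'" using d(2)[of t] d(2)[of t'] by simp
    then show "t = t'" using t inj(2) by (auto dest: inj_onD)
  qed
  moreover have "eval_fps \<sigma> holomorphic_on ?B"
    using d(2) by (intro holomorphic_on_eval_fps) auto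
  ultimately have "deriv (eval_fps \<sigma>) 0 \<noteq> 0"
    using d(1) inj(1) by (intro holomorphic_injective_imp_regular[of _ ?B]) auto
  then show "fps_nth \<sigma> 1 \<noteq> 0"
    using fps_nth_conv_deriv[of \<sigma> 1] r(3) by simp
qed

lemma eval_fps_rot1: "eval_fps (rot1 z b) t = eval_fps b (z * t)"
  by (simp add: eval_fps_def power_mult_distrib mult_ac)

lemma unit_conv2_eval:
  assumes "unit_conv2 g"
  shows "\<forall>\<^sub>F p in nhds 0. eval2 g p \<noteq> 0"
proof -
  obtain h where h: "convergent2 g" "convergent2 h" "g * h = 1" using assms by (auto simp: unit_conv2_def)
  have "\<forall>\<^sub>F p in nhds 0. eval2 (fps_const 1) p = eval_fps 1 (fst p)"
    by (rule eval2_fps_const) simp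
  with eval2_mult[OF h(1,2)] show ?thesis
    by eventually_elim (auto simp: h(3))
qed

section \<open>From formal to holomorphic geodesics\<close>

lemma max_ideal_if_irreducible_conv2: "irreducible_conv2 F \<Longrightarrow> max_ideal F"
  unfolding irreducible_conv2_def max_ideal_def using unit_conv2I by blast

text \<open>If \<open>F(0, y) = 0\<close>, then \<open>x\<close> divides \<open>F\<close> and
  irreducibility leaves a unit as cofactor: the branch is the axis \<open>x = 0\<close>, which has
  no Puiseux parametrization over \<open>x\<close>.\<close>

lemma parametrization_vertical:
  assumes F: "irreducible_conv2 F" and 0: "\<And>j. coeff2 F 0 j = 0"
  shows "irreducible_parametrization (0, fps_X) (germ_of {p. eval2 F p = 0})"
proof -
  have conv: "convergent2 F"
    and irr: "\<And>g h. convergent2 g \<Longrightarrow> convergent2 h \<Longrightarrow> F = g * h \<Longrightarrow> unit_conv2 g \<or> unit_conv2 h"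
    using F by (auto simp: irreducible_conv2_def)
  define g where "g = Abs_fps (\<lambda>j. Abs_fps (\<lambda>i. coeff2 F (i + 1) j))"
  have g: "coeff2 g i j = coeff2 F (i + 1) j" for i j by (simp add: g_def)
  have "F = var_x ^ 1 * g"
  proof (rule fps2_eqI)
    fix i j
    show "coeff2 F i j = coeff2 (var_x ^ 1 * g) i j"
      using 0[of j] by (cases "i = 0") (auto simp only: coeff2_var_x_power_mult g, auto)
  qed
  then have Fg: "F = var_x * g" by simp
  have cg: "convergent2 g"
  proof (rule convergent2_coeff_shift[OF conv, of 1 _ 1 0])
    show "norm (coeff2 g i j) \<le> 1 * 2 ^ (i + j) * norm (coeff2 F (i + 1) (j + 0))" for i j
      using mult_right_mono[of 1 "2 ^ (i + j)" "norm (coeff2 F (i + 1) j)"] by (simp add: g)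
  qed simp
  have "\<not> unit_conv2 var_x" using unit_conv2_coeff[of var_x] by (auto simp: coeff2_var_x)
  then have unit: "unit_conv2 g" using irr[OF _ cg Fg] by auto
  from eval2_mult[OF convergent2_var(1) cg] eval2_var(1) unit_conv2_eval[OF unit]
  have zero: "\<forall>\<^sub>F p in nhds 0. eval2 F p = 0 \<longleftrightarrow> fst p = 0"
    by eventually_elim (simp add: Fg)
  have pp: "parametric_pair (0, fps_X)" by (simp add: parametric_pair_simp)
  have "germ_of (curve (0, fps_X) ` ball 0 \<delta>) = germ_of {p. eval2 F p = 0}" if "\<delta> > 0" for \<delta>
  proof -
    have "\<forall>\<^sub>F p in nhds (0 :: complex \<times> complex). p \<in> ball 0 \<delta>"
      using that by (intro eventually_nhds_in_open) auto
    with zero have "\<forall>\<^sub>F p in nhds 0. p \<in> curve (0, fps_X) ` ball 0 \<delta> \<longleftrightarrow> p \<in> {p. eval2 F p = 0}"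
    proof eventually_elim
      case (elim p)
      have "norm (snd p) < \<delta>" using elim(2) norm_snd_le[of "snd p" "fst p"] by simp
      then have "p \<in> curve (0, fps_X) ` ball 0 \<delta> \<longleftrightarrow> fst p = 0"
        by (auto simp: curve_pair image_iff prod_eq_iff)
      then show ?case using elim(1) by simp
    qed
    then show ?thesis by (simp only: germ_of_eq_iff)
  qed
  then have "parametrization (0, fps_X) (germ_of {p. eval2 F p = 0})"
    unfolding parametrization_iff using pp zero_less_one by blast
  moreover have "irreducible_pair (0, fps_X)"
    by (rule irreducible_pair_if_inj[OF pp zero_less_one]) (auto simp: inj_on_def curve_pair)
  ultimately show ?thesis by (simp add: irreducible_parametrization_iff)
qed

text \<open>Up to a unit, \<open>F(t^n, y)\<close> is the product of \<open>y - b(z t)\<close> over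
  the roots of unity \<open>z\<close>, and \<open>(t^n, b(z t))\<close> is the point of the curve
  with parameter \<open>z t\<close>; so the curve of one root covers the zero set. The conjugates
  take distinct values near 0 except at 0 itself, which makes the curve injective and hence
  irreducible.\<close>

lemma parametrization_puiseux:
  assumes F: "irreducible_conv2 F" and ex: "\<exists>j. coeff2 F 0 j \<noteq> 0"
  shows "\<exists>\<alpha>. irreducible_parametrization \<alpha> (germ_of {p. eval2 F p = 0})"
proof -
  obtain n b p g where n: "n > 0" and b: "fps_conv_radius b > 0" "fps_nth b 0 = 0"
    and root: "subst2 F (fps_X ^ n, b) = 0"
    and distinct: "\<And>z. z \<in> roots_unity n \<Longrightarrow> z \<noteq> 1 \<Longrightarrow> rot1 z b \<noteq> b"
    and p: "convergent2 p" "ramify n p = (\<Prod>z\<in>roots_unity n. var_y - fps_const (rot1 z b))"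
    and g: "unit_conv2 g" "F = p * g"
    by (rule irreducible_puiseux[OF F ex]) blast
  have conv: "convergent2 F" using F by (simp add: irreducible_conv2_def)
  have cg: "convergent2 g" using g by (simp add: unit_conv2_def)
  let ?U = "roots_unity n"
  let ?\<alpha> = "(fps_X ^ n, b)"
  have U: "finite ?U" "1 \<in> ?U" using roots_unity_simps[OF n] by auto
  have nU: "norm z = 1" if "z \<in> ?U" for z
  proof -
    have "norm z ^ n = 1" using that by (simp add: roots_unity_def flip: norm_power)
    then show ?thesis using n power_eq_1_iff[of "norm z" n] by auto
  qed
  have pp: "parametric_pair ?\<alpha>" using n b by (simp add: parametric_pair_simp fps_X_power_nth)
  have c\<alpha>: "curve ?\<alpha> t = (t ^ n, eval_fps b t)" for t by (simp add: curve_pair)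
  have same_zero: "\<forall>\<^sub>F q in nhds 0. eval2 F q = 0 \<longleftrightarrow> eval2 p q = 0"
    using eval2_mult[OF p(1) cg] unit_conv2_eval[OF g(1)]
    by eventually_elim (simp add: g(2))
  have rad: "fps_conv_radius (rot1 z b) > 0" for z using fps_conv_radius_rot1 b by blast
  have pe: "\<forall>\<^sub>F q in nhds 0. eval2 p (fst q ^ n, snd q) = (\<Prod>z\<in>?U. snd q - eval_fps b (z * fst q))"
  proof -
    have 1: "\<forall>\<^sub>F q in nhds 0. eval2 (ramify n p) q = eval2 p (eval2 (var_x ^ n) q, eval2 var_y q)"
      unfolding ramify_def using p n by (intro eval2_subst22) auto
    have "var_x ^ n = (fps_const (fps_X ^ n) :: fps2)" by (simp add: var_x_def fps_const_power)
    then have 2: "\<forall>\<^sub>F q in nhds 0. eval2 (var_x ^ n) q = fst q ^ n"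
      using eval2_fps_const[of "fps_X ^ n"] by simp
    have 3: "\<forall>\<^sub>F q in nhds 0. eval2 (ramify n p) q = (\<Prod>z\<in>?U. eval2 (var_y - fps_const (rot1 z b)) q)"
      unfolding p(2) using U rad by (intro eval2_prod convergent2_diff) (auto simp: convergent2_fps_const)
    have "\<forall>\<^sub>F q in nhds 0. eval2 (var_y - fps_const (rot1 z b)) q = snd q - eval_fps b (z * fst q)" for z
    proof -
      have "\<forall>\<^sub>F q in nhds 0. eval2 (var_y - fps_const (rot1 z b) + fps_const (rot1 z b)) q =
          eval2 (var_y - fps_const (rot1 z b)) q + eval2 (fps_const (rot1 z b)) q"
        using rad by (intro eval2_add convergent2_diff) (auto simp: convergent2_fps_const)
      with eval2_fps_const[OF rad[of z]] eval2_var(2) show ?thesis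
        by eventually_elim (simp add: eval_fps_rot1)
    qed
    then have "\<forall>\<^sub>F q in nhds 0. \<forall>z\<in>?U. eval2 (var_y - fps_const (rot1 z b)) q = snd q - eval_fps b (z * fst q)"
      using U by (simp add: eventually_ball_finite_distrib)
    with 1 2 3 eval2_var(2) show ?thesis
      by eventually_elim simp
  qed
  obtain e where e: "e > 0"
    "\<And>q. norm q < e \<Longrightarrow> eval2 p (fst q ^ n, snd q) = (\<Prod>z\<in>?U. snd q - eval_fps b (z * fst q))"
    using pe unfolding eventually_nhds_0_ball by blast
  have "\<forall>\<^sub>F t in nhds 0. eval_fps (subst2 F ?\<alpha>) t = eval2 F (curve ?\<alpha> t)"
    using pp conv unfolding curve_pair parametric_pair_simp by (intro eval_fps_subst2) auto
  then obtain d where d: "d > 0" "\<And>t. norm t < d \<Longrightarrow> eval2 F (curve ?\<alpha> t) = 0"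
    unfolding eventually_nhds_0_ball using root by auto
  have "germ_of (curve ?\<alpha> ` ball 0 \<delta>) = germ_of {q. eval2 F q = 0}" if \<delta>: "0 < \<delta>" "\<delta> < d" for \<delta>
  proof -
    \<comment> \<open>A first coordinate of modulus below \<open>r^n\<close> has an
      \<open>n\<close>-th root \<open>t\<close> of modulus below \<open>r\<close>. This puts
      \<open>(t, snd q)\<close> within the radius \<open>e\<close> of the product formula and the
      parameter \<open>z t\<close> within \<open>\<delta>\<close>.\<close>
    define r where "r = min (e / 2) \<delta>"
    have r: "r > 0" "r \<le> e / 2" "r \<le> \<delta>" using e \<delta> by (auto simp: r_def)
    have "\<forall>\<^sub>F q in nhds (0 :: complex \<times> complex). q \<in> ball 0 (min (r ^ n) (e / 2))"
      using r e by (intro eventually_nhds_in_open) auto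
    with same_zero have "\<forall>\<^sub>F q in nhds 0. q \<in> curve ?\<alpha> ` ball 0 \<delta> \<longleftrightarrow> q \<in> {q. eval2 F q = 0}"
    proof eventually_elim
      case (elim q)
      have q: "norm (fst q) < r ^ n" "norm (snd q) < e / 2"
        using elim(2) norm_fst_le[of "fst q" "snd q"] norm_snd_le[of "snd q" "fst q"] by auto
      have "q \<in> curve ?\<alpha> ` ball 0 \<delta>" if "eval2 F q = 0"
      proof -
        obtain t where t: "t ^ n = fst q"
        proof (cases "fst q = 0")
          case True
          then show ?thesis using that[of 0] n by (simp add: power_0_left)
        next
          case False
          then show ?thesis
            using that[of "exp (Ln (fst q) / of_nat n)"] n by (simp flip: exp_of_nat_mult)
        qed
        have "norm t ^ n < r ^ n" using q(1) t by (simp flip: norm_power)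
        then have nt: "norm t < r" using r(1) power_less_imp_less_base[of "norm t" n r] by simp
        have "norm (t, snd q) < e"
          using norm_Pair_le[of t "snd q"] nt q(2) r(2) by linarith
        then have "(\<Prod>z\<in>?U. snd q - eval_fps b (z * t)) = 0"
          using e(2)[of "(t, snd q)"] that elim(1) by (simp add: t)
        then obtain z where z: "z \<in> ?U" "snd q = eval_fps b (z * t)" using U by auto
        have "q = curve ?\<alpha> (z * t)"
          using z t by (simp add: c\<alpha> prod_eq_iff power_mult_distrib roots_unity_def)
        moreover have "norm (z * t) < \<delta>" using nU[OF z(1)] nt r(3) by (simp add: norm_mult)
        ultimately show ?thesis by auto
      qed
      moreover have "eval2 F q = 0" if "q \<in> curve ?\<alpha> ` ball 0 \<delta>"
        using that d(2) \<delta> by auto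
      ultimately show ?case by auto
    qed
    then show ?thesis by (simp only: germ_of_eq_iff)
  qed
  then have "parametrization ?\<alpha> (germ_of {q. eval2 F q = 0})"
    unfolding parametrization_iff using pp d(1) by blast
  moreover have "irreducible_pair ?\<alpha>"
  proof -
    have "\<forall>\<^sub>F t in nhds 0. \<forall>z\<in>?U - {1}. t \<noteq> 0 \<longrightarrow> eval_fps b (z * t) \<noteq> eval_fps b t"
    proof -
      have "\<forall>\<^sub>F t in nhds 0. t \<noteq> 0 \<longrightarrow> eval_fps b (z * t) \<noteq> eval_fps b t" if z: "z \<in> ?U - {1}" for z
      proof -
        define h where "h = rot1 z b - b"
        have h: "h \<noteq> 0" using distinct z by (auto simp: h_def)
        have "fps_conv_radius h > 0"
          using fps_conv_radius_diff[of "rot1 z b" b] rad[of z] b(1) unfolding h_def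
          by (meson less_le_trans min_less_iff_conj)
        then have "\<forall>\<^sub>F t in at 0. eval_fps h t \<noteq> 0"
          using h has_laurent_expansion_eventually_nonzero_iff'[OF has_laurent_expansion_fps[OF eval_fps_has_fps_expansion[of h]]]
          by simp
        moreover have "\<forall>\<^sub>F t in at 0. eval_fps h t = eval_fps (rot1 z b) t - eval_fps b t"
        proof -
          have "\<forall>\<^sub>F t in nhds 0. t \<in> eball 0 (fps_conv_radius (rot1 z b)) \<inter> eball 0 (fps_conv_radius b)"
            using rad[of z] b by (intro eventually_nhds_in_open) (auto simp: zero_ereal_def)
          then have "\<forall>\<^sub>F t in nhds 0. eval_fps h t = eval_fps (rot1 z b) t - eval_fps b t"
            by eventually_elim (simp add: h_def eval_fps_diff)
          then show ?thesis by (simp add: eventually_at_filter eventually_mono)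
        qed
        ultimately have "\<forall>\<^sub>F t in at 0. eval_fps b (z * t) \<noteq> eval_fps b t"
          by eventually_elim (auto simp: eval_fps_rot1)
        then show ?thesis by (simp add: eventually_at_filter)
      qed
      then show ?thesis using U by (intro eventually_ball_finite) auto
    qed
    then obtain k where k: "k > 0"
      "\<And>t z. norm t < k \<Longrightarrow> z \<in> ?U - {1} \<Longrightarrow> t \<noteq> 0 \<Longrightarrow> eval_fps b (z * t) \<noteq> eval_fps b t"
      unfolding eventually_nhds_0_ball by blast
    have "inj_on (curve ?\<alpha>) (ball 0 k)"
    proof (rule inj_onI)
      fix t t' assume t: "t \<in> ball 0 k" "t' \<in> ball 0 k" "curve ?\<alpha> t = curve ?\<alpha> t'"
      then have eq: "t ^ n = t' ^ n" "eval_fps b t = eval_fps b t'" by (auto simp: c\<alpha>)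
      show "t = t'"
      proof (cases "t = 0")
        case True
        then show ?thesis using eq(1) n by (simp add: power_0_left)
      next
        case False
        have "t' / t \<in> ?U" using False by (simp add: roots_unity_def power_divide flip: eq(1))
        then have "t' / t = 1" using k(2)[of t "t' / t"] t(1) False eq(2) by auto
        then show ?thesis using False by simp
      qed
    qed
    then show ?thesis by (rule irreducible_pair_if_inj[OF pp k(1)])
  qed
  ultimately show ?thesis unfolding irreducible_parametrization_iff by blast
qed

theorem plane_branch_has_irreducible_parametrization:
  assumes "plane_branch \<Gamma>"
  obtains \<alpha> where "irreducible_parametrization \<alpha> \<Gamma>"
  using assms parametrization_vertical parametrization_puiseux unfolding plane_branch_def by metis

text \<open>The difference of the arguments equals a difference of values of \<open>u1\<close> and
  \<open>u2\<close>, which by their order 2 agree to one order more than the arguments do; induction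
  on the order gives equality.\<close>

lemma tangent_to_identity_injective:
  assumes u: "vanish 2 u1" "vanish 2 u2"
    and z: "fps_nth a 0 = 0" "fps_nth b 0 = 0" "fps_nth c 0 = 0" "fps_nth d 0 = 0"
    and eq: "subst2 (var_x + u1) (a, b) = subst2 (var_x + u1) (c, d)"
      "subst2 (var_y + u2) (a, b) = subst2 (var_y + u2) (c, d)"
  shows "a = c \<and> b = d"
proof -
  have 1: "a - c = subst2 u1 (c, d) - subst2 u1 (a, b)"
    using eq(1) z by (simp add: subst2_add algebra_simps)
  have 2: "b - d = subst2 u2 (c, d) - subst2 u2 (a, b)"
    using eq(2) z by (simp add: subst2_add algebra_simps)
  have "agree m a c \<and> agree m b d" for m
  proof (induction m)
    case 0
    show ?case by (simp add: agree_def)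
  next
    case (Suc m)
    then have ag: "agree (Suc m) (subst2 u (c, d)) (subst2 u (a, b))" if "vanish 2 u" for u
      using that z by (intro agree_subst2_Suc) (auto intro: agree_sym)
    have "fps_nth (a - c) k = 0" "fps_nth (b - d) k = 0" if "k < Suc m" for k
      unfolding 1 2 using ag[OF u(1)] ag[OF u(2)] that by (simp_all add: agree_def)
    then show ?case by (simp add: agree_def)
  qed
  then show ?thesis using agree_eqI by blast
qed

text \<open>\<open>Z\<close> is the inverse Jacobian matrix of \<open>f\<close>, written out by
  Cramer's rule, applied to the coefficients of \<open>X\<close> composed with \<open>f\<close>; the
  determinant is 1 at the origin as \<open>f\<close> is tangent to the identity. The relation holds
  for \<open>x\<close> and \<open>y\<close> by construction and extends to monomials by the product
  rule.\<close>

lemma pullback_vf: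
  assumes u: "vanish 2 u1" "vanish 2 u2" "convergent2 u1" "convergent2 u2"
    and X: "singular_holomorphic_vf X"
  defines "f \<equiv> (var_x + u1, var_y + u2)"
  obtains Z where "singular_holomorphic_vf Z"
    "\<And>g. vf_apply Z (subst22 g f) = subst22 (vf_apply X g) f"
proof -
  define f1 where "f1 = var_x + u1"
  define f2 where "f2 = var_y + u2"
  have f: "f = (f1, f2)" by (simp add: f_def f1_def f2_def)
  have "max_ideal u1" "max_ideal u2" using u(1,2) by (auto simp: max_ideal_def vanish_def)
  then have mi: "max_ideal f1" "max_ideal f2" by (auto simp: f1_def f2_def)
  have cf: "convergent2 f1" "convergent2 f2" using u by (auto simp: f1_def f2_def)
  have sX: "singular_formal_vf X" and cX: "convergent2 (fst X)" "convergent2 (snd X)"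
    using X by (auto simp: singular_holomorphic_vf_def)
  have mX: "max_ideal (fst X)" "max_ideal (snd X)" using sX by (auto simp: singular_formal_vf_iff)
  define J where "J = deriv_x f1 * deriv_y f2 - deriv_y f1 * deriv_x f2"
  have "coeff2 J 0 0 = 1"
  proof -
    have "coeff2 u1 1 0 = 0" "coeff2 u1 0 1 = 0" "coeff2 u2 1 0 = 0" "coeff2 u2 0 1 = 0"
      using u(1,2) by (auto simp: vanish_def)
    then show ?thesis
      by (simp add: J_def coeff2_mult coeff2_deriv_x coeff2_deriv_y f1_def f2_def coeff2_var_x coeff2_var_y)
  qed
  moreover have "convergent2 J" using cf unfolding J_def by auto
  ultimately obtain I where I: "convergent2 I" "J * I = 1"
    using unit_conv2I[of J] by (auto simp: unit_conv2_def)
  define A where "A = subst22 (fst X) (f1, f2)"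
  define B where "B = subst22 (snd X) (f1, f2)"
  have AB: "convergent2 A" "convergent2 B" "max_ideal A" "max_ideal B"
    using cX cf mi mX by (auto simp: A_def B_def)
  define Z where "Z = (I * (deriv_y f2 * A - deriv_y f1 * B), I * (deriv_x f1 * B - deriv_x f2 * A))"
  have "singular_formal_vf Z" using AB by (auto simp: singular_formal_vf_iff Z_def)
  moreover have "convergent2 (fst Z)" "convergent2 (snd Z)"
    using AB I cf by (auto simp: Z_def)
  ultimately have Z: "singular_holomorphic_vf Z" by (simp add: singular_holomorphic_vf_def)
  have "vf_apply Z f1 = (J * I) * A"
    by (simp add: vf_apply_def Z_def J_def algebra_simps)
  then have Z1: "vf_apply Z f1 = A" using I by simp
  have "vf_apply Z f2 = (J * I) * B"
    by (simp add: vf_apply_def Z_def J_def algebra_simps)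
  then have Z2: "vf_apply Z f2 = B" using I by simp
  define P where "P g \<longleftrightarrow> vf_apply Z (subst22 g (f1, f2)) = subst22 (vf_apply X g) (f1, f2)" for g
  have P_mult: "P (g * h)" if "P g" "P h" for g h
    using that unfolding P_def by (simp add: subst22_mult[OF mi] subst22_add[OF mi] vf_apply_mult)
  have P_power: "P (g ^ n)" if "P g" for g n
  proof (induction n)
    case 0
    show ?case by (simp add: P_def mi)
  next
    case (Suc n)
    then show ?case using P_mult[OF that] by simp
  qed
  have "P var_x" "P var_y" using mi by (simp_all add: P_def Z1 Z2 A_def B_def)
  then have P_mon: "P (mon a b)" for a b unfolding mon_def by (intro P_mult P_power)
  have "vf_apply Z (subst22 g (f1, f2)) = subst22 (vf_apply X g) (f1, f2)" for g
  proof (rule filtered_linear_eqI[where f = g])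
    show "filtered_linear (\<lambda>g. vf_apply Z (subst22 g (f1, f2)))"
      by (rule filtered_linear_compose[OF filtered_linear_vf_apply filtered_linear_subst22[OF mi]])
         (use Z in \<open>simp add: singular_holomorphic_vf_def\<close>)
    show "filtered_linear (\<lambda>g. subst22 (vf_apply X g) (f1, f2))"
      by (rule filtered_linear_compose[OF filtered_linear_subst22[OF mi] filtered_linear_vf_apply[OF sX]])
  qed (use P_mon in \<open>simp add: P_def\<close>)
  then show thesis using that[OF Z] by (simp add: f)
qed

lemma agree_compose_left: "agree m a b \<Longrightarrow> agree m (a oo c) (b oo c)"
  by (auto simp: agree_def fps_compose_nth intro!: sum.cong)

lemma agree_compose_right: "agree m a b \<Longrightarrow> agree m (c oo a) (c oo b)"
  using agree_power[of m a b] by (auto simp: agree_def fps_compose_nth intro!: sum.cong)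

lemma agree_subst2_vanish:
  assumes "vanish m (f - g)" "fps_nth a 0 = 0" "fps_nth b 0 = 0"
  shows "agree m (subst2 f (a, b)) (subst2 g (a, b))"
proof -
  have "fps_nth (subst2 (f - g) (a, b)) k = 0" if "k < m" for k
    using assms(1) that by (auto simp: subst2_def vanish_def intro!: sum.neutral)
  then show ?thesis using assms by (simp add: agree_def subst2_diff)
qed

lemma fps_quotient_agree:
  fixes D q :: "complex fps"
  assumes "D \<noteq> 0" "agree (c + subdegree D) (q * D) 0"
  shows "agree c q 0"
proof (cases "q = 0")
  case False
  have "\<not> subdegree q + subdegree D < c + subdegree D"
  proof
    assume lt: "subdegree q + subdegree D < c + subdegree D"
    have "fps_nth q (subdegree q) * fps_nth D (subdegree D) = fps_nth (q * D) (subdegree q + subdegree D)"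
      by simp
    also have "\<dots> = 0" using assms(2) lt unfolding agree_def fps_zero_nth by blast
    finally show False using False assms(1) by simp
  qed
  then show ?thesis by (auto simp: agree_def intro: nth_less_subdegree_zero)
qed simp

lemma convergent2_trunc2: "convergent2 (trunc2 N f)"
  unfolding trunc2_def mon_def by (intro convergent2_sum convergent2_mult convergent2_power) auto

text \<open>
  The correcting map is sought in the form \<open>f = id + F (k\<^sub>1, k\<^sub>2)\<close>, which fixes \<open>\<alpha>\<close> because \<open>F\<close>
  vanishes there; dividing the error by \<open>F \<circ> \<beta> \<noteq> 0\<close> leaves it in the conductor of \<open>\<beta>\<close>.
\<close>

lemma formal_to_holomorphic:
  assumes \<alpha>: "parametric_pair \<alpha>" and \<beta>: "parametric_pair \<beta>" "irreducible_pair \<beta>"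
    and F: "convergent2 F" "max_ideal F" "subst2 F \<alpha> = 0" "subst2 F \<beta> \<noteq> 0"
    and X: "singular_formal_vf X" and \<rho>: "fps_nth \<rho> 0 = 0" "fps_nth \<rho> 1 \<noteq> 0"
    and conj: "comp_map (exp_vf X) \<alpha> = (fst \<beta> oo \<rho>, snd \<beta> oo \<rho>)"
  obtains Z \<rho>' where "singular_holomorphic_vf Z"
    "fps_conv_radius \<rho>' > 0" "fps_nth \<rho>' 0 = 0" "fps_nth \<rho>' 1 \<noteq> 0"
    "comp_map (exp_vf Z) \<alpha> = (fst \<beta> oo \<rho>', snd \<beta> oo \<rho>')"
proof -
  obtain a1 a2 b1 b2 where ab: "\<alpha> = (a1, a2)" "\<beta> = (b1, b2)" by (metis prod.exhaust)
  have a: "fps_conv_radius a1 > 0" "fps_conv_radius a2 > 0" "fps_nth a1 0 = 0" "fps_nth a2 0 = 0"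
    and b: "fps_conv_radius b1 > 0" "fps_conv_radius b2 > 0" "fps_nth b1 0 = 0" "fps_nth b2 0 = 0"
    using \<alpha> \<beta> by (auto simp: ab parametric_pair_simp)
  obtain c where c: "\<And>w. fps_conv_radius w > 0 \<Longrightarrow> agree c w 0 \<Longrightarrow>
      \<exists>h. convergent2 h \<and> max_ideal h \<and> subst2 h (b1, b2) = w"
    using conductor[OF b] \<beta>(2) unfolding ab by blast
  define D where "D = subst2 F (b1, b2)"
  have D: "fps_conv_radius D > 0" "D \<noteq> 0"
    using fps_conv_radius_subst2[OF F(1) b] F(4) by (simp_all add: D_def ab)
  \<comment> \<open>The quotient of the error by \<open>D\<close> needs order at least
    \<open>c\<close>. The successor gives \<open>N \<ge> 1\<close>, so that the cut-off
    \<open>\<rho>'\<close> keeps the linear term of \<open>\<rho>\<close>.\<close>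
  define N where "N = Suc (c + subdegree D)"
  define Y where "Y = (trunc2 N (fst X), trunc2 N (snd X))"
  have Y: "singular_holomorphic_vf Y" and sY: "singular_formal_vf Y"
    using X by (auto simp: Y_def singular_holomorphic_vf_def singular_formal_vf_def convergent2_trunc2 coeff2_trunc2)
  \<comment> \<open>The change of parameter \<open>\<rho>\<close> is only formal; a convergent one
    is required, and a polynomial with the same jet takes its place.\<close>
  define \<rho>' where "\<rho>' = fps_cutoff (Suc N) \<rho>"
  have "fps_const \<rho>' = trunc2 N (fps_const \<rho>)"
    by (rule fps2_eqI) (auto simp: coeff2_fps_const coeff2_trunc2 \<rho>'_def)
  then have \<rho>'r: "fps_conv_radius \<rho>' > 0" using convergent2_trunc2 by (metis convergent2_fps_const)
  have \<rho>': "fps_nth \<rho>' 0 = 0" "fps_nth \<rho>' 1 \<noteq> 0" using \<rho> by (simp_all add: \<rho>'_def N_def)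
  have ag\<rho>: "agree (Suc N) \<rho> \<rho>'" by (simp add: agree_def \<rho>'_def)
  obtain \<sigma> where \<sigma>: "fps_conv_radius \<sigma> > 0" "fps_nth \<sigma> 0 = 0" "\<rho>' oo \<sigma> = fps_X" "\<sigma> oo \<rho>' = fps_X"
    using convergent_compositional_inverse[OF \<rho>'r \<rho>'] by metis
  define E where "E = exp_vf Y"
  have hE: "convergent2 (fst E)" "convergent2 (snd E)" "max_ideal (fst E)" "max_ideal (snd E)"
    using holomorphic_map_germ_exp_vf[OF Y] by (auto simp: E_def holomorphic_map_germ_def max_ideal_def)
  define e1 where "e1 = subst2 (fst E) (a1, a2)"
  define e2 where "e2 = subst2 (snd E) (a1, a2)"
  have e: "fps_conv_radius e1 > 0" "fps_conv_radius e2 > 0" "fps_nth e1 0 = 0" "fps_nth e2 0 = 0"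
    using hE a by (simp_all add: e1_def e2_def fps_conv_radius_subst2 subst2_nth_0 max_ideal_def)
  have conj': "subst2 (fst (exp_vf X)) (a1, a2) = b1 oo \<rho>" "subst2 (snd (exp_vf X)) (a1, a2) = b2 oo \<rho>"
    using conj by (simp_all add: comp_map_def ab)
  have jet: "vanish (Suc N) (exp_vf_apply Y f - exp_vf_apply X f)" for f
  proof (rule exp_vf_jet[OF sY X])
    have "vanish (Suc N) (- (h - trunc2 N h))" for h by (intro vanish_uminus vanish_trunc2)
    then show "vanish (Suc N) (fst Y - fst X)" "vanish (Suc N) (snd Y - snd X)"
      by (simp_all add: Y_def)
  qed
  have ag_e: "agree (Suc N) e1 (b1 oo \<rho>')" "agree (Suc N) e2 (b2 oo \<rho>')"
  proof -
    have "agree (Suc N) e1 (b1 oo \<rho>)" "agree (Suc N) e2 (b2 oo \<rho>)"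
      unfolding conj'[symmetric] e1_def e2_def E_def exp_vf_def fst_conv snd_conv
      using jet a by (auto intro: agree_subst2_vanish)
    then show "agree (Suc N) e1 (b1 oo \<rho>')" "agree (Suc N) e2 (b2 oo \<rho>')"
      using agree_compose_right[OF ag\<rho>] agree_trans by blast+
  qed
  have cancel: "(s oo \<rho>') oo \<sigma> = s" "(s oo \<sigma>) oo \<rho>' = s" for s
    using fps_compose_assoc[OF \<sigma>(2) \<rho>'(1), of s] fps_compose_assoc[OF \<rho>'(1) \<sigma>(2), of s] \<sigma>(3,4) by simp_all
  \<comment> \<open>By the choice of \<open>c\<close>, the quotient of the error by \<open>D\<close>
    is the restriction to \<open>\<beta>\<close> of some \<open>k\<close>; then \<open>F k\<close>
    reproduces the error on \<open>\<beta>\<close>.\<close>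
  have correction: "\<exists>k. convergent2 k \<and> max_ideal k \<and> subst2 (F * k) (b1, b2) = (s oo \<sigma>) - v"
    if s: "fps_conv_radius s > 0" and v: "fps_conv_radius v > 0" and ag: "agree (Suc N) s (v oo \<rho>')" for s v
  proof -
    define w where "w = (s oo \<sigma>) - v"
    have "agree (Suc N) (s oo \<sigma>) v" using agree_compose_left[OF ag, of \<sigma>] by (simp add: cancel)
    then have w0: "agree (c + subdegree D) w 0" by (simp add: w_def agree_def N_def)
    have "fps_conv_radius w > 0"
      using fps_conv_radius_diff[of "s oo \<sigma>" v] fps_conv_radius_compose[OF s \<sigma>(1,2)] v
      unfolding w_def by (meson less_le_trans min_less_iff_conj)
    moreover have "agree (subdegree D) w 0" using w0 by (rule agree_mono) simp
    ultimately obtain q where q: "fps_conv_radius q > 0" "w = q * D"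
      using fps_divide_convergent[OF D] by metis
    have "agree c q 0" using fps_quotient_agree[OF D(2), of c q] w0 q(2) by simp
    then obtain k where k: "convergent2 k" "max_ideal k" "subst2 k (b1, b2) = q" using c[OF q(1)] by blast
    have "subst2 (F * k) (b1, b2) = D * q" using k(3) b by (simp add: subst2_mult D_def)
    then show ?thesis using k q(2) by (auto simp: w_def mult.commute)
  qed
  obtain k1 where k1: "convergent2 k1" "max_ideal k1" "subst2 (F * k1) (b1, b2) = (e1 oo \<sigma>) - b1"
    using correction[OF e(1) b(1) ag_e(1)] by blast
  obtain k2 where k2: "convergent2 k2" "max_ideal k2" "subst2 (F * k2) (b1, b2) = (e2 oo \<sigma>) - b2"
    using correction[OF e(2) b(2) ag_e(2)] by blast
  define u1 where "u1 = F * k1"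
  define u2 where "u2 = F * k2"
  have u: "vanish 2 u1" "vanish 2 u2" "convergent2 u1" "convergent2 u2"
    using vanish_mult[of 1 F 1 k1] vanish_mult[of 1 F 1 k2] F(1,2) k1 k2
    by (auto simp: u1_def u2_def max_ideal_vanish numeral_2_eq_2)
  define f1 where "f1 = var_x + u1"
  define f2 where "f2 = var_y + u2"
  obtain Z where Z: "singular_holomorphic_vf Z"
    "\<And>g. vf_apply Z (subst22 g (f1, f2)) = subst22 (vf_apply Y g) (f1, f2)"
    unfolding f1_def f2_def using pullback_vf[OF u Y] by metis
  have sZ: "singular_formal_vf Z" using Z(1) by (simp add: singular_holomorphic_vf_def)
  have mf: "max_ideal f1" "max_ideal f2"
    using u(1,2) by (auto simp: f1_def f2_def max_ideal_def vanish_def coeff2_var_x coeff2_var_y)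
  \<comment> \<open>In terms of maps: \<open>f\<close> after \<open>exp(Z)\<close> equals
    \<open>E\<close> after \<open>f\<close>.\<close>
  have twine: "subst22 (subst22 g (f1, f2)) (exp_vf Z) = subst22 (exp_vf_apply Y g) (f1, f2)" for g
    using exp_vf_intertwine[OF sY sZ, of "(f1, f2)" g] mf Z(2)
    by (simp add: exp_vf_apply_eq_subst22[OF sZ])
  have f_a: "subst2 f1 (a1, a2) = a1" "subst2 f2 (a1, a2) = a2"
    using F(3) a by (simp_all add: f1_def f2_def u1_def u2_def subst2_add subst2_mult ab)
  have f_b: "subst2 f1 (b1, b2) = e1 oo \<sigma>" "subst2 f2 (b1, b2) = e2 oo \<sigma>"
    using k1(3) k2(3) b by (simp_all add: f1_def f2_def u1_def u2_def subst2_add)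
  define z1 where "z1 = subst2 (fst (exp_vf Z)) (a1, a2)"
  define z2 where "z2 = subst2 (snd (exp_vf Z)) (a1, a2)"
  have z: "fps_nth z1 0 = 0" "fps_nth z2 0 = 0"
    using max_ideal_exp_vf[OF sZ] a by (simp_all add: z1_def z2_def subst2_nth_0 max_ideal_def)
  have lhs: "subst2 (subst22 g (f1, f2)) (z1, z2) = subst2 (exp_vf_apply Y g) (a1, a2)" for g
  proof -
    have "subst2 (subst22 g (f1, f2)) (z1, z2) = subst2 (subst22 (subst22 g (f1, f2)) (fst (exp_vf Z), snd (exp_vf Z))) (a1, a2)"
      unfolding z1_def z2_def using max_ideal_exp_vf[OF sZ] a by (intro subst2_subst22[symmetric])
    also have "\<dots> = subst2 (subst22 (exp_vf_apply Y g) (f1, f2)) (a1, a2)" by (simp add: twine)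
    also have "\<dots> = subst2 (exp_vf_apply Y g) (a1, a2)"
      using mf a by (subst subst2_subst22) (simp_all add: f_a)
    finally show ?thesis .
  qed
  have rhs: "subst2 f1 (b1 oo \<rho>', b2 oo \<rho>') = e1" "subst2 f2 (b1 oo \<rho>', b2 oo \<rho>') = e2"
    using b \<rho>'(1) by (simp_all add: subst2_compose f_b cancel)
  \<comment> \<open>Since \<open>f\<close> fixes \<open>\<alpha>\<close>, composing \<open>f\<close>
    with \<open>exp(Z) \<circ> \<alpha>\<close> gives \<open>E \<circ> \<alpha>\<close>; by the
    construction of \<open>f\<close> on \<open>\<beta>\<close> this is also
    \<open>f \<circ> \<beta> \<circ> \<rho>'\<close>. It remains to cancel \<open>f\<close>.\<close>
  have "subst2 f1 (z1, z2) = subst2 f1 (b1 oo \<rho>', b2 oo \<rho>')" "subst2 f2 (z1, z2) = subst2 f2 (b1 oo \<rho>', b2 oo \<rho>')"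
    using lhs[of var_x] lhs[of var_y] mf unfolding rhs by (simp_all add: e1_def e2_def E_def exp_vf_def)
  then have "z1 = b1 oo \<rho>' \<and> z2 = b2 oo \<rho>'"
    unfolding f1_def f2_def by (intro tangent_to_identity_injective[OF u(1,2) z]) (simp_all add: b)
  then have "comp_map (exp_vf Z) \<alpha> = (fst \<beta> oo \<rho>', snd \<beta> oo \<rho>')"
    by (simp add: comp_map_def ab z1_def z2_def)
  then show thesis using that[OF Z(1) \<rho>'r \<rho>'] by blast
qed

section \<open>The two implications between completeness and formal completeness\<close>

lemma exp_vf_0: "exp_vf 0 = (var_x, var_y)"
proof -
  have s: "singular_formal_vf 0" by (simp add: singular_formal_vf_def)
  have "exp_vf_apply 0 f = f" for f
  proof (rule coeff2_exp_vf_eqI[OF s])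
    fix i j
    have "vf_apply 0 g = 0" for g by (simp add: vf_apply_def)
    then have "(vf_apply 0 ^^ n) f = (if n = 0 then f else 0)" for n by (cases n) simp_all
    then have "coeff2 ((vf_apply 0 ^^ n) f) i j / fact n = (if n = 0 then coeff2 f i j else 0)" for n by simp
    then show "(\<lambda>n. coeff2 ((vf_apply 0 ^^ n) f) i j / fact n) sums coeff2 f i j"
      using sums_single[of 0 "\<lambda>_. coeff2 f i j"] by simp
  qed
  then show ?thesis by (simp add: exp_vf_def)
qed

lemma maps_germ_exp_vfI:
  assumes Z: "singular_holomorphic_vf Z"
    and \<alpha>: "parametrization \<alpha> \<Gamma>1" and \<beta>: "parametrization \<beta> \<Gamma>2"
    and \<rho>: "fps_conv_radius \<rho> > 0" "fps_nth \<rho> 0 = 0" "fps_nth \<rho> 1 \<noteq> 0"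
    and eq: "comp_map (exp_vf Z) \<alpha> = (fst \<beta> oo \<rho>, snd \<beta> oo \<rho>)"
  shows "maps_germ (eval_map (exp_vf Z)) \<Gamma>1 \<Gamma>2"
  using maps_germ_parametrization[OF holomorphic_map_germ_exp_vf[OF Z] local_inverse_exp_vf[OF Z] \<alpha>]
    parametrization_reparametrize[OF \<beta> \<rho>] eq by simp

text \<open>The correction needs an equation of the source that is not zero on the target. If
  \<open>F1\<close> does not qualify but \<open>F2\<close> is nonzero on \<open>\<alpha>\<close>,
  the construction is run from \<open>\<Gamma>2\<close> to \<open>\<Gamma>1\<close>, with
  \<open>- X\<close> and the inverse of \<open>\<rho>\<close>, and the resulting field changes sign
  at the end. If both vanish, each zero set contains the other and the zero field serves.\<close>

lemma formally_conjugates_imp_maps_germ: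
  assumes \<Gamma>1: "plane_branch \<Gamma>1" and \<Gamma>2: "plane_branch \<Gamma>2"
    and X: "singular_formal_vf X" and conj: "formally_conjugates (exp_vf X) \<Gamma>1 \<Gamma>2"
  shows "\<exists>Z. singular_holomorphic_vf Z \<and> maps_germ (eval_map (exp_vf Z)) \<Gamma>1 \<Gamma>2"
proof -
  obtain \<alpha> \<beta> \<rho> where \<alpha>: "parametrization \<alpha> \<Gamma>1" "irreducible_pair \<alpha>"
    and \<beta>: "parametrization \<beta> \<Gamma>2" "irreducible_pair \<beta>"
    and \<rho>: "fps_nth \<rho> 0 = 0" "fps_nth \<rho> 1 \<noteq> 0"
    and eq: "comp_map (exp_vf X) \<alpha> = (fst \<beta> oo \<rho>, snd \<beta> oo \<rho>)"
    using conj unfolding formally_conjugates_def irreducible_parametrization_iff comp_map_def by blast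
  have pp: "parametric_pair \<alpha>" "parametric_pair \<beta>" using \<alpha> \<beta> by (auto simp: parametrization_iff)
  obtain F1 where F1: "irreducible_conv2 F1" "\<Gamma>1 = germ_of {p. eval2 F1 p = 0}"
    using \<Gamma>1 by (auto simp: plane_branch_def)
  obtain F2 where F2: "irreducible_conv2 F2" "\<Gamma>2 = germ_of {p. eval2 F2 p = 0}"
    using \<Gamma>2 by (auto simp: plane_branch_def)
  have F: "convergent2 F1" "max_ideal F1" "convergent2 F2" "max_ideal F2"
    using F1 F2 max_ideal_if_irreducible_conv2 by (auto simp: irreducible_conv2_def)
  have F1\<alpha>: "subst2 F1 \<alpha> = 0" using \<alpha>(1) F(1) unfolding F1(2) by (rule subst2_eq_0_if_parametrization)
  have F2\<beta>: "subst2 F2 \<beta> = 0" using \<beta>(1) F(3) unfolding F2(2) by (rule subst2_eq_0_if_parametrization)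
  consider "subst2 F1 \<beta> \<noteq> 0" | "subst2 F2 \<alpha> \<noteq> 0" | "subst2 F1 \<beta> = 0" "subst2 F2 \<alpha> = 0" by blast
  then show ?thesis
  proof cases
    case 1
    obtain Z \<rho>' where "singular_holomorphic_vf Z" "fps_conv_radius \<rho>' > 0" "fps_nth \<rho>' 0 = 0" "fps_nth \<rho>' 1 \<noteq> 0"
      "comp_map (exp_vf Z) \<alpha> = (fst \<beta> oo \<rho>', snd \<beta> oo \<rho>')"
      by (rule formal_to_holomorphic[OF pp \<beta>(2) F(1,2) F1\<alpha> 1 X \<rho> eq])
    then show ?thesis using maps_germ_exp_vfI[OF _ \<alpha>(1) \<beta>(1)] by blast
  next
    case 2
    define \<sigma> where "\<sigma> = fps_inv \<rho>"
    have \<sigma>0: "fps_nth \<sigma> 0 = 0" by (simp add: \<sigma>_def fps_inv_def)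
    have \<rho>\<sigma>: "\<rho> oo \<sigma> = fps_X" unfolding \<sigma>_def using \<rho> by (intro fps_inv_right) auto
    have \<sigma>1: "fps_nth \<sigma> 1 \<noteq> 0"
    proof
      assume "fps_nth \<sigma> 1 = 0"
      then have "fps_nth (\<rho> oo \<sigma>) 1 = 0" using \<sigma>0 by (simp add: fps_compose_nth)
      then show False by (simp add: \<rho>\<sigma>)
    qed
    have z: "fps_nth (fst \<alpha>) 0 = 0" "fps_nth (snd \<alpha>) 0 = 0" "fps_nth (fst \<beta>) 0 = 0" "fps_nth (snd \<beta>) 0 = 0"
      using pp by (auto simp: parametric_pair_def)
    have back_comp: "(s oo \<rho>) oo \<sigma> = s" for s
      using fps_compose_assoc[OF \<sigma>0 \<rho>(1), of s] \<rho>\<sigma> by simp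
    \<comment> \<open>Applied to the components of \<open>exp(-X)\<close>, this yields
      \<open>\<alpha> \<circ> \<sigma>\<close>, the conjugacy in the opposite direction.\<close>
    have inv: "subst2 f \<beta> = subst2 (subst22 f (exp_vf X)) \<alpha> oo \<sigma>" for f
    proof -
      have "subst2 (subst22 f (fst (exp_vf X), snd (exp_vf X))) (fst \<alpha>, snd \<alpha>) =
          subst2 f (subst2 (fst (exp_vf X)) (fst \<alpha>, snd \<alpha>), subst2 (snd (exp_vf X)) (fst \<alpha>, snd \<alpha>))"
        using max_ideal_exp_vf[OF X] z by (intro subst2_subst22)
      also have "\<dots> = subst2 f (fst \<beta> oo \<rho>, snd \<beta> oo \<rho>)" using eq by (simp add: comp_map_def)
      also have "\<dots> = subst2 f (fst \<beta>, snd \<beta>) oo \<rho>" using z \<rho> by (intro subst2_compose)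
      finally show ?thesis by (simp add: back_comp)
    qed
    have var: "subst2 var_x \<alpha> = fst \<alpha>" "subst2 var_y \<alpha> = snd \<alpha>"
      using subst2_var[OF z(1,2)] by simp_all
    have eq': "comp_map (exp_vf (- X)) \<beta> = (fst \<alpha> oo \<sigma>, snd \<alpha> oo \<sigma>)"
      by (simp add: comp_map_def inv exp_vf_uminus[OF X] var)
    obtain Z \<rho>' where Z: "singular_holomorphic_vf Z" and *: "fps_conv_radius \<rho>' > 0" "fps_nth \<rho>' 0 = 0" "fps_nth \<rho>' 1 \<noteq> 0"
      "comp_map (exp_vf Z) \<beta> = (fst \<alpha> oo \<rho>', snd \<alpha> oo \<rho>')"
      by (rule formal_to_holomorphic[OF pp(2,1) \<alpha>(2) F(3,4) F2\<beta> 2 singular_formal_vf_uminus[OF X] \<sigma>0 \<sigma>1 eq'])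
    have "maps_germ (eval_map (exp_vf Z)) \<Gamma>2 \<Gamma>1" by (rule maps_germ_exp_vfI[OF Z \<beta>(1) \<alpha>(1) *])
    then have "maps_germ (eval_map (exp_vf (- Z))) \<Gamma>1 \<Gamma>2"
      by (rule maps_germ_inverse[OF local_inverse_exp_vf[OF Z]])
    moreover have "singular_holomorphic_vf (- Z)"
      using Z by (auto simp: singular_holomorphic_vf_def singular_formal_vf_def)
    ultimately show ?thesis by blast
  next
    case 3
    have "\<forall>\<^sub>F p in nhds 0. p \<in> {p. eval2 F2 p = 0} \<longrightarrow> eval2 F1 p = 0"
      using \<beta>(1) F(1) 3(1) unfolding F2(2) by (rule zero_set_if_subst2_eq_0)
    moreover have "\<forall>\<^sub>F p in nhds 0. p \<in> {p. eval2 F1 p = 0} \<longrightarrow> eval2 F2 p = 0"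
      using \<alpha>(1) F(3) 3(2) unfolding F1(2) by (rule zero_set_if_subst2_eq_0)
    ultimately have "\<forall>\<^sub>F p in nhds 0. p \<in> {p. eval2 F1 p = 0} \<longleftrightarrow> p \<in> {p. eval2 F2 p = 0}"
      by eventually_elim auto
    then have "\<Gamma>1 = \<Gamma>2" by (simp only: F1(2) F2(2) germ_of_eq_iff)
    moreover have "singular_holomorphic_vf 0" by (simp add: singular_holomorphic_vf_def singular_formal_vf_def)
    moreover have "comp_map (exp_vf 0) \<alpha> = (fst \<alpha> oo fps_X, snd \<alpha> oo fps_X)"
      using subst2_var[of "fst \<alpha>" "snd \<alpha>"] pp by (simp add: exp_vf_0 comp_map_def parametric_pair_def)
    ultimately show ?thesis
      using maps_germ_exp_vfI[of 0 \<alpha> \<Gamma>1 \<alpha> \<Gamma>2 fps_X] \<alpha>(1) by (intro exI[of _ 0]) simp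
  qed
qed

lemma maps_germ_imp_formally_conjugates:
  assumes \<Gamma>1: "plane_branch \<Gamma>1" and X: "singular_holomorphic_vf X"
    and maps: "maps_germ (eval_map (exp_vf X)) \<Gamma>1 \<Gamma>2"
  shows "formally_conjugates (exp_vf X) \<Gamma>1 \<Gamma>2"
proof -
  obtain \<alpha> where \<alpha>: "parametrization \<alpha> \<Gamma>1" "irreducible_pair \<alpha>"
    using plane_branch_has_irreducible_parametrization[OF \<Gamma>1] unfolding irreducible_parametrization_iff by blast
  let ?\<beta> = "comp_map (exp_vf X) \<alpha>"
  have "parametrization ?\<beta> \<Gamma>2"
    using maps_germ_parametrization[OF holomorphic_map_germ_exp_vf[OF X] local_inverse_exp_vf[OF X] \<alpha>(1)] maps by simp
  moreover have "irreducible_pair ?\<beta>"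
    using \<alpha> by (intro irreducible_pair_exp_vf[OF X]) (simp_all add: parametrization_iff)
  \<comment> \<open>With the image of \<open>\<alpha>\<close> as parametrization of the target, the
    change of parameter is the identity, whence the witness \<open>fps_X\<close>.\<close>
  ultimately show ?thesis
    unfolding formally_conjugates_def irreducible_parametrization_iff using \<alpha>
    by (intro exI[of _ \<alpha>] exI[of _ ?\<beta>] conjI exI[of _ fps_X]) (simp_all add: comp_map_def)
qed

theorem theorem1:
  fixes \<C> :: "plane_germ set"
  assumes "analytic_conjugacy_class \<C>"
  shows "complete_class \<C> \<longleftrightarrow> formally_complete_class \<C>"
proof -
  have branch: "plane_branch \<Gamma>" if "\<Gamma> \<in> \<C>" for \<Gamma>
    using assms that by (auto simp: analytic_conjugacy_class_def quotient_def analytic_conjugacy_def)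
  show ?thesis
  proof
    assume "complete_class \<C>"
    then show "formally_complete_class \<C>"
      unfolding complete_class_def formally_complete_class_def singular_holomorphic_vf_def
      using branch maps_germ_imp_formally_conjugates[unfolded singular_holomorphic_vf_def] by blast
  next
    assume "formally_complete_class \<C>"
    then show "complete_class \<C>"
      unfolding complete_class_def formally_complete_class_def
      using branch formally_conjugates_imp_maps_germ by meson
  qed
qed

end
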